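(* Let $H$ be a Hopf algebra with bijective antipode $S$, let $A$ be a right $H$-comodule transposed Poisson algebra, let $B=A^{AcoH}$, and let $M$ be a transposed Poisson $(A,H)$-Hopf module. Assume that there exists a homomorphism of right $H$-comodules $\phi:H\rightarrow A^A$ which is also an algebra map such that, with $p_M(m)=\phi(S^{-1}(m_{(1)}))\cdot m_{(0)}$ for $m\in M$, $$\{1_A,aa'\}\cdot p_M(m)=\phi(a'_{(1)})\diamond\big(a\cdot p_M(a'_{(0)}\cdot m)\big)\quad\text{for all } a,a'\in A,\ m\in M,$$ and, with $p_A(a)=\phi(S^{-1}(a_{(1)}))a_{(0)}$ for $a\in A$, $$\{1_A,aa'\}\, p_A(a'')=\{\phi(a'_{(1)}),\, a\,p_A(a'_{(0)} a'')\}\quad\text{for all } a,a',a''\in A.$$ Then the functor $G=(-)^{AcoH}:{}_{\mathcal{P}A}\mathcal{M}^H\rightarrow {}_B\mathcal{M}$ is dual Maschke, that is, every object of ${}_{\mathcal{P}A}\mathcal{M}^H$ is $G$-relative projective.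
   Context: $\mathbf{k}$ is a field of characteristic $0$; all vector spaces, algebras and tensor products are over $\mathbf{k}$. $H$ has comultiplication $\Delta(h)=h_1\otimes h_2$, counit $\varepsilon$ and bijective antipode $S$; $H$ is a right $H$-comodule via $\Delta$. Right $H$-coactions are written $m\mapsto m_{(0)}\otimes m_{(1)}$ (implicit sums), and $M^{coH}=\{m\in M: m_{(0)}\otimes m_{(1)}=m\otimes 1_H\}$. Modules over algebras are left unital modules. A transposed Poisson algebra is a commutative associative unital algebra $A$ with a Lie bracket $\{\cdot,\cdot\}$ satisfying $2a\{b,c\}=\{ab,c\}+\{b,ac\}$ for all $a,b,c\in A$. Its transposed Poisson center is $A^A=\{b\in A: b\{a,a'\}=\{ba,a'\}\ \forall a,a'\in A\}$. A right $H$-comodule transposed Poisson algebra is a transposed Poisson algebra $A$ that is a right $H$-comodule algebra (the coaction is a unital algebra map $A\to A\otimes H$) with $\{a,a'\}_{(0)}\otimes\{a,a'\}_{(1)}=\{a_{(0)},a'_{(0)}\}\otimes a_{(1)}a'_{(1)}$ for all $a,a'\in A$. Put $A^{AcoH}=A^A\cap A^{coH}$. $A^A$ is a subalgebra and $H$-subcomodule of $A$. A transposed Poisson $A$-module is a vector space $M$ with an $A$-module structure $\cdot$ and a Lie $A$-module structure $\diamond$ (i.e. $\{a,b\}\diamond m=a\diamond(b\diamond m)-b\diamond(a\diamond m)$) such that $2\{a,b\}\cdot m=a\diamond(b\cdot m)-b\diamond(a\cdot m)$ and $2a\cdot(b\diamond m)=(ab)\diamond m+b\diamond(a\cdot m)$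 for all $a,b\in A$, $m\in M$. Put $M^A=\{m\in M:\{a,a'\}\cdot m=a\diamond(a'\cdot m)\ \forall a,a'\in A\}$ and $M^{AcoH}=M^A\cap M^{coH}$; this is a $B$-submodule of $M$. A transposed Poisson $(A,H)$-Hopf module is a transposed Poisson $A$-module $M$ that is a right $H$-comodule with $(a\cdot m)_{(0)}\otimes(a\cdot m)_{(1)}=a_{(0)}\cdot m_{(0)}\otimes a_{(1)}m_{(1)}$ and $(a\diamond m)_{(0)}\otimes(a\diamond m)_{(1)}=a_{(0)}\diamond m_{(0)}\otimes a_{(1)}m_{(1)}$. ${}_{\mathcal{P}A}\mathcal{M}^H$ is the category of these with maps that are $A$-linear, Lie $A$-linear and $H$-colinear; ${}_B\mathcal{M}$ is the category of $B$-modules. The functor $G$ sends an object $N$ of ${}_{\mathcal{P}A}\mathcal{M}^H$ to $N^{AcoH}$ and acts on morphisms by restriction. For a functor $G:\mathcal{C}\to\mathcal{D}$, an object $P$ of $\mathcal{C}$ is $G$-relative projective if for every morphism $p:C\to C'$ in $\mathcal{C}$ such that $G(p)$ has a right inverse in $\mathcal{D}$, the map $\mathrm{Hom}_{\mathcal{C}}(P,C)\to\mathrm{Hom}_{\mathcal{C}}(P,C')$, $f\mapsto p\circ f$, is surjective.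
   Formalization: As worded (conditions on one M, conclusion for every object) the claim fails, e.g. for H=A=k, zero bracket, M=0; here it is proved that each M admitting such a φ is G-relative projective, and that G is dual Maschke if such a φ exists for every object M. *)

theory Defs
  imports "HOL-Algebra.Module"
begin

section \<open>Vector spaces, linear maps\<close>

text \<open>
  Vector spaces over a field \<open>K\<close> are modules over \<open>K\<close> in the sense of \<^locale>\<open>module\<close>.
  For records that are used only as vector spaces, the fields \<^const>\<open>mult\<close> and
  \<^const>\<open>one\<close> are irrelevant.
\<close>

definition field_char_zero :: "('k, 'z) ring_scheme \<Rightarrow> bool" where
  "field_char_zero K \<longleftrightarrow> field K \<and> (\<forall>n::nat. n > 0 \<longrightarrow> [n] \<cdot>\<^bsub>K\<^esub> \<one>\<^bsub>K\<^esub> \<noteq> \<zero>\<^bsub>K\<^esub>)"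

definition linear_map ::
  "('k, 'z) ring_scheme \<Rightarrow> ('k, 'v, 'x) module_scheme \<Rightarrow> ('k, 'w, 'y) module_scheme \<Rightarrow> ('v \<Rightarrow> 'w) \<Rightarrow> bool"
where
  "linear_map R V W f \<longleftrightarrow>
     f \<in> carrier V \<rightarrow> carrier W \<and>
     (\<forall>x\<in>carrier V. \<forall>y\<in>carrier V. f (x \<oplus>\<^bsub>V\<^esub> y) = f x \<oplus>\<^bsub>W\<^esub> f y) \<and>
     (\<forall>c\<in>carrier R. \<forall>x\<in>carrier V. f (c \<odot>\<^bsub>V\<^esub> x) = c \<odot>\<^bsub>W\<^esub> f x)"

definition bilinear_map ::
  "('k, 'z) ring_scheme \<Rightarrow> ('k, 'u, 'x) module_scheme \<Rightarrow> ('k, 'v, 'y) module_scheme \<Rightarrow>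
   ('k, 'w, 't) module_scheme \<Rightarrow> ('u \<Rightarrow> 'v \<Rightarrow> 'w) \<Rightarrow> bool"
where
  "bilinear_map R U V W \<beta> \<longleftrightarrow>
     (\<forall>u\<in>carrier U. linear_map R V W (\<beta> u)) \<and>
     (\<forall>v\<in>carrier V. linear_map R U W (\<lambda>u. \<beta> u v))"


section \<open>Tensor products\<close>

text \<open>
  A list of pairs stands for the formal sum of the corresponding pure tensors, and
  the tensor product consists of the classes of such lists modulo the congruence
  generated by the bilinearity relations.  Negatives need no separate generators,
  because \<open>(\<ominus>v) \<otimes> w\<close> is the negative of \<open>v \<otimes> w\<close>.
\<close>

inductive tensor_eq ::
  "('k, 'z) ring_scheme \<Rightarrow> ('k, 'v, 'x) module_scheme \<Rightarrow> ('k, 'w, 'y) module_scheme \<Rightarrow>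
   ('v \<times> 'w) list \<Rightarrow> ('v \<times> 'w) list \<Rightarrow> bool"
  for K V W
where
  refl: "set xs \<subseteq> carrier V \<times> carrier W \<Longrightarrow> tensor_eq K V W xs xs"
| sym: "tensor_eq K V W xs ys \<Longrightarrow> tensor_eq K V W ys xs"
| trans: "tensor_eq K V W xs ys \<Longrightarrow> tensor_eq K V W ys zs \<Longrightarrow> tensor_eq K V W xs zs"
| append: "tensor_eq K V W xs ys \<Longrightarrow> tensor_eq K V W us vs \<Longrightarrow> tensor_eq K V W (xs @ us) (ys @ vs)"
| commute: "set xs \<subseteq> carrier V \<times> carrier W \<Longrightarrow> set ys \<subseteq> carrier V \<times> carrier W \<Longrightarrow>
    tensor_eq K V W (xs @ ys) (ys @ xs)"
| add_left: "v \<in> carrier V \<Longrightarrow> v' \<in> carrier V \<Longrightarrow> w \<in> carrier W \<Longrightarrow>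
    tensor_eq K V W [(v \<oplus>\<^bsub>V\<^esub> v', w)] [(v, w), (v', w)]"
| add_right: "v \<in> carrier V \<Longrightarrow> w \<in> carrier W \<Longrightarrow> w' \<in> carrier W \<Longrightarrow>
    tensor_eq K V W [(v, w \<oplus>\<^bsub>W\<^esub> w')] [(v, w), (v, w')]"
| scalar: "c \<in> carrier K \<Longrightarrow> v \<in> carrier V \<Longrightarrow> w \<in> carrier W \<Longrightarrow>
    tensor_eq K V W [(c \<odot>\<^bsub>V\<^esub> v, w)] [(v, c \<odot>\<^bsub>W\<^esub> w)]"
| zero: "w \<in> carrier W \<Longrightarrow> tensor_eq K V W [(\<zero>\<^bsub>V\<^esub>, w)] []"

type_synonym ('v, 'w) tensor_elem = "('v \<times> 'w) list set"

definition tensor_class ::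
  "('k, 'z) ring_scheme \<Rightarrow> ('k, 'v, 'x) module_scheme \<Rightarrow> ('k, 'w, 'y) module_scheme \<Rightarrow>
   ('v \<times> 'w) list \<Rightarrow> ('v, 'w) tensor_elem"
where
  "tensor_class K V W xs = {ys. tensor_eq K V W xs ys}"

definition pure ::
  "('k, 'z) ring_scheme \<Rightarrow> ('k, 'v, 'x) module_scheme \<Rightarrow> ('k, 'w, 'y) module_scheme \<Rightarrow>
   'v \<Rightarrow> 'w \<Rightarrow> ('v, 'w) tensor_elem"
where
  "pure K V W v w = tensor_class K V W [(v, w)]"

text \<open>
  The fields \<^const>\<open>mult\<close> and \<^const>\<open>one\<close> of \<open>tensor K V W\<close> are the usual tensor product of
  algebras; they are meaningful only if \<open>V\<close> and \<open>W\<close> are algebras.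
\<close>

definition tensor ::
  "('k, 'z) ring_scheme \<Rightarrow> ('k, 'v, 'x) module_scheme \<Rightarrow> ('k, 'w, 'y) module_scheme \<Rightarrow>
   ('k, ('v, 'w) tensor_elem) module"
where
  "tensor K V W =
    \<lparr> carrier = tensor_class K V W ` lists (carrier V \<times> carrier W),
      mult = (\<lambda>X Y. \<Union>xs\<in>X. \<Union>ys\<in>Y.
        tensor_class K V W (map (\<lambda>((v, w), (v', w')). (v \<otimes>\<^bsub>V\<^esub> v', w \<otimes>\<^bsub>W\<^esub> w')) (List.product xs ys))),
      one = pure K V W \<one>\<^bsub>V\<^esub> \<one>\<^bsub>W\<^esub>,
      zero = tensor_class K V W [],
      add = (\<lambda>X Y. \<Union>xs\<in>X. \<Union>ys\<in>Y. tensor_class K V W (xs @ ys)),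
      smult = (\<lambda>c X. \<Union>xs\<in>X. tensor_class K V W (map (\<lambda>(v, w). (c \<odot>\<^bsub>V\<^esub> v, w)) xs)) \<rparr>"

text \<open>
  \<open>tensor_lift U \<beta>\<close> is the linear map into \<open>U\<close> induced by the bilinear map \<open>\<beta>\<close>. In Sweedler
  notation, for a tensor \<open>X = x\<^sub>0 \<otimes> x\<^sub>1\<close>, it is \<open>tensor_lift U \<beta> X = \<beta> x\<^sub>0 x\<^sub>1\<close>. The image of \<open>X\<close>
  below is a singleton whenever \<open>\<beta>\<close> is bilinear.
\<close>

definition tensor_lift ::
  "('k, 'u, 'x) module_scheme \<Rightarrow> ('v \<Rightarrow> 'w \<Rightarrow> 'u) \<Rightarrow> ('v, 'w) tensor_elem \<Rightarrow> 'u"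
where
  "tensor_lift U \<beta> X =
     the_elem ((\<lambda>xs. foldr (\<lambda>(v, w) u. \<beta> v w \<oplus>\<^bsub>U\<^esub> u) xs \<zero>\<^bsub>U\<^esub>) ` X)"

definition tensor_map ::
  "('k, 'z) ring_scheme \<Rightarrow> ('k, 'v', 'x) module_scheme \<Rightarrow> ('k, 'w', 'y) module_scheme \<Rightarrow>
   ('v \<Rightarrow> 'v') \<Rightarrow> ('w \<Rightarrow> 'w') \<Rightarrow> ('v, 'w) tensor_elem \<Rightarrow> ('v', 'w') tensor_elem"
where
  "tensor_map K V' W' f g = tensor_lift (tensor K V' W') (\<lambda>v w. pure K V' W' (f v) (g w))"

definition tensor_assoc ::
  "('k, 'z) ring_scheme \<Rightarrow> ('k, 'u, 'x) module_scheme \<Rightarrow> ('k, 'v, 'y) module_scheme \<Rightarrow>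
   ('k, 'w, 't) module_scheme \<Rightarrow>
   (('u, 'v) tensor_elem, 'w) tensor_elem \<Rightarrow> ('u, ('v, 'w) tensor_elem) tensor_elem"
where
  "tensor_assoc K U V W =
     tensor_lift (tensor K U (tensor K V W))
       (\<lambda>X w. tensor_lift (tensor K U (tensor K V W))
         (\<lambda>u v. pure K U (tensor K V W) u (pure K V W v w)) X)"


section \<open>Hopf algebras and comodules\<close>

record ('k, 'h) hopf = "('k, 'h) module" +
  comult :: "'h \<Rightarrow> ('h, 'h) tensor_elem"
  counit :: "'h \<Rightarrow> 'k"
  antipode :: "'h \<Rightarrow> 'h"

definition comodule ::
  "('k, 'z) ring_scheme \<Rightarrow> ('k, 'h) hopf \<Rightarrow> ('k, 'm, 'x) module_scheme \<Rightarrow>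
   ('m \<Rightarrow> ('m, 'h) tensor_elem) \<Rightarrow> bool"
where
  "comodule K H M \<rho> \<longleftrightarrow>
     module K M \<and>
     linear_map K M (tensor K M H) \<rho> \<and>
     (\<forall>m\<in>carrier M.
        tensor_assoc K M H H (tensor_map K (tensor K M H) H \<rho> id (\<rho> m)) =
        tensor_map K M (tensor K H H) id (comult H) (\<rho> m)) \<and>
     (\<forall>m\<in>carrier M. tensor_lift M (\<lambda>m\<^sub>0 h. counit H h \<odot>\<^bsub>M\<^esub> m\<^sub>0) (\<rho> m) = m)"

definition colinear_map ::
  "('k, 'z) ring_scheme \<Rightarrow> ('k, 'h) hopf \<Rightarrow>
   ('k, 'm, 'x) module_scheme \<Rightarrow> ('m \<Rightarrow> ('m, 'h) tensor_elem) \<Rightarrow>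
   ('k, 'n, 'y) module_scheme \<Rightarrow> ('n \<Rightarrow> ('n, 'h) tensor_elem) \<Rightarrow> ('m \<Rightarrow> 'n) \<Rightarrow> bool"
where
  "colinear_map K H M \<rho> N \<sigma> f \<longleftrightarrow>
     linear_map K M N f \<and> (\<forall>m\<in>carrier M. \<sigma> (f m) = tensor_map K N H f id (\<rho> m))"

definition coinvariants ::
  "('k, 'z) ring_scheme \<Rightarrow> ('k, 'h) hopf \<Rightarrow> ('k, 'm, 'x) module_scheme \<Rightarrow>
   ('m \<Rightarrow> ('m, 'h) tensor_elem) \<Rightarrow> 'm set"
where
  "coinvariants K H M \<rho> = {m \<in> carrier M. \<rho> m = pure K M H m \<one>\<^bsub>H\<^esub>}"

text \<open>
  \<open>comodule K H H (comult H)\<close> says that \<open>\<Delta>\<close> is linear and coassociative with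
  \<open>h\<^sub>1 \<epsilon>(h\<^sub>2) = h\<close>; the remaining counit law is stated separately.  The locale
  \<^locale>\<open>algebra\<close> of the library covers commutative algebras only, so it is not used here.
\<close>

definition hopf_algebra :: "('k, 'z) ring_scheme \<Rightarrow> ('k, 'h) hopf \<Rightarrow> bool" where
  "hopf_algebra K H \<longleftrightarrow>
     ring H \<and> module K H \<and> bilinear_map K H H H (mult H) \<and>
     comodule K H H (comult H) \<and>
     (\<forall>h\<in>carrier H. tensor_lift H (\<lambda>h\<^sub>1 h\<^sub>2. counit H h\<^sub>1 \<odot>\<^bsub>H\<^esub> h\<^sub>2) (comult H h) = h) \<and>
     comult H \<in> ring_hom H (tensor K H H) \<and>
     counit H \<in> ring_hom H K \<and>
     (\<forall>c\<in>carrier K. \<forall>h\<in>carrier H. counit H (c \<odot>\<^bsub>H\<^esub> h) = c \<otimes>\<^bsub>K\<^esub> counit H h) \<and>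
     linear_map K H H (antipode H) \<and>
     (\<forall>h\<in>carrier H.
        tensor_lift H (\<lambda>h\<^sub>1 h\<^sub>2. antipode H h\<^sub>1 \<otimes>\<^bsub>H\<^esub> h\<^sub>2) (comult H h) = counit H h \<odot>\<^bsub>H\<^esub> \<one>\<^bsub>H\<^esub> \<and>
        tensor_lift H (\<lambda>h\<^sub>1 h\<^sub>2. h\<^sub>1 \<otimes>\<^bsub>H\<^esub> antipode H h\<^sub>2) (comult H h) = counit H h \<odot>\<^bsub>H\<^esub> \<one>\<^bsub>H\<^esub>)"

definition bijective_antipode :: "('k, 'h) hopf \<Rightarrow> bool" where
  "bijective_antipode H \<longleftrightarrow> bij_betw (antipode H) (carrier H) (carrier H)"

definition antipode_inv :: "('k, 'h) hopf \<Rightarrow> 'h \<Rightarrow> 'h" where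
  "antipode_inv H = inv_into (carrier H) (antipode H)"

text \<open>
  \<open>tensor_act K N H \<beta> X Y\<close> is \<open>\<beta> x\<^sub>0 y\<^sub>0 \<otimes> x\<^sub>1 y\<^sub>1\<close> for \<open>X = x\<^sub>0 \<otimes> x\<^sub>1\<close> and \<open>Y = y\<^sub>0 \<otimes> y\<^sub>1\<close>.
\<close>

definition tensor_act ::
  "('k, 'z) ring_scheme \<Rightarrow> ('k, 'n, 'x) module_scheme \<Rightarrow> ('k, 'h) hopf \<Rightarrow> ('a \<Rightarrow> 'm \<Rightarrow> 'n) \<Rightarrow>
   ('a, 'h) tensor_elem \<Rightarrow> ('m, 'h) tensor_elem \<Rightarrow> ('n, 'h) tensor_elem"
where
  "tensor_act K N H \<beta> X Y =
     tensor_lift (tensor K N H) (\<lambda>x\<^sub>0 x\<^sub>1.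
       tensor_lift (tensor K N H) (\<lambda>y\<^sub>0 y\<^sub>1.
         pure K N H (\<beta> x\<^sub>0 y\<^sub>0) (x\<^sub>1 \<otimes>\<^bsub>H\<^esub> y\<^sub>1)) Y) X"


section \<open>Transposed Poisson algebras and Hopf modules\<close>

record ('k, 'a, 'h) comodule_tpa = "('k, 'a) module" +
  bracket :: "'a \<Rightarrow> 'a \<Rightarrow> 'a"
  alg_coact :: "'a \<Rightarrow> ('a, 'h) tensor_elem"

definition lie_bracket :: "('k, 'z) ring_scheme \<Rightarrow> ('k, 'a, 'x) module_scheme \<Rightarrow> ('a \<Rightarrow> 'a \<Rightarrow> 'a) \<Rightarrow> bool"
where
  "lie_bracket K A br \<longleftrightarrow>
     bilinear_map K A A A br \<and>
     (\<forall>a\<in>carrier A. br a a = \<zero>\<^bsub>A\<^esub>) \<and>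
     (\<forall>a\<in>carrier A. \<forall>b\<in>carrier A. \<forall>c\<in>carrier A.
        br a (br b c) \<oplus>\<^bsub>A\<^esub> br b (br c a) \<oplus>\<^bsub>A\<^esub> br c (br a b) = \<zero>\<^bsub>A\<^esub>)"

definition transposed_poisson_algebra ::
  "('k, 'z) ring_scheme \<Rightarrow> ('k, 'a, 'h) comodule_tpa \<Rightarrow> bool"
where
  "transposed_poisson_algebra K A \<longleftrightarrow>
     algebra K A \<and> lie_bracket K A (bracket A) \<and>
     (\<forall>a\<in>carrier A. \<forall>b\<in>carrier A. \<forall>c\<in>carrier A.
        [(2::nat)] \<cdot>\<^bsub>A\<^esub> (a \<otimes>\<^bsub>A\<^esub> bracket A b c) =
        bracket A (a \<otimes>\<^bsub>A\<^esub> b) c \<oplus>\<^bsub>A\<^esub> bracket A b (a \<otimes>\<^bsub>A\<^esub> c))"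

definition comodule_transposed_poisson_algebra ::
  "('k, 'z) ring_scheme \<Rightarrow> ('k, 'h) hopf \<Rightarrow> ('k, 'a, 'h) comodule_tpa \<Rightarrow> bool"
where
  "comodule_transposed_poisson_algebra K H A \<longleftrightarrow>
     transposed_poisson_algebra K A \<and>
     comodule K H A (alg_coact A) \<and>
     alg_coact A \<in> ring_hom A (tensor K A H) \<and>
     (\<forall>a\<in>carrier A. \<forall>a'\<in>carrier A.
        alg_coact A (bracket A a a') = tensor_act K A H (bracket A) (alg_coact A a) (alg_coact A a'))"

definition transposed_poisson_center :: "('k, 'a, 'h) comodule_tpa \<Rightarrow> 'a set" where
  "transposed_poisson_center A =
     {b \<in> carrier A. \<forall>a\<in>carrier A. \<forall>a'\<in>carrier A.
        b \<otimes>\<^bsub>A\<^esub> bracket A a a' = bracket A (b \<otimes>\<^bsub>A\<^esub> a) a'}"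

record ('k, 'a, 'h, 'm) hopf_mod = "('k, 'm) module" +
  act :: "'a \<Rightarrow> 'm \<Rightarrow> 'm"
  lie_act :: "'a \<Rightarrow> 'm \<Rightarrow> 'm"
  coact :: "'m \<Rightarrow> ('m, 'h) tensor_elem"

definition transposed_poisson_module ::
  "('k, 'z) ring_scheme \<Rightarrow> ('k, 'a, 'h) comodule_tpa \<Rightarrow> ('k, 'a, 'h, 'm) hopf_mod \<Rightarrow> bool"
where
  "transposed_poisson_module K A M \<longleftrightarrow>
     module K M \<and>
     bilinear_map K A M M (act M) \<and>
     (\<forall>m\<in>carrier M. act M \<one>\<^bsub>A\<^esub> m = m) \<and>
     (\<forall>a\<in>carrier A. \<forall>b\<in>carrier A. \<forall>m\<in>carrier M. act M (a \<otimes>\<^bsub>A\<^esub> b) m = act M a (act M b m)) \<and>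
     bilinear_map K A M M (lie_act M) \<and>
     (\<forall>a\<in>carrier A. \<forall>b\<in>carrier A. \<forall>m\<in>carrier M.
        lie_act M (bracket A a b) m = lie_act M a (lie_act M b m) \<ominus>\<^bsub>M\<^esub> lie_act M b (lie_act M a m)) \<and>
     (\<forall>a\<in>carrier A. \<forall>b\<in>carrier A. \<forall>m\<in>carrier M.
        [(2::nat)] \<cdot>\<^bsub>M\<^esub> act M (bracket A a b) m =
        lie_act M a (act M b m) \<ominus>\<^bsub>M\<^esub> lie_act M b (act M a m)) \<and>
     (\<forall>a\<in>carrier A. \<forall>b\<in>carrier A. \<forall>m\<in>carrier M.
        [(2::nat)] \<cdot>\<^bsub>M\<^esub> act M a (lie_act M b m) =
        lie_act M (a \<otimes>\<^bsub>A\<^esub> b) m \<oplus>\<^bsub>M\<^esub> lie_act M b (act M a m))"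

definition transposed_poisson_hopf_module ::
  "('k, 'z) ring_scheme \<Rightarrow> ('k, 'h) hopf \<Rightarrow> ('k, 'a, 'h) comodule_tpa \<Rightarrow>
   ('k, 'a, 'h, 'm) hopf_mod \<Rightarrow> bool"
where
  "transposed_poisson_hopf_module K H A M \<longleftrightarrow>
     transposed_poisson_module K A M \<and>
     comodule K H M (coact M) \<and>
     (\<forall>a\<in>carrier A. \<forall>m\<in>carrier M.
        coact M (act M a m) = tensor_act K M H (act M) (alg_coact A a) (coact M m)) \<and>
     (\<forall>a\<in>carrier A. \<forall>m\<in>carrier M.
        coact M (lie_act M a m) = tensor_act K M H (lie_act M) (alg_coact A a) (coact M m))"

definition hopf_module_hom ::
  "('k, 'z) ring_scheme \<Rightarrow> ('k, 'h) hopf \<Rightarrow> ('k, 'a, 'h) comodule_tpa \<Rightarrow>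
   ('k, 'a, 'h, 'm) hopf_mod \<Rightarrow> ('k, 'a, 'h, 'n) hopf_mod \<Rightarrow> ('m \<Rightarrow> 'n) \<Rightarrow> bool"
where
  "hopf_module_hom K H A M N f \<longleftrightarrow>
     colinear_map K H M (coact M) N (coact N) f \<and>
     (\<forall>a\<in>carrier A. \<forall>m\<in>carrier M. f (act M a m) = act N a (f m)) \<and>
     (\<forall>a\<in>carrier A. \<forall>m\<in>carrier M. f (lie_act M a m) = lie_act N a (f m))"

definition module_center ::
  "('k, 'a, 'h) comodule_tpa \<Rightarrow> ('k, 'a, 'h, 'm) hopf_mod \<Rightarrow> 'm set"
where
  "module_center A M =
     {m \<in> carrier M. \<forall>a\<in>carrier A. \<forall>a'\<in>carrier A.
        act M (bracket A a a') m = lie_act M a (act M a' m)}"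


section \<open>The coinvariants functor and the dual Maschke property\<close>

definition coinv_algebra ::
  "('k, 'z) ring_scheme \<Rightarrow> ('k, 'h) hopf \<Rightarrow> ('k, 'a, 'h) comodule_tpa \<Rightarrow> ('k, 'a, 'h) comodule_tpa"
where
  "coinv_algebra K H A =
     A\<lparr>carrier := transposed_poisson_center A \<inter> coinvariants K H A (alg_coact A)\<rparr>"

text \<open>
  \<open>coinv_algebra\<close> is \<open>B\<close>, and the values of \<open>G_obj\<close> are \<open>B\<close>-modules; the \<open>K\<close>-vector space structure
  of a \<open>B\<close>-module is the one induced by \<open>K \<rightarrow> B\<close>, so \<open>B\<close>-linear maps are automatically \<open>K\<close>-linear.
\<close>

definition G_obj ::
  "('k, 'z) ring_scheme \<Rightarrow> ('k, 'h) hopf \<Rightarrow> ('k, 'a, 'h) comodule_tpa \<Rightarrow>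
   ('k, 'a, 'h, 'm) hopf_mod \<Rightarrow> ('a, 'm) module"
where
  "G_obj K H A M =
     \<lparr> carrier = module_center A M \<inter> coinvariants K H M (coact M),
       mult = mult M, one = one M, zero = zero M, add = add M, smult = act M \<rparr>"

definition G_mor ::
  "('k, 'z) ring_scheme \<Rightarrow> ('k, 'h) hopf \<Rightarrow> ('k, 'a, 'h) comodule_tpa \<Rightarrow>
   ('k, 'a, 'h, 'm) hopf_mod \<Rightarrow> ('m \<Rightarrow> 'n) \<Rightarrow> ('m \<Rightarrow> 'n)"
where
  "G_mor K H A M f = restrict f (carrier (G_obj K H A M))"

text \<open>
  The objects of the category of transposed Poisson Hopf modules are those whose carrier is a
  subset of the type \<open>'m\<close>. This type plays the role of a universe and is arbitrary.
\<close>

definition G_relative_projective ::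
  "('k, 'z) ring_scheme \<Rightarrow> ('k, 'h) hopf \<Rightarrow> ('k, 'a, 'h) comodule_tpa \<Rightarrow>
   ('k, 'a, 'h, 'm) hopf_mod \<Rightarrow> bool"
where
  "G_relative_projective K H A P \<longleftrightarrow>
     (\<forall>(C :: ('k, 'a, 'h, 'm) hopf_mod) (C' :: ('k, 'a, 'h, 'm) hopf_mod) p.
        transposed_poisson_hopf_module K H A C \<and> transposed_poisson_hopf_module K H A C' \<and>
        hopf_module_hom K H A C C' p \<and>
        (\<exists>s. linear_map (coinv_algebra K H A) (G_obj K H A C') (G_obj K H A C) s \<and>
             (\<forall>x\<in>carrier (G_obj K H A C'). G_mor K H A C p (s x) = x)) \<longrightarrow>
        (\<forall>f. hopf_module_hom K H A P C' f \<longrightarrow>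
           (\<exists>g. hopf_module_hom K H A P C g \<and> (\<forall>x\<in>carrier P. p (g x) = f x))))"

definition G_dual_Maschke ::
  "'m itself \<Rightarrow> ('k, 'z) ring_scheme \<Rightarrow> ('k, 'h) hopf \<Rightarrow> ('k, 'a, 'h) comodule_tpa \<Rightarrow> bool"
where
  "G_dual_Maschke (U :: 'm itself) K H A \<longleftrightarrow>
     (\<forall>P :: ('k, 'a, 'h, 'm) hopf_mod.
        transposed_poisson_hopf_module K H A P \<longrightarrow> G_relative_projective K H A P)"


section \<open>The hypotheses on \<open>\<phi>\<close>\<close>

text \<open>
  Colinearity of \<open>\<phi>: H \<rightarrow> A\<^sup>A\<close> is expressed in \<open>A \<otimes> H\<close>, which contains \<open>A\<^sup>A \<otimes> H\<close>;
  the coaction of the subcomodule \<open>A\<^sup>A\<close> is the restriction of that of \<open>A\<close>.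
\<close>

definition comodule_algebra_map ::
  "('k, 'z) ring_scheme \<Rightarrow> ('k, 'h) hopf \<Rightarrow> ('k, 'a, 'h) comodule_tpa \<Rightarrow> ('h \<Rightarrow> 'a) \<Rightarrow> bool"
where
  "comodule_algebra_map K H A \<phi> \<longleftrightarrow>
     \<phi> \<in> carrier H \<rightarrow> transposed_poisson_center A \<and>
     colinear_map K H H (comult H) A (alg_coact A) \<phi> \<and>
     \<phi> \<in> ring_hom H A"

definition p_module ::
  "('k, 'h) hopf \<Rightarrow> ('h \<Rightarrow> 'a) \<Rightarrow> ('k, 'a, 'h, 'm) hopf_mod \<Rightarrow> 'm \<Rightarrow> 'm"
where
  "p_module H \<phi> M m =
     tensor_lift M (\<lambda>m\<^sub>0 m\<^sub>1. act M (\<phi> (antipode_inv H m\<^sub>1)) m\<^sub>0) (coact M m)"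

definition p_algebra ::
  "('k, 'h) hopf \<Rightarrow> ('k, 'a, 'h) comodule_tpa \<Rightarrow> ('h \<Rightarrow> 'a) \<Rightarrow> 'a \<Rightarrow> 'a"
where
  "p_algebra H A \<phi> a =
     tensor_lift A (\<lambda>a\<^sub>0 a\<^sub>1. \<phi> (antipode_inv H a\<^sub>1) \<otimes>\<^bsub>A\<^esub> a\<^sub>0) (alg_coact A a)"

definition module_condition ::
  "('k, 'h) hopf \<Rightarrow> ('k, 'a, 'h) comodule_tpa \<Rightarrow> ('k, 'a, 'h, 'm) hopf_mod \<Rightarrow> ('h \<Rightarrow> 'a) \<Rightarrow> bool"
where
  "module_condition H A M \<phi> \<longleftrightarrow>
     (\<forall>a\<in>carrier A. \<forall>a'\<in>carrier A. \<forall>m\<in>carrier M.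
        act M (bracket A \<one>\<^bsub>A\<^esub> (a \<otimes>\<^bsub>A\<^esub> a')) (p_module H \<phi> M m) =
        tensor_lift M
          (\<lambda>a'\<^sub>0 a'\<^sub>1. lie_act M (\<phi> a'\<^sub>1) (act M a (p_module H \<phi> M (act M a'\<^sub>0 m))))
          (alg_coact A a'))"

definition algebra_condition ::
  "('k, 'h) hopf \<Rightarrow> ('k, 'a, 'h) comodule_tpa \<Rightarrow> ('h \<Rightarrow> 'a) \<Rightarrow> bool"
where
  "algebra_condition H A \<phi> \<longleftrightarrow>
     (\<forall>a\<in>carrier A. \<forall>a'\<in>carrier A. \<forall>a''\<in>carrier A.
        bracket A \<one>\<^bsub>A\<^esub> (a \<otimes>\<^bsub>A\<^esub> a') \<otimes>\<^bsub>A\<^esub> p_algebra H A \<phi> a'' =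
        tensor_lift A
          (\<lambda>a'\<^sub>0 a'\<^sub>1. bracket A (\<phi> a'\<^sub>1) (a \<otimes>\<^bsub>A\<^esub> p_algebra H A \<phi> (a'\<^sub>0 \<otimes>\<^bsub>A\<^esub> a'')))
          (alg_coact A a'))"

end

theory Submission
  imports Defs
begin

text \<open>
  Fix \<open>\<phi>\<close> for an object \<open>P\<close>, and let \<open>B\<close> be the algebra of coinvariants in the transposed Poisson
  center of \<open>A\<close>. The map \<open>p\<^sub>P(m) = \<phi>(S\<^sup>-\<^sup>1(m\<^sub>1)) m\<^sub>0\<close> is a projection of \<open>P\<close> onto \<open>G(P)\<close>, and similarly
  \<open>p\<^sub>A\<close> maps \<open>A\<close> to \<open>B\<close>. The values are coinvariant (lemma \<open>coact_proj\<close>), and they are in the center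
  because it suffices to test brackets of the form \<open>{1,a}\<close> (lemmas \<open>module_centerI\<close> and
  \<open>transposed_poisson_centerI\<close>), for which the hypotheses at \<open>a' = 1\<close> give exactly what is needed.
  The identities

    \<^item> \<open>m = \<phi>(m\<^sub>1) p\<^sub>P(m\<^sub>0)\<close> (lemma \<open>sum_proj\<close>),
    \<^item> \<open>p\<^sub>P(a m) = p\<^sub>A(a) p\<^sub>P(m)\<close> (lemma \<open>proj_act\<close>)

  say that \<open>P\<close> is induced from \<open>G(P)\<close>.

  Let \<open>p: C \<rightarrow> C'\<close> be a morphism, \<open>s\<close> a \<open>B\<close>-linear section of \<open>G(p)\<close>, and \<open>f: P \<rightarrow> C'\<close> a morphism.
  Put \<open>q = s \<circ> f \<circ> p\<^sub>P\<close>, a map from \<open>P\<close> to \<open>G(C)\<close>. The lift of \<open>f\<close> is \<open>g(m) = \<phi>(m\<^sub>1) q(m\<^sub>0)\<close>.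
  Indeed, \<open>p(g(m)) = \<phi>(m\<^sub>1) f(p\<^sub>P(m\<^sub>0)) = f(m)\<close>; colinearity of \<open>g\<close> follows from colinearity of \<open>\<phi>\<close>;
  \<open>A\<close>-linearity follows from \<open>q(a m) = p\<^sub>A(a) q(m)\<close> and \<open>\<phi>(a\<^sub>1) p\<^sub>A(a\<^sub>0) = a\<close>; and Lie linearity
  follows from \<open>A\<close>-linearity, as \<open>a \<diamond> m = {a,\<phi>(m\<^sub>1)} p\<^sub>P(m\<^sub>0)\<close> and likewise
  \<open>a \<diamond> g(m) = {a,\<phi>(m\<^sub>1)} q(m\<^sub>0)\<close>.

  Sweedler calculus takes place in finite sums over representatives of tensors. Linearity in each
  variable is needed only where coassociativity, the counit or another identity between tensors is
  applied.
\<close>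


section \<open>Linear and bilinear maps\<close>

lemma linear_mapI:
  assumes "\<And>x. x \<in> carrier V \<Longrightarrow> f x \<in> carrier W"
    and "\<And>x y. x \<in> carrier V \<Longrightarrow> y \<in> carrier V \<Longrightarrow> f (x \<oplus>\<^bsub>V\<^esub> y) = f x \<oplus>\<^bsub>W\<^esub> f y"
    and "\<And>c x. c \<in> carrier K \<Longrightarrow> x \<in> carrier V \<Longrightarrow> f (c \<odot>\<^bsub>V\<^esub> x) = c \<odot>\<^bsub>W\<^esub> f x"
  shows "linear_map K V W f"
  using assms by (auto simp: linear_map_def)

lemma linear_map_closed: "linear_map K V W f \<Longrightarrow> x \<in> carrier V \<Longrightarrow> f x \<in> carrier W"
  by (auto simp: linear_map_def)

lemma linear_map_add:
  "linear_map K V W f \<Longrightarrow> x \<in> carrier V \<Longrightarrow> y \<in> carrier V \<Longrightarrow> f (x \<oplus>\<^bsub>V\<^esub> y) = f x \<oplus>\<^bsub>W\<^esub> f y"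
  by (auto simp: linear_map_def)

lemma linear_map_smult:
  "linear_map K V W f \<Longrightarrow> c \<in> carrier K \<Longrightarrow> x \<in> carrier V \<Longrightarrow> f (c \<odot>\<^bsub>V\<^esub> x) = c \<odot>\<^bsub>W\<^esub> f x"
  by (auto simp: linear_map_def)

lemma linear_map_zero:
  assumes "module K V" "module K W" "linear_map K V W f"
  shows "f \<zero>\<^bsub>V\<^esub> = \<zero>\<^bsub>W\<^esub>"
proof -
  interpret V: module K V by fact
  interpret W: module K W by fact
  have "f (\<zero>\<^bsub>K\<^esub> \<odot>\<^bsub>V\<^esub> \<zero>\<^bsub>V\<^esub>) = \<zero>\<^bsub>K\<^esub> \<odot>\<^bsub>W\<^esub> f \<zero>\<^bsub>V\<^esub>"
    by (rule linear_map_smult[OF assms(3)]) auto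
  then show ?thesis
    using linear_map_closed[OF assms(3) V.zero_closed] by simp
qed

lemma linear_map_cong:
  assumes "linear_map K V W g" "module K V" "\<And>x. x \<in> carrier V \<Longrightarrow> f x = g x"
  shows "linear_map K V W f"
proof -
  interpret V: module K V by fact
  show ?thesis
    using assms(1,3) by (auto simp: linear_map_def Pi_iff)
qed

lemma linear_map_ident: "linear_map K V V (\<lambda>x. x)"
  by (auto simp: linear_map_def)

lemma linear_map_compose:
  "linear_map K V W g \<Longrightarrow> linear_map K U V f \<Longrightarrow> linear_map K U W (\<lambda>x. g (f x))"
  by (auto simp: linear_map_def Pi_iff)

lemma bilinear_mapI:
  assumes "\<And>u. u \<in> carrier U \<Longrightarrow> linear_map K V W (\<lambda>v. \<beta> u v)"
    and "\<And>v. v \<in> carrier V \<Longrightarrow> linear_map K U W (\<lambda>u. \<beta> u v)"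
  shows "bilinear_map K U V W \<beta>"
  using assms by (auto simp: bilinear_map_def)

lemma bilinear_map_left:
  "bilinear_map K U V W \<beta> \<Longrightarrow> v \<in> carrier V \<Longrightarrow> linear_map K U W (\<lambda>u. \<beta> u v)"
  by (auto simp: bilinear_map_def)

lemma bilinear_map_right:
  "bilinear_map K U V W \<beta> \<Longrightarrow> u \<in> carrier U \<Longrightarrow> linear_map K V W (\<lambda>v. \<beta> u v)"
  by (auto simp: bilinear_map_def)

lemma bilinear_map_closed:
  "bilinear_map K U V W \<beta> \<Longrightarrow> u \<in> carrier U \<Longrightarrow> v \<in> carrier V \<Longrightarrow> \<beta> u v \<in> carrier W"
  by (auto simp: bilinear_map_def linear_map_def)

lemma bilinear_map_comp_left:
  "bilinear_map K U V W \<beta> \<Longrightarrow> linear_map K X U f \<Longrightarrow> v \<in> carrier V \<Longrightarrow>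
   linear_map K X W (\<lambda>x. \<beta> (f x) v)"
  by (rule linear_map_compose[OF bilinear_map_left])

lemma bilinear_map_comp_right:
  "bilinear_map K U V W \<beta> \<Longrightarrow> linear_map K X V f \<Longrightarrow> u \<in> carrier U \<Longrightarrow>
   linear_map K X W (\<lambda>x. \<beta> u (f x))"
  by (rule linear_map_compose[OF bilinear_map_right])

section \<open>Sums over lists of pure tensors\<close>

text \<open>The value \<open>\<Sum> \<beta> v w\<close> of a two-variable map on a formal sum of pure tensors.\<close>

definition list_lift :: "('k, 'u, 'x) module_scheme \<Rightarrow> ('v \<Rightarrow> 'w \<Rightarrow> 'u) \<Rightarrow> ('v \<times> 'w) list \<Rightarrow> 'u" where
  "list_lift U \<beta> xs = foldr (\<lambda>(v, w) u. \<beta> v w \<oplus>\<^bsub>U\<^esub> u) xs \<zero>\<^bsub>U\<^esub>"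

lemma list_lift_Nil [simp]: "list_lift U \<beta> [] = \<zero>\<^bsub>U\<^esub>"
  by (simp add: list_lift_def)

lemma list_lift_Cons [simp]: "list_lift U \<beta> ((v, w) # xs) = \<beta> v w \<oplus>\<^bsub>U\<^esub> list_lift U \<beta> xs"
  by (simp add: list_lift_def)

lemma list_lift_closed:
  assumes "module K U" "\<And>v w. v \<in> carrier V \<Longrightarrow> w \<in> carrier W \<Longrightarrow> \<beta> v w \<in> carrier U"
    and "set xs \<subseteq> carrier V \<times> carrier W"
  shows "list_lift U \<beta> xs \<in> carrier U"
proof -
  interpret U: module K U by fact
  show ?thesis
    using assms(3) by (induction xs) (auto simp: assms(2))
qed

lemma list_lift_cong:
  assumes "\<And>v w. v \<in> carrier V \<Longrightarrow> w \<in> carrier W \<Longrightarrow> \<beta> v w = \<gamma> v w"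
    and "set xs \<subseteq> carrier V \<times> carrier W"
  shows "list_lift U \<beta> xs = list_lift U \<gamma> xs"
  using assms(2) by (induction xs) (auto simp: assms(1))

lemma list_lift_append:
  assumes "module K U" "\<And>v w. v \<in> carrier V \<Longrightarrow> w \<in> carrier W \<Longrightarrow> \<beta> v w \<in> carrier U"
    and "set xs \<subseteq> carrier V \<times> carrier W" "set ys \<subseteq> carrier V \<times> carrier W"
  shows "list_lift U \<beta> (xs @ ys) = list_lift U \<beta> xs \<oplus>\<^bsub>U\<^esub> list_lift U \<beta> ys"
proof -
  interpret U: module K U by fact
  show ?thesis
    using assms(3,4)
    by (induction xs)
       (auto simp: U.add.m_assoc assms(2) list_lift_closed[OF assms(1,2)])
qed

lemma list_lift_linear:
  assumes "module K U" "module K U'" "linear_map K U U' L"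
    and "\<And>v w. v \<in> carrier V \<Longrightarrow> w \<in> carrier W \<Longrightarrow> \<beta> v w \<in> carrier U"
    and "set xs \<subseteq> carrier V \<times> carrier W"
  shows "L (list_lift U \<beta> xs) = list_lift U' (\<lambda>v w. L (\<beta> v w)) xs"
  using assms(5)
  by (induction xs)
     (auto simp: linear_map_zero[OF assms(1-3)] linear_map_add[OF assms(3)] assms(4)
        list_lift_closed[OF assms(1,4)])

lemma list_lift_add:
  assumes "module K U" "\<And>v w. v \<in> carrier V \<Longrightarrow> w \<in> carrier W \<Longrightarrow> \<beta> v w \<in> carrier U"
    and "\<And>v w. v \<in> carrier V \<Longrightarrow> w \<in> carrier W \<Longrightarrow> \<gamma> v w \<in> carrier U"
    and "set xs \<subseteq> carrier V \<times> carrier W"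
  shows "list_lift U (\<lambda>v w. \<beta> v w \<oplus>\<^bsub>U\<^esub> \<gamma> v w) xs = list_lift U \<beta> xs \<oplus>\<^bsub>U\<^esub> list_lift U \<gamma> xs"
proof -
  interpret U: module K U by fact
  show ?thesis
    using assms(4)
  proof (induction xs)
    case (Cons z xs)
    obtain v w where z: "z = (v, w)" by (cases z)
    have "list_lift U \<beta> xs \<in> carrier U" "list_lift U \<gamma> xs \<in> carrier U"
      using Cons.prems by (auto intro!: list_lift_closed[OF assms(1,2)] list_lift_closed[OF assms(1,3)])
    then show ?case
      using Cons z by (auto simp: assms(2,3) U.add.m_ac)
  qed simp
qed

lemma list_lift_smult:
  assumes "module K U" "c \<in> carrier K"
    and "\<And>v w. v \<in> carrier V \<Longrightarrow> w \<in> carrier W \<Longrightarrow> \<beta> v w \<in> carrier U"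
    and "set xs \<subseteq> carrier V \<times> carrier W"
  shows "list_lift U (\<lambda>v w. c \<odot>\<^bsub>U\<^esub> \<beta> v w) xs = c \<odot>\<^bsub>U\<^esub> list_lift U \<beta> xs"
proof -
  interpret U: module K U by fact
  show ?thesis
    using assms(4)
    by (induction xs) (auto simp: assms(2,3) U.smult_r_distr list_lift_closed[OF assms(1,3)])
qed

lemma tensor_eq_closed:
  assumes "module K V" "module K W" "tensor_eq K V W xs ys"
  shows "set xs \<subseteq> carrier V \<times> carrier W \<and> set ys \<subseteq> carrier V \<times> carrier W"
proof -
  interpret V: module K V by fact
  interpret W: module K W by fact
  show ?thesis
    using assms(3) by induction auto
qed

lemma tensor_eq_list_lift:
  assumes "module K V" "module K W" "module K U" "bilinear_map K V W U \<beta>" "tensor_eq K V W xs ys"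
  shows "list_lift U \<beta> xs = list_lift U \<beta> ys"
proof -
  interpret V: module K V by fact
  interpret W: module K W by fact
  interpret U: module K U by fact
  have closed: "\<beta> v w \<in> carrier U" if "v \<in> carrier V" "w \<in> carrier W" for v w
    using bilinear_map_closed[OF assms(4)] that by blast
  show ?thesis
    using assms(5)
  proof induction
    case (append xs ys us vs)
    then show ?case
      using tensor_eq_closed[OF assms(1,2)]
      by (simp add: list_lift_append[where V=V and W=W, OF assms(3) closed])
  next
    case (commute xs ys)
    then show ?case
      by (simp add: list_lift_append[where V=V and W=W, OF assms(3) closed] U.add.m_comm
          list_lift_closed[where V=V and W=W, OF assms(3) closed])
  next
    case (add_left v v' w)
    then show ?case
      by (simp add: linear_map_add[OF bilinear_map_left[OF assms(4)]] closed)
  next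
    case (add_right v w w')
    then show ?case
      by (simp add: linear_map_add[OF bilinear_map_right[OF assms(4)]] closed)
  next
    case (scalar c v w)
    then show ?case
      by (simp add: linear_map_smult[OF bilinear_map_right[OF assms(4)]] closed
          linear_map_smult[OF bilinear_map_left[OF assms(4)]])
  next
    case (zero w)
    then show ?case
      by (simp add: linear_map_zero[OF assms(1,3) bilinear_map_left[OF assms(4)]])
  qed simp_all
qed

section \<open>The tensor product as a vector space\<close>

lemma tensor_eq_self:
  "set xs \<subseteq> carrier V \<times> carrier W \<Longrightarrow> xs \<in> tensor_class K V W xs"
  by (simp add: tensor_class_def tensor_eq.refl)

lemma tensor_class_eqI:
  "tensor_eq K V W xs ys \<Longrightarrow> tensor_class K V W xs = tensor_class K V W ys"
  by (auto simp: tensor_class_def intro: tensor_eq.trans tensor_eq.sym)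

lemma tensor_class_in_carrier:
  "set xs \<subseteq> carrier V \<times> carrier W \<Longrightarrow> tensor_class K V W xs \<in> carrier (tensor K V W)"
  by (auto simp: tensor_def in_lists_conv_set)

lemma tensor_carrierE:
  assumes "X \<in> carrier (tensor K V W)"
  obtains xs where "set xs \<subseteq> carrier V \<times> carrier W" "X = tensor_class K V W xs"
  using assms by (auto simp: tensor_def in_lists_conv_set)

lemma pure_closed [simp]:
  "v \<in> carrier V \<Longrightarrow> w \<in> carrier W \<Longrightarrow> pure K V W v w \<in> carrier (tensor K V W)"
  unfolding pure_def by (rule tensor_class_in_carrier) simp

lemma tensor_add_class:
  assumes "set xs \<subseteq> carrier V \<times> carrier W" "set ys \<subseteq> carrier V \<times> carrier W"
  shows "tensor_class K V W xs \<oplus>\<^bsub>tensor K V W\<^esub> tensor_class K V W ys = tensor_class K V W (xs @ ys)"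
proof -
  have *: "tensor_class K V W (us @ vs) = tensor_class K V W (xs @ ys)"
    if "us \<in> tensor_class K V W xs" "vs \<in> tensor_class K V W ys" for us vs
    using that by (intro tensor_class_eqI) (auto simp: tensor_class_def intro: tensor_eq.append tensor_eq.sym)
  show ?thesis
    unfolding tensor_def using tensor_eq_self[OF assms(1)] tensor_eq_self[OF assms(2)]
    by (auto simp: *)
qed

text \<open>Scalar multiplication of a formal sum.\<close>

definition list_smult :: "('k, 'v, 'x) module_scheme \<Rightarrow> 'k \<Rightarrow> ('v \<times> 'w) list \<Rightarrow> ('v \<times> 'w) list" where
  "list_smult V c xs = map (\<lambda>(v, w). (c \<odot>\<^bsub>V\<^esub> v, w)) xs"

lemma list_smult_simps [simp]:
  "list_smult V c [] = []"
  "list_smult V c ((v, w) # xs) = (c \<odot>\<^bsub>V\<^esub> v, w) # list_smult V c xs"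
  "list_smult V c (xs @ ys) = list_smult V c xs @ list_smult V c ys"
  by (auto simp: list_smult_def)

lemma list_smult_closed:
  assumes "module K V" "c \<in> carrier K" "set xs \<subseteq> carrier V \<times> carrier W"
  shows "set (list_smult V c xs) \<subseteq> carrier V \<times> carrier W"
proof -
  interpret V: module K V by fact
  show ?thesis using assms(2,3) by (auto simp: list_smult_def)
qed

lemma tensor_eq_list_smult:
  assumes "module K V" "module K W" "c \<in> carrier K" "tensor_eq K V W xs ys"
  shows "tensor_eq K V W (list_smult V c xs) (list_smult V c ys)"
proof -
  interpret V: module K V by fact
  interpret W: module K W by fact
  show ?thesis
    using assms(4)
  proof induction
    case (scalar d v w)
    have "tensor_eq K V W [(c \<odot>\<^bsub>V\<^esub> (d \<odot>\<^bsub>V\<^esub> v), w)] [(c \<odot>\<^bsub>V\<^esub> v, d \<odot>\<^bsub>W\<^esub> w)]"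
      using tensor_eq.scalar[of d K "c \<odot>\<^bsub>V\<^esub> v" V w W] scalar assms(3)
      by (simp add: V.smult_assoc1[symmetric] V.R.m_comm)
    then show ?case by simp
  next
    case (refl xs)
    then show ?case
      by (intro tensor_eq.refl list_smult_closed[OF assms(1,3)])
  next
    case (commute xs ys)
    then show ?case
      unfolding list_smult_simps by (intro tensor_eq.commute list_smult_closed[OF assms(1,3)])
  qed (use assms(3) in \<open>auto simp: V.smult_r_distr intro: tensor_eq.intros\<close>)
qed

lemma tensor_smult_class:
  assumes "module K V" "module K W" "c \<in> carrier K" "set xs \<subseteq> carrier V \<times> carrier W"
  shows "c \<odot>\<^bsub>tensor K V W\<^esub> tensor_class K V W xs = tensor_class K V W (list_smult V c xs)"
proof -
  have *: "tensor_class K V W (list_smult V c us) = tensor_class K V W (list_smult V c xs)"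
    if "us \<in> tensor_class K V W xs" for us
    using that by (intro tensor_class_eqI)
      (auto simp: tensor_class_def intro: tensor_eq_list_smult[OF assms(1-3)] tensor_eq.sym)
  show ?thesis
    unfolding tensor_def using tensor_eq_self[OF assms(4)]
    by (auto simp: * list_smult_def[symmetric])
qed

lemma tensor_zero_class: "\<zero>\<^bsub>tensor K V W\<^esub> = tensor_class K V W []"
  by (simp add: tensor_def)

lemma tensor_eq_inverse:
  assumes "module K V" "module K W" "set xs \<subseteq> carrier V \<times> carrier W"
  shows "tensor_eq K V W (list_smult V (\<ominus>\<^bsub>K\<^esub> \<one>\<^bsub>K\<^esub>) xs @ xs) []"
proof -
  interpret V: module K V by fact
  interpret W: module K W by fact
  let ?m = "\<ominus>\<^bsub>K\<^esub> \<one>\<^bsub>K\<^esub>"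
  show ?thesis
    using assms(3)
  proof (induction xs)
    case Nil
    then show ?case by (simp add: tensor_eq.refl)
  next
    case (Cons z xs)
    obtain v w where z: "z = (v, w)" by (cases z)
    have v: "v \<in> carrier V" and w: "w \<in> carrier W" and xs: "set xs \<subseteq> carrier V \<times> carrier W"
      using Cons.prems z by auto
    have mv: "?m \<odot>\<^bsub>V\<^esub> v \<in> carrier V" using v by simp
    let ?ys = "list_smult V ?m xs"
    have ys: "set ?ys \<subseteq> carrier V \<times> carrier W"
      by (rule list_smult_closed[OF assms(1) _ xs]) simp
    have "?m \<odot>\<^bsub>V\<^esub> v \<oplus>\<^bsub>V\<^esub> v = \<zero>\<^bsub>V\<^esub>"
      using v by (simp add: V.smult_l_minus V.M.l_neg)
    then have cancel: "tensor_eq K V W [(?m \<odot>\<^bsub>V\<^esub> v, w), (v, w)] []"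
      using tensor_eq.add_left[OF mv v w] tensor_eq.zero[OF w] tensor_eq.sym tensor_eq.trans by metis
    have swap: "tensor_eq K V W (?ys @ [(v, w)]) ([(v, w)] @ ?ys)"
      by (rule tensor_eq.commute) (use ys v w in auto)
    have 1: "tensor_eq K V W ([(?m \<odot>\<^bsub>V\<^esub> v, w)] @ (?ys @ [(v, w)]) @ xs)
                      ([(?m \<odot>\<^bsub>V\<^esub> v, w)] @ ([(v, w)] @ ?ys) @ xs)"
      by (rule tensor_eq.append[OF tensor_eq.refl tensor_eq.append[OF swap tensor_eq.refl]])
        (use mv w xs in auto)
    have 2: "tensor_eq K V W ([(?m \<odot>\<^bsub>V\<^esub> v, w), (v, w)] @ (?ys @ xs)) ([] @ [])"
      by (rule tensor_eq.append) (use cancel Cons.IH xs in auto)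
    have "tensor_eq K V W ([(?m \<odot>\<^bsub>V\<^esub> v, w)] @ (?ys @ [(v, w)]) @ xs) []"
      using tensor_eq.trans[OF 1] 2 by simp
    then show ?case using z by simp
  qed
qed

lemma tensor_module:
  assumes "module K V" "module K W"
  shows "module K (tensor K V W)"
proof -
  interpret V: module K V by fact
  interpret W: module K W by fact
  let ?T = "tensor K V W" and ?c = "tensor_class K V W"
  note add = tensor_add_class[of _ V W _ K] and smult = tensor_smult_class[OF assms]
  note closed = list_smult_closed[OF assms(1)]
  have group: "abelian_group ?T"
  proof (rule abelian_groupI)
    fix X Y assume "X \<in> carrier ?T" "Y \<in> carrier ?T"
    then obtain xs ys where 1: "set xs \<subseteq> carrier V \<times> carrier W" "X = ?c xs"
       "set ys \<subseteq> carrier V \<times> carrier W" "Y = ?c ys" by (metis tensor_carrierE)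
    show "X \<oplus>\<^bsub>?T\<^esub> Y \<in> carrier ?T"
      using 1 by (simp add: add tensor_class_in_carrier)
    show "X \<oplus>\<^bsub>?T\<^esub> Y = Y \<oplus>\<^bsub>?T\<^esub> X"
      using 1 by (simp add: add tensor_eq.commute tensor_class_eqI)
  next
    fix X Y Z assume "X \<in> carrier ?T" "Y \<in> carrier ?T" "Z \<in> carrier ?T"
    then obtain xs ys zs where "set xs \<subseteq> carrier V \<times> carrier W" "X = ?c xs"
       "set ys \<subseteq> carrier V \<times> carrier W" "Y = ?c ys"
       "set zs \<subseteq> carrier V \<times> carrier W" "Z = ?c zs" by (metis tensor_carrierE)
    then show "X \<oplus>\<^bsub>?T\<^esub> Y \<oplus>\<^bsub>?T\<^esub> Z = X \<oplus>\<^bsub>?T\<^esub> (Y \<oplus>\<^bsub>?T\<^esub> Z)"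
      by (simp add: add)
  next
    show "\<zero>\<^bsub>?T\<^esub> \<in> carrier ?T"
      by (simp add: tensor_zero_class tensor_class_in_carrier)
  next
    fix X assume "X \<in> carrier ?T"
    then obtain xs where 1: "set xs \<subseteq> carrier V \<times> carrier W" "X = ?c xs" by (metis tensor_carrierE)
    then show "\<zero>\<^bsub>?T\<^esub> \<oplus>\<^bsub>?T\<^esub> X = X"
      by (simp add: tensor_zero_class add)
    let ?ys = "list_smult V (\<ominus>\<^bsub>K\<^esub> \<one>\<^bsub>K\<^esub>) xs"
    have "set ?ys \<subseteq> carrier V \<times> carrier W"
      by (rule closed) (use 1 in auto)
    then have "?c ?ys \<in> carrier ?T \<and> ?c ?ys \<oplus>\<^bsub>?T\<^esub> X = \<zero>\<^bsub>?T\<^esub>"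
      using 1 tensor_eq_inverse[OF assms 1(1)]
      by (simp add: add tensor_zero_class tensor_class_in_carrier tensor_class_eqI)
    then show "\<exists>Y\<in>carrier ?T. Y \<oplus>\<^bsub>?T\<^esub> X = \<zero>\<^bsub>?T\<^esub>" by blast
  qed
  have ldistr: "tensor_eq K V W (list_smult V (a \<oplus>\<^bsub>K\<^esub> b) xs) (list_smult V a xs @ list_smult V b xs)"
    if "a \<in> carrier K" "b \<in> carrier K" "set xs \<subseteq> carrier V \<times> carrier W" for a b xs
    using that(3)
  proof (induction xs)
    case (Cons z xs)
    obtain v w where z: "z = (v, w)" by (cases z)
    have v: "v \<in> carrier V" and w: "w \<in> carrier W" and xs: "set xs \<subseteq> carrier V \<times> carrier W"
      using Cons.prems z by auto
    let ?a = "list_smult V a xs" and ?b = "list_smult V b xs"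
    have ab: "set ?a \<subseteq> carrier V \<times> carrier W" "set ?b \<subseteq> carrier V \<times> carrier W"
      using closed that xs by auto
    have "tensor_eq K V W ([((a \<oplus>\<^bsub>K\<^esub> b) \<odot>\<^bsub>V\<^esub> v, w)] @ list_smult V (a \<oplus>\<^bsub>K\<^esub> b) xs)
            ([(a \<odot>\<^bsub>V\<^esub> v, w), (b \<odot>\<^bsub>V\<^esub> v, w)] @ (?a @ ?b))"
      using v w that Cons.IH[OF xs]
      by (intro tensor_eq.append) (auto simp: V.smult_l_distr intro!: tensor_eq.add_left)
    moreover have "tensor_eq K V W ([(a \<odot>\<^bsub>V\<^esub> v, w)] @ ([(b \<odot>\<^bsub>V\<^esub> v, w)] @ ?a) @ ?b)
       ([(a \<odot>\<^bsub>V\<^esub> v, w)] @ (?a @ [(b \<odot>\<^bsub>V\<^esub> v, w)]) @ ?b)"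
      using v w that ab by (intro tensor_eq.append tensor_eq.refl tensor_eq.commute) auto
    ultimately show ?case
      using z tensor_eq.trans by fastforce
  qed (simp add: tensor_eq.refl)
  show ?thesis
  proof (rule moduleI[OF V.R.is_cring group])
    fix a X assume a: "a \<in> carrier K" and "X \<in> carrier ?T"
    then obtain xs where 1: "set xs \<subseteq> carrier V \<times> carrier W" "X = ?c xs" by (metis tensor_carrierE)
    then show "a \<odot>\<^bsub>?T\<^esub> X \<in> carrier ?T"
      using a by (simp add: smult closed tensor_class_in_carrier)
  next
    fix a b X assume ab: "a \<in> carrier K" "b \<in> carrier K" and "X \<in> carrier ?T"
    then obtain xs where 1: "set xs \<subseteq> carrier V \<times> carrier W" "X = ?c xs" by (metis tensor_carrierE)
    show "(a \<oplus>\<^bsub>K\<^esub> b) \<odot>\<^bsub>?T\<^esub> X = a \<odot>\<^bsub>?T\<^esub> X \<oplus>\<^bsub>?T\<^esub> b \<odot>\<^bsub>?T\<^esub> X"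
      using 1 ab by (simp add: smult closed add tensor_class_eqI ldistr)
    have "list_smult V (a \<otimes>\<^bsub>K\<^esub> b) xs = list_smult V a (list_smult V b xs)"
      using 1 ab by (auto simp: list_smult_def V.smult_assoc1)
    then show "(a \<otimes>\<^bsub>K\<^esub> b) \<odot>\<^bsub>?T\<^esub> X = a \<odot>\<^bsub>?T\<^esub> (b \<odot>\<^bsub>?T\<^esub> X)"
      using 1 ab by (simp add: smult closed)
  next
    fix a X Y assume a: "a \<in> carrier K" and "X \<in> carrier ?T" "Y \<in> carrier ?T"
    then obtain xs ys where 1: "set xs \<subseteq> carrier V \<times> carrier W" "X = ?c xs"
       "set ys \<subseteq> carrier V \<times> carrier W" "Y = ?c ys" by (metis tensor_carrierE)
    then show "a \<odot>\<^bsub>?T\<^esub> (X \<oplus>\<^bsub>?T\<^esub> Y) = a \<odot>\<^bsub>?T\<^esub> X \<oplus>\<^bsub>?T\<^esub> a \<odot>\<^bsub>?T\<^esub> Y"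
      using a by (simp add: smult closed add)
  next
    fix X assume "X \<in> carrier ?T"
    then obtain xs where 1: "set xs \<subseteq> carrier V \<times> carrier W" "X = ?c xs" by (metis tensor_carrierE)
    then have "list_smult V \<one>\<^bsub>K\<^esub> xs = xs"
      by (auto simp: list_smult_def intro!: map_idI)
    then show "\<one>\<^bsub>K\<^esub> \<odot>\<^bsub>?T\<^esub> X = X"
      using 1 by (simp add: smult)
  qed
qed

lemma pure_bilinear:
  assumes "module K V" "module K W"
  shows "bilinear_map K V W (tensor K V W) (pure K V W)"
proof -
  interpret V: module K V by fact
  interpret W: module K W by fact
  have s: "tensor_class K V W [(v, c \<odot>\<^bsub>W\<^esub> w)] = tensor_class K V W [(c \<odot>\<^bsub>V\<^esub> v, w)]"
    if "c \<in> carrier K" "v \<in> carrier V" "w \<in> carrier W" for c v w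
    using that by (intro tensor_class_eqI tensor_eq.sym[OF tensor_eq.scalar])
  show ?thesis
    by (intro bilinear_mapI linear_mapI; (simp; fail)?)
       (auto simp: pure_def tensor_add_class tensor_smult_class[OF assms] s
          intro!: tensor_class_eqI tensor_eq.add_left tensor_eq.add_right)
qed

lemma list_lift_pure:
  assumes "module K V" "module K W" "set xs \<subseteq> carrier V \<times> carrier W"
  shows "list_lift (tensor K V W) (pure K V W) xs = tensor_class K V W xs"
  using assms(3)
  by (induction xs) (auto simp: tensor_zero_class pure_def tensor_add_class)


section \<open>Sweedler sums\<close>

text \<open>
  \<open>sw U X \<beta>\<close> is the Sweedler sum \<open>\<beta> x\<^sub>0 x\<^sub>1\<close> for a tensor \<open>X = x\<^sub>0 \<otimes> x\<^sub>1\<close>, taken over an arbitrary but fixed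
  representative of \<open>X\<close>. In contrast to \<^const>\<open>tensor_lift\<close>, it is a genuine finite sum even if
  \<open>\<beta>\<close> is not bilinear.  It can therefore be moved through linear maps and interchanged with other
  sums without any condition on \<open>\<beta>\<close> but closure.
\<close>

definition sw ::
  "('k, 'u, 'x) module_scheme \<Rightarrow> ('v, 'w) tensor_elem \<Rightarrow> ('v \<Rightarrow> 'w \<Rightarrow> 'u) \<Rightarrow> 'u" where
  "sw U X \<beta> = list_lift U \<beta> (SOME xs. xs \<in> X)"

lemma tensor_rep:
  assumes "module K V" "module K W" "X \<in> carrier (tensor K V W)"
  shows "set (SOME xs. xs \<in> X) \<subseteq> carrier V \<times> carrier W"
    and "tensor_class K V W (SOME xs. xs \<in> X) = X"
proof -
  obtain xs where xs: "set xs \<subseteq> carrier V \<times> carrier W" "X = tensor_class K V W xs"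
    using assms(3) by (rule tensor_carrierE)
  then have "(SOME xs. xs \<in> X) \<in> X"
    using tensor_eq_self[OF xs(1)] by (metis someI_ex)
  then have "tensor_eq K V W xs (SOME xs. xs \<in> X)"
    using xs by (simp add: tensor_class_def)
  then show "set (SOME xs. xs \<in> X) \<subseteq> carrier V \<times> carrier W"
    and "tensor_class K V W (SOME xs. xs \<in> X) = X"
    using tensor_eq_closed[OF assms(1,2)] tensor_class_eqI[of K V W] xs by blast+
qed

lemma sw_closed:
  assumes "module K V" "module K W" "module K U" "X \<in> carrier (tensor K V W)"
    and "\<And>v w. v \<in> carrier V \<Longrightarrow> w \<in> carrier W \<Longrightarrow> \<beta> v w \<in> carrier U"
  shows "sw U X \<beta> \<in> carrier U"
  unfolding sw_def by (rule list_lift_closed[OF assms(3,5) tensor_rep(1)[OF assms(1,2,4)]])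

lemma sw_cong:
  assumes "module K V" "module K W" "X \<in> carrier (tensor K V W)"
    and "\<And>v w. v \<in> carrier V \<Longrightarrow> w \<in> carrier W \<Longrightarrow> \<beta> v w = \<gamma> v w"
  shows "sw U X \<beta> = sw U X \<gamma>"
  unfolding sw_def by (rule list_lift_cong[OF assms(4) tensor_rep(1)[OF assms(1-3)]])

text \<open>A linear map may be applied under a Sweedler sum.\<close>

lemma sw_linear:
  assumes "module K V" "module K W" "module K U" "module K U'" "X \<in> carrier (tensor K V W)"
    and "linear_map K U U' L"
    and "\<And>v w. v \<in> carrier V \<Longrightarrow> w \<in> carrier W \<Longrightarrow> \<beta> v w \<in> carrier U"
  shows "L (sw U X \<beta>) = sw U' X (\<lambda>v w. L (\<beta> v w))"
  unfolding sw_def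
  by (rule list_lift_linear[OF assms(3,4,6,7) tensor_rep(1)[OF assms(1,2,5)]])

lemma linear_map_sw:
  assumes "module K V" "module K W" "module K U" "module K Z" "X \<in> carrier (tensor K V W)"
    and "\<And>v w. v \<in> carrier V \<Longrightarrow> w \<in> carrier W \<Longrightarrow> linear_map K Z U (\<lambda>z. \<beta> z v w)"
  shows "linear_map K Z U (\<lambda>z. sw U X (\<beta> z))"
proof (rule linear_mapI)
  interpret Z: module K Z by fact
  note rep = tensor_rep(1)[OF assms(1,2,5)]
  note closed = linear_map_closed[OF assms(6)]
  fix z assume z: "z \<in> carrier Z"
  then show "sw U X (\<beta> z) \<in> carrier U"
    by (intro sw_closed[OF assms(1-3,5)] closed)
  show "sw U X (\<beta> (z \<oplus>\<^bsub>Z\<^esub> z')) = sw U X (\<beta> z) \<oplus>\<^bsub>U\<^esub> sw U X (\<beta> z')" if "z' \<in> carrier Z" for z'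
  proof -
    have "sw U X (\<beta> (z \<oplus>\<^bsub>Z\<^esub> z')) = sw U X (\<lambda>v w. \<beta> z v w \<oplus>\<^bsub>U\<^esub> \<beta> z' v w)"
      by (rule sw_cong[OF assms(1,2,5)]) (use z that linear_map_add[OF assms(6)] in auto)
    also have "\<dots> = sw U X (\<beta> z) \<oplus>\<^bsub>U\<^esub> sw U X (\<beta> z')"
      unfolding sw_def by (rule list_lift_add[OF assms(3) _ _ rep]) (use z that closed in auto)
    finally show ?thesis .
  qed
  show "sw U X (\<beta> (c \<odot>\<^bsub>Z\<^esub> z)) = c \<odot>\<^bsub>U\<^esub> sw U X (\<beta> z)" if "c \<in> carrier K" for c
  proof -
    have "sw U X (\<beta> (c \<odot>\<^bsub>Z\<^esub> z)) = sw U X (\<lambda>v w. c \<odot>\<^bsub>U\<^esub> \<beta> z v w)"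
      by (rule sw_cong[OF assms(1,2,5)]) (use z that linear_map_smult[OF assms(6)] in auto)
    also have "\<dots> = c \<odot>\<^bsub>U\<^esub> sw U X (\<beta> z)"
      unfolding sw_def by (rule list_lift_smult[OF assms(3) that _ rep]) (use z closed in auto)
    finally show ?thesis .
  qed
qed

lemma list_lift_zero:
  assumes "module K U" shows "list_lift U (\<lambda>v w. \<zero>\<^bsub>U\<^esub>) xs = \<zero>\<^bsub>U\<^esub>"
proof -
  interpret U: module K U by fact
  show ?thesis by (induction xs) auto
qed

lemma sw_swap:
  assumes "module K V" "module K W" "module K V'" "module K W'" "module K U"
    and "X \<in> carrier (tensor K V W)" "Y \<in> carrier (tensor K V' W')"
    and "\<And>v w v' w'. v \<in> carrier V \<Longrightarrow> w \<in> carrier W \<Longrightarrow> v' \<in> carrier V' \<Longrightarrow> w' \<in> carrier W' \<Longrightarrow>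
      \<beta> v w v' w' \<in> carrier U"
  shows "sw U X (\<lambda>v w. sw U Y (\<beta> v w)) = sw U Y (\<lambda>v' w'. sw U X (\<lambda>v w. \<beta> v w v' w'))"
proof -
  interpret U: module K U by fact
  note repX = tensor_rep(1)[OF assms(1,2,6)] and repY = tensor_rep(1)[OF assms(3,4,7)]
  have "list_lift U (\<lambda>v w. list_lift U (\<beta> v w) ys) xs =
        list_lift U (\<lambda>v' w'. list_lift U (\<lambda>v w. \<beta> v w v' w') xs) ys"
    if xs: "set xs \<subseteq> carrier V \<times> carrier W" and ys: "set ys \<subseteq> carrier V' \<times> carrier W'" for xs ys
    using xs
  proof (induction xs)
    case Nil
    then show ?case by (simp add: list_lift_zero[OF assms(5)])
  next
    case (Cons z xs)
    obtain v w where z: "z = (v, w)" by (cases z)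
    then have vw: "v \<in> carrier V" "w \<in> carrier W" and xs: "set xs \<subseteq> carrier V \<times> carrier W"
      using Cons.prems by auto
    have "list_lift U (\<lambda>v' w'. \<beta> v w v' w' \<oplus>\<^bsub>U\<^esub> list_lift U (\<lambda>v w. \<beta> v w v' w') xs) ys =
      list_lift U (\<beta> v w) ys \<oplus>\<^bsub>U\<^esub> list_lift U (\<lambda>v' w'. list_lift U (\<lambda>v w. \<beta> v w v' w') xs) ys"
      by (rule list_lift_add[OF assms(5) _ _ ys])
         (auto intro!: assms(8) vw list_lift_closed[OF assms(5) _ xs])
    then show ?case
      using Cons.IH[OF xs] z by simp
  qed
  then show ?thesis
    unfolding sw_def using repX repY by blast
qed

lemma sw_tensor_class:
  assumes "module K V" "module K W" "module K U" "bilinear_map K V W U \<beta>"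
    and "set xs \<subseteq> carrier V \<times> carrier W"
  shows "sw U (tensor_class K V W xs) \<beta> = list_lift U \<beta> xs"
proof -
  have "tensor_class K V W (SOME ys. ys \<in> tensor_class K V W xs) = tensor_class K V W xs"
    by (rule tensor_rep(2)[OF assms(1,2) tensor_class_in_carrier[OF assms(5)]])
  then have "tensor_eq K V W (SOME ys. ys \<in> tensor_class K V W xs) xs"
    using tensor_eq.refl[OF assms(5)] by (auto simp: tensor_class_def)
  then show ?thesis
    unfolding sw_def by (rule tensor_eq_list_lift[OF assms(1-4)])
qed

text \<open>For bilinear \<open>\<beta>\<close>, the Sweedler sum does not depend on the representative and agrees with the
  induced linear map.\<close>

lemma tensor_lift_eq_sw:
  assumes "module K V" "module K W" "module K U" "X \<in> carrier (tensor K V W)"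
    and "bilinear_map K V W U \<beta>"
  shows "tensor_lift U \<beta> X = sw U X \<beta>"
proof -
  obtain xs where xs: "set xs \<subseteq> carrier V \<times> carrier W" "X = tensor_class K V W xs"
    using assms(4) by (rule tensor_carrierE)
  have "list_lift U \<beta> ` X = {list_lift U \<beta> xs}"
    using tensor_eq_list_lift[OF assms(1-3,5)] xs tensor_eq_self[OF xs(1)]
    by (fastforce simp: tensor_class_def)
  then show ?thesis
    using sw_tensor_class[OF assms(1-3,5) xs(1)] xs
    by (simp add: tensor_lift_def list_lift_def[abs_def])
qed

lemma sw_pure:
  assumes "module K V" "module K W" "module K U" "bilinear_map K V W U \<beta>"
    and "v \<in> carrier V" "w \<in> carrier W"
  shows "sw U (pure K V W v w) \<beta> = \<beta> v w"
proof -
  interpret U: module K U by fact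
  show ?thesis
    unfolding pure_def
    using sw_tensor_class[OF assms(1-4), of "[(v, w)]"] assms(5,6) bilinear_map_closed[OF assms(4-6)]
    by simp
qed

lemma sw_pure_self:
  assumes "module K V" "module K W" "X \<in> carrier (tensor K V W)"
  shows "sw (tensor K V W) X (pure K V W) = X"
  unfolding sw_def using tensor_rep[OF assms] by (simp add: list_lift_pure[OF assms(1,2)])

lemma linear_map_sw_tensor:
  assumes "module K V" "module K W" "module K U" "bilinear_map K V W U \<beta>"
  shows "linear_map K (tensor K V W) U (\<lambda>X. sw U X \<beta>)"
proof -
  note closed = bilinear_map_closed[OF assms(4)]
  show ?thesis
  proof (rule linear_mapI)
    fix X assume X: "X \<in> carrier (tensor K V W)"
    then show "sw U X \<beta> \<in> carrier U"
      by (intro sw_closed[OF assms(1-3)] closed)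
    obtain xs where xs: "set xs \<subseteq> carrier V \<times> carrier W" "X = tensor_class K V W xs"
      using X by (rule tensor_carrierE)
    show "sw U (X \<oplus>\<^bsub>tensor K V W\<^esub> Y) \<beta> = sw U X \<beta> \<oplus>\<^bsub>U\<^esub> sw U Y \<beta>"
      if "Y \<in> carrier (tensor K V W)" for Y
    proof -
      obtain ys where ys: "set ys \<subseteq> carrier V \<times> carrier W" "Y = tensor_class K V W ys"
        using \<open>Y \<in> _\<close> by (rule tensor_carrierE)
      then show ?thesis
        using xs by (simp add: tensor_add_class sw_tensor_class[OF assms]
            list_lift_append[OF assms(3) closed])
    qed
    show "sw U (c \<odot>\<^bsub>tensor K V W\<^esub> X) \<beta> = c \<odot>\<^bsub>U\<^esub> sw U X \<beta>" if c: "c \<in> carrier K" for c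
    proof -
      interpret U: module K U by fact
      have "list_lift U \<beta> (list_smult V c xs) = c \<odot>\<^bsub>U\<^esub> list_lift U \<beta> xs"
        using xs(1)
        by (induction xs)
           (auto simp: c U.smult_r_distr closed linear_map_smult[OF bilinear_map_left[OF assms(4)]]
              list_lift_closed[OF assms(3) closed])
      then show ?thesis
        using xs c by (simp add: tensor_smult_class[OF assms(1,2)] sw_tensor_class[OF assms]
             list_smult_closed[OF assms(1)])
    qed
  qed
qed

text \<open>Linear maps on a tensor product that agree on pure tensors are equal.\<close>

lemma linear_map_tensor_eqI:
  assumes "module K V" "module K W" "module K U"
    and "linear_map K (tensor K V W) U F" "linear_map K (tensor K V W) U G"
    and "\<And>v w. v \<in> carrier V \<Longrightarrow> w \<in> carrier W \<Longrightarrow> F (pure K V W v w) = G (pure K V W v w)"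
    and X: "X \<in> carrier (tensor K V W)"
  shows "F X = G X"
proof -
  note T = tensor_module[OF assms(1,2)]
  have "F X = F (sw (tensor K V W) X (pure K V W))"
    by (simp add: sw_pure_self assms)
  also have "\<dots> = sw U X (\<lambda>v w. F (pure K V W v w))"
    by (rule sw_linear[OF assms(1,2) T assms(3) X assms(4)]) simp
  also have "\<dots> = sw U X (\<lambda>v w. G (pure K V W v w))"
    by (rule sw_cong[OF assms(1,2) X assms(6)])
  also have "\<dots> = G (sw (tensor K V W) X (pure K V W))"
    by (rule sw_linear[OF assms(1,2) T assms(3) X assms(5), symmetric]) simp
  also have "\<dots> = G X"
    by (simp add: sw_pure_self assms)
  finally show ?thesis .
qed

text \<open>The multiplication of \<open>V \<otimes> W\<close> is \<open>(x\<^sub>0 \<otimes> x\<^sub>1)(y\<^sub>0 \<otimes> y\<^sub>1) = x\<^sub>0 y\<^sub>0 \<otimes> x\<^sub>1 y\<^sub>1\<close>.\<close>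

lemma tensor_mult_eq_sw:
  assumes "module K V" "module K W" "bilinear_map K V V V (mult V)" "bilinear_map K W W W (mult W)"
    and X: "X \<in> carrier (tensor K V W)" and Y: "Y \<in> carrier (tensor K V W)"
  shows "X \<otimes>\<^bsub>tensor K V W\<^esub> Y =
    sw (tensor K V W) X (\<lambda>x\<^sub>0 x\<^sub>1. sw (tensor K V W) Y (\<lambda>y\<^sub>0 y\<^sub>1.
      pure K V W (x\<^sub>0 \<otimes>\<^bsub>V\<^esub> y\<^sub>0) (x\<^sub>1 \<otimes>\<^bsub>W\<^esub> y\<^sub>1)))" (is "_ = ?R")
proof -
  let ?T = "tensor K V W" and ?c = "tensor_class K V W"
  note T = tensor_module[OF assms(1,2)]
  note pb = pure_bilinear[OF assms(1,2)]
  define \<beta> where "\<beta> = (\<lambda>x\<^sub>0 x\<^sub>1 y\<^sub>0 y\<^sub>1. pure K V W (x\<^sub>0 \<otimes>\<^bsub>V\<^esub> y\<^sub>0) (x\<^sub>1 \<otimes>\<^bsub>W\<^esub> y\<^sub>1))"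
  have cV: "v \<otimes>\<^bsub>V\<^esub> v' \<in> carrier V" if "v \<in> carrier V" "v' \<in> carrier V" for v v'
    using bilinear_map_closed[OF assms(3)] that .
  have cW: "w \<otimes>\<^bsub>W\<^esub> w' \<in> carrier W" if "w \<in> carrier W" "w' \<in> carrier W" for w w'
    using bilinear_map_closed[OF assms(4)] that .
  have b1: "bilinear_map K V W ?T (\<beta> x\<^sub>0 x\<^sub>1)" if "x\<^sub>0 \<in> carrier V" "x\<^sub>1 \<in> carrier W" for x\<^sub>0 x\<^sub>1
    unfolding \<beta>_def using that
    by (intro bilinear_mapI bilinear_map_comp_left[OF pb] bilinear_map_comp_right[OF pb]
        bilinear_map_left[OF assms(3)] bilinear_map_left[OF assms(4)]
        bilinear_map_right[OF assms(3)] bilinear_map_right[OF assms(4)] cV cW)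
  have b2: "bilinear_map K V W ?T (\<lambda>x\<^sub>0 x\<^sub>1. sw ?T Y (\<beta> x\<^sub>0 x\<^sub>1))"
    unfolding \<beta>_def
    by (intro bilinear_mapI linear_map_sw[OF assms(1,2) T _ Y] assms(1,2)
        bilinear_map_comp_left[OF pb] bilinear_map_comp_right[OF pb]
        bilinear_map_left[OF assms(3)] bilinear_map_left[OF assms(4)]
        bilinear_map_right[OF assms(3)] bilinear_map_right[OF assms(4)] cV cW)
  have row: "set (map (\<lambda>(v', w'). (v \<otimes>\<^bsub>V\<^esub> v', w \<otimes>\<^bsub>W\<^esub> w')) ys) \<subseteq> carrier V \<times> carrier W \<and>
      ?c (map (\<lambda>(v', w'). (v \<otimes>\<^bsub>V\<^esub> v', w \<otimes>\<^bsub>W\<^esub> w')) ys) = list_lift ?T (\<beta> v w) ys"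
    if "v \<in> carrier V" "w \<in> carrier W" "set ys \<subseteq> carrier V \<times> carrier W" for v w ys
    using that(3)
  proof (induction ys)
    case (Cons y ys)
    then have "?c [(v \<otimes>\<^bsub>V\<^esub> fst y, w \<otimes>\<^bsub>W\<^esub> snd y)] \<oplus>\<^bsub>?T\<^esub> ?c (map (\<lambda>(v', w'). (v \<otimes>\<^bsub>V\<^esub> v', w \<otimes>\<^bsub>W\<^esub> w')) ys) =
      ?c ([(v \<otimes>\<^bsub>V\<^esub> fst y, w \<otimes>\<^bsub>W\<^esub> snd y)] @ map (\<lambda>(v', w'). (v \<otimes>\<^bsub>V\<^esub> v', w \<otimes>\<^bsub>W\<^esub> w')) ys)"
      using that(1,2) cV cW by (intro tensor_add_class) auto
    then show ?case
      using Cons that(1,2) cV cW by (auto simp: \<beta>_def pure_def)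
  qed (simp add: tensor_zero_class)
  have prod: "set (map (\<lambda>((v, w), (v', w')). (v \<otimes>\<^bsub>V\<^esub> v', w \<otimes>\<^bsub>W\<^esub> w')) (List.product xs ys))
        \<subseteq> carrier V \<times> carrier W \<and>
      ?c (map (\<lambda>((v, w), (v', w')). (v \<otimes>\<^bsub>V\<^esub> v', w \<otimes>\<^bsub>W\<^esub> w')) (List.product xs ys)) =
      list_lift ?T (\<lambda>x\<^sub>0 x\<^sub>1. list_lift ?T (\<beta> x\<^sub>0 x\<^sub>1) ys) xs"
    if "set xs \<subseteq> carrier V \<times> carrier W" and ys: "set ys \<subseteq> carrier V \<times> carrier W" for xs ys
    using that(1)
  proof (induction xs)
    case (Cons x xs)
    obtain v w where x: "x = (v, w)" by (cases x)
    then have vw: "v \<in> carrier V" "w \<in> carrier W" using Cons.prems by auto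
    note r = row[OF vw ys] and IH = Cons.IH
    have "map (\<lambda>((v, w), (v', w')). (v \<otimes>\<^bsub>V\<^esub> v', w \<otimes>\<^bsub>W\<^esub> w')) (List.product (x # xs) ys) =
      map (\<lambda>(v', w'). (v \<otimes>\<^bsub>V\<^esub> v', w \<otimes>\<^bsub>W\<^esub> w')) ys @
      map (\<lambda>((v, w), (v', w')). (v \<otimes>\<^bsub>V\<^esub> v', w \<otimes>\<^bsub>W\<^esub> w')) (List.product xs ys)"
      using x by (simp add: comp_def split_def)
    then show ?case
      using r IH Cons.prems x
        tensor_add_class[OF conjunct1[OF r] conjunct1[OF IH], of K]
      by (simp del: product.simps)
  qed (simp add: tensor_zero_class)
  have eq: "?c (map (\<lambda>((v, w), (v', w')). (v \<otimes>\<^bsub>V\<^esub> v', w \<otimes>\<^bsub>W\<^esub> w')) (List.product xs ys)) = ?R"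
    if "xs \<in> X" "ys \<in> Y" for xs ys
  proof -
    obtain us vs where us: "set us \<subseteq> carrier V \<times> carrier W" "X = ?c us"
      and vs: "set vs \<subseteq> carrier V \<times> carrier W" "Y = ?c vs"
      using X Y by (metis tensor_carrierE)
    have xs: "set xs \<subseteq> carrier V \<times> carrier W" "X = ?c xs" and ys: "set ys \<subseteq> carrier V \<times> carrier W" "Y = ?c ys"
      using that us vs tensor_eq_closed[OF assms(1,2)] tensor_class_eqI[of K V W]
      by (auto simp: tensor_class_def dest: tensor_eq.trans[OF tensor_eq.sym] intro: tensor_eq.trans)
    have "list_lift ?T (\<lambda>x\<^sub>0 x\<^sub>1. list_lift ?T (\<beta> x\<^sub>0 x\<^sub>1) ys) xs = list_lift ?T (\<lambda>x\<^sub>0 x\<^sub>1. sw ?T Y (\<beta> x\<^sub>0 x\<^sub>1)) xs"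
      by (rule list_lift_cong[OF _ xs(1)])
         (simp add: ys sw_tensor_class[OF assms(1,2) T b1])
    also have "\<dots> = sw ?T X (\<lambda>x\<^sub>0 x\<^sub>1. sw ?T Y (\<beta> x\<^sub>0 x\<^sub>1))"
      by (simp add: xs sw_tensor_class[OF assms(1,2) T b2])
    finally show ?thesis
      using prod[OF xs(1) ys(1)] by (simp add: \<beta>_def)
  qed
  have "\<exists>xs. xs \<in> X" "\<exists>ys. ys \<in> Y"
    using X Y by (metis tensor_carrierE tensor_eq_self)+
  then show ?thesis
    unfolding tensor_def by (auto simp: eq[unfolded tensor_def])
qed


section \<open>Maps between tensor products\<close>

text \<open>
  The rules in \<open>lin_intros\<close> establish linearity of an expression in one variable by recursion on its
  structure: in each subterm of the form \<open>\<beta> x y\<close> with \<open>\<beta>\<close> bilinear, exactly one argument contains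
  the variable.
\<close>

named_theorems lin_intros \<open>introduction rules for linearity\<close>

declare linear_map_ident [lin_intros]

lemma linear_map_pure_left [lin_intros]:
  "linear_map K X V f \<Longrightarrow> module K V \<Longrightarrow> module K W \<Longrightarrow> w \<in> carrier W \<Longrightarrow>
   linear_map K X (tensor K V W) (\<lambda>x. pure K V W (f x) w)"
  by (rule bilinear_map_comp_left[OF pure_bilinear])

lemma linear_map_pure_right [lin_intros]:
  "linear_map K X W f \<Longrightarrow> module K V \<Longrightarrow> module K W \<Longrightarrow> v \<in> carrier V \<Longrightarrow>
   linear_map K X (tensor K V W) (\<lambda>x. pure K V W v (f x))"
  by (rule bilinear_map_comp_right[OF pure_bilinear])

lemma tensor_map_eq_sw:
  assumes V: "module K V" and W: "module K W" and V': "module K V'" and W': "module K W'"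
    and f: "linear_map K V V' f" and g: "linear_map K W W' g" and X: "X \<in> carrier (tensor K V W)"
  shows "tensor_map K V' W' f g X = sw (tensor K V' W') X (\<lambda>v w. pure K V' W' (f v) (g w))"
proof -
  have "bilinear_map K V W (tensor K V' W') (\<lambda>v w. pure K V' W' (f v) (g w))"
    by (intro bilinear_mapI lin_intros f g V' W' linear_map_closed[OF f] linear_map_closed[OF g])
  then show ?thesis
    unfolding tensor_map_def by (rule tensor_lift_eq_sw[OF V W tensor_module[OF V' W'] X])
qed

lemma tensor_assoc_eq_sw:
  assumes U: "module K U" and V: "module K V" and W: "module K W"
    and Y: "Y \<in> carrier (tensor K (tensor K U V) W)"
  shows "tensor_assoc K U V W Y =
     sw (tensor K U (tensor K V W)) Y
       (\<lambda>X w. sw (tensor K U (tensor K V W)) X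
         (\<lambda>u v. pure K U (tensor K V W) u (pure K V W v w)))"
    and "bilinear_map K (tensor K U V) W (tensor K U (tensor K V W))
       (\<lambda>X w. sw (tensor K U (tensor K V W)) X
         (\<lambda>u v. pure K U (tensor K V W) u (pure K V W v w)))"
proof -
  note UV = tensor_module[OF U V] and VW = tensor_module[OF V W]
  note T = tensor_module[OF U VW]
  let ?T = "tensor K U (tensor K V W)"
  let ?\<beta> = "\<lambda>X w. sw ?T X (\<lambda>u v. pure K U (tensor K V W) u (pure K V W v w))"
  have b: "bilinear_map K U V ?T (\<lambda>u v. pure K U (tensor K V W) u (pure K V W v w))"
    if "w \<in> carrier W" for w
    by (intro bilinear_mapI lin_intros U V W VW pure_closed that)
  show bb: "bilinear_map K (tensor K U V) W ?T ?\<beta>"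
    by (intro bilinear_mapI linear_map_sw[OF U V T W] linear_map_sw_tensor[OF U V T] b
        lin_intros U V W VW pure_closed)
  have eq: "tensor_lift ?T (\<lambda>u v. pure K U (tensor K V W) u (pure K V W v w)) X = ?\<beta> X w"
    if "X \<in> carrier (tensor K U V)" "w \<in> carrier W" for X w
    by (rule tensor_lift_eq_sw[OF U V T that(1) b[OF that(2)]])
  have "bilinear_map K (tensor K U V) W ?T
    (\<lambda>X w. tensor_lift ?T (\<lambda>u v. pure K U (tensor K V W) u (pure K V W v w)) X)"
    by (intro bilinear_mapI)
       (auto intro: linear_map_cong[OF bilinear_map_left[OF bb] UV]
          linear_map_cong[OF bilinear_map_right[OF bb] W] simp: eq)
  then have "tensor_assoc K U V W Y =
    sw ?T Y (\<lambda>X w. tensor_lift ?T (\<lambda>u v. pure K U (tensor K V W) u (pure K V W v w)) X)"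
    unfolding tensor_assoc_def by (rule tensor_lift_eq_sw[OF UV W T Y])
  also have "\<dots> = sw ?T Y ?\<beta>"
    by (rule sw_cong[OF UV W Y eq])
  finally show "tensor_assoc K U V W Y = sw ?T Y ?\<beta>" .
qed

section \<open>Comodules\<close>

lemma comodule_coact_linear: "comodule K H M \<rho> \<Longrightarrow> linear_map K M (tensor K M H) \<rho>"
  and comodule_module: "comodule K H M \<rho> \<Longrightarrow> module K M"
  by (simp_all add: comodule_def)

lemma comodule_coact_closed:
  "comodule K H M \<rho> \<Longrightarrow> m \<in> carrier M \<Longrightarrow> \<rho> m \<in> carrier (tensor K M H)"
  by (rule linear_map_closed[OF comodule_coact_linear])

text \<open>
  Coassociativity \<open>\<gamma> m\<^sub>0\<^sub>0 m\<^sub>0\<^sub>1 m\<^sub>1 = \<gamma> m\<^sub>0 m\<^sub>1\<^sub>1 m\<^sub>1\<^sub>2\<close>, evaluated at a trilinear map.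
\<close>

lemma comodule_coassoc:
  assumes H: "comodule K H H (comult H)" and M: "comodule K H M \<rho>" and U: "module K U"
    and m: "m \<in> carrier M"
    and \<gamma>1: "\<And>h k. h \<in> carrier H \<Longrightarrow> k \<in> carrier H \<Longrightarrow> linear_map K M U (\<lambda>x. \<gamma> x h k)"
    and \<gamma>2: "\<And>x k. x \<in> carrier M \<Longrightarrow> k \<in> carrier H \<Longrightarrow> linear_map K H U (\<lambda>h. \<gamma> x h k)"
    and \<gamma>3: "\<And>x h. x \<in> carrier M \<Longrightarrow> h \<in> carrier H \<Longrightarrow> linear_map K H U (\<lambda>k. \<gamma> x h k)"
  shows "sw U (\<rho> m) (\<lambda>x h. sw U (\<rho> x) (\<lambda>y k. \<gamma> y k h)) =
         sw U (\<rho> m) (\<lambda>x h. sw U (comult H h) (\<lambda>k l. \<gamma> x k l))"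
proof -
  note mM = comodule_module[OF M] and mH = comodule_module[OF H]
  let ?HH = "tensor K H H" and ?MH = "tensor K M H"
  let ?T = "tensor K M ?HH" and ?T' = "tensor K ?MH H"
  note mHH = tensor_module[OF mH mH] and mMH = tensor_module[OF mM mH]
  note mT = tensor_module[OF mM mHH] and mT' = tensor_module[OF mMH mH]
  note \<rho> = comodule_coact_linear[OF M] and \<rho>c = comodule_coact_closed[OF M]
  note \<Delta> = comodule_coact_linear[OF H] and \<Delta>c = comodule_coact_closed[OF H]
  note closed = linear_map_closed[OF \<gamma>1]
  define G where "G = (\<lambda>X. sw U X (\<lambda>x Z. sw U Z (\<gamma> x)))"
  have b: "bilinear_map K H H U (\<gamma> x)" if "x \<in> carrier M" for x
    by (intro bilinear_mapI \<gamma>2 \<gamma>3 that)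
  have bb: "bilinear_map K M ?HH U (\<lambda>x Z. sw U Z (\<gamma> x))"
    by (intro bilinear_mapI linear_map_sw_tensor[OF mH mH U] b linear_map_sw[OF mH mH U mM] \<gamma>1)
  have G: "linear_map K ?T U G"
    unfolding G_def by (rule linear_map_sw_tensor[OF mM mHH U bb])
  have G_pure: "G (pure K M ?HH x Z) = sw U Z (\<gamma> x)" if "x \<in> carrier M" "Z \<in> carrier ?HH" for x Z
    unfolding G_def by (rule sw_pure[OF mM mHH U bb that])
  have G_pure2: "G (pure K M ?HH x (pure K H H k l)) = \<gamma> x k l"
    if "x \<in> carrier M" "k \<in> carrier H" "l \<in> carrier H" for x k l
    using that by (simp add: G_pure sw_pure[OF mH mH U b])
  have right: "G (tensor_map K M ?HH id (comult H) (\<rho> m)) = sw U (\<rho> m) (\<lambda>x h. sw U (comult H h) (\<gamma> x))"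
  proof -
    have "tensor_map K M ?HH id (comult H) (\<rho> m) = sw ?T (\<rho> m) (\<lambda>x h. pure K M ?HH (id x) (comult H h))"
      by (rule tensor_map_eq_sw[OF mM mH mM mHH _ \<Delta> \<rho>c[OF m]]) (simp add: id_def linear_map_ident)
    then have "G (tensor_map K M ?HH id (comult H) (\<rho> m)) =
      sw U (\<rho> m) (\<lambda>x h. G (pure K M ?HH (id x) (comult H h)))"
      by (simp add: sw_linear[OF mM mH mT U \<rho>c[OF m] G] \<Delta>c)
    also have "\<dots> = sw U (\<rho> m) (\<lambda>x h. sw U (comult H h) (\<gamma> x))"
      by (rule sw_cong[OF mM mH \<rho>c[OF m]]) (simp add: G_pure \<Delta>c)
    finally show ?thesis .
  qed
  let ?Y = "tensor_map K ?MH H \<rho> id (\<rho> m)"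
  let ?a = "\<lambda>X w. sw ?T X (\<lambda>u v. pure K M ?HH u (pure K H H v w))"
  have Y: "?Y = sw ?T' (\<rho> m) (\<lambda>x h. pure K ?MH H (\<rho> x) h)"
    using tensor_map_eq_sw[OF mM mH mMH mH \<rho> _ \<rho>c[OF m], of id] by (simp add: id_def linear_map_ident)
  have Yc: "?Y \<in> carrier ?T'"
    unfolding Y by (rule sw_closed[OF mM mH mT' \<rho>c[OF m]]) (simp add: \<rho>c)
  note a = tensor_assoc_eq_sw[OF mM mH mH Yc]
  have "tensor_assoc K M H H ?Y = sw ?T (sw ?T' (\<rho> m) (\<lambda>x h. pure K ?MH H (\<rho> x) h)) ?a"
    using a(1) Y by simp
  also have "\<dots> = sw ?T (\<rho> m) (\<lambda>x h. sw ?T (pure K ?MH H (\<rho> x) h) ?a)"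
    by (rule sw_linear[OF mM mH mT' mT \<rho>c[OF m] linear_map_sw_tensor[OF mMH mH mT a(2)]])
       (simp add: \<rho>c)
  also have "\<dots> = sw ?T (\<rho> m) (\<lambda>x h. ?a (\<rho> x) h)"
    by (rule sw_cong[OF mM mH \<rho>c[OF m]]) (simp add: sw_pure[OF mMH mH mT a(2)] \<rho>c)
  finally have "G (tensor_assoc K M H H ?Y) = G (sw ?T (\<rho> m) (\<lambda>x h. ?a (\<rho> x) h))"
    by simp
  also have "\<dots> = sw U (\<rho> m) (\<lambda>x h. G (?a (\<rho> x) h))"
    by (rule sw_linear[OF mM mH mT U \<rho>c[OF m] G]) (intro bilinear_map_closed[OF a(2)] \<rho>c)
  also have "\<dots> = sw U (\<rho> m) (\<lambda>x h. sw U (\<rho> x) (\<lambda>u v. G (pure K M ?HH u (pure K H H v h))))"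
    by (rule sw_cong[OF mM mH \<rho>c[OF m]], rule sw_linear[OF mM mH mT U \<rho>c G]) auto
  also have "\<dots> = sw U (\<rho> m) (\<lambda>x h. sw U (\<rho> x) (\<lambda>u v. \<gamma> u v h))"
    by (rule sw_cong[OF mM mH \<rho>c[OF m]], rule sw_cong[OF mM mH \<rho>c]) (auto simp: G_pure2)
  finally show ?thesis
    using right M m by (simp add: comodule_def)
qed


section \<open>Hopf algebras with bijective antipode\<close>

locale bijective_hopf_algebra =
  fixes K :: "('k, 'z) ring_scheme" and H :: "('k, 'h) hopf"
  assumes hopf: "hopf_algebra K H" and antipode_bij: "bijective_antipode H"
begin

abbreviation coproduct (\<open>\<Delta>\<close>) where "\<Delta> \<equiv> comult H"
abbreviation counit_map (\<open>\<epsilon>\<close>) where "\<epsilon> \<equiv> counit H"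
abbreviation antipode_map (\<open>S\<close>) where "S \<equiv> antipode H"
abbreviation antipode_inverse (\<open>T\<close>) where "T \<equiv> antipode_inv H"

lemma H_ring: "ring H" and H_module [simp]: "module K H"
  and H_mult_bilinear: "bilinear_map K H H H (mult H)"
  and H_comodule [simp]: "comodule K H H \<Delta>"
  and coproduct_hom: "\<Delta> \<in> ring_hom H (tensor K H H)"
  and counit_hom: "\<epsilon> \<in> ring_hom H K"
  and antipode_linear: "linear_map K H H S"
  using hopf by (simp_all add: hopf_algebra_def)

sublocale H: ring H by (rule H_ring)
sublocale HM: module K H by (rule H_module)

lemma coproduct_closed [simp]: "h \<in> carrier H \<Longrightarrow> \<Delta> h \<in> carrier (tensor K H H)"
  by (rule comodule_coact_closed[OF H_comodule])

lemma counit_closed [simp]: "h \<in> carrier H \<Longrightarrow> \<epsilon> h \<in> carrier K"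
  using counit_hom by (auto simp: ring_hom_def)

lemma counit_mult: "h \<in> carrier H \<Longrightarrow> k \<in> carrier H \<Longrightarrow> \<epsilon> (h \<otimes>\<^bsub>H\<^esub> k) = \<epsilon> h \<otimes>\<^bsub>K\<^esub> \<epsilon> k"
  using counit_hom by (auto simp: ring_hom_def)

lemma counit_one [simp]: "\<epsilon> \<one>\<^bsub>H\<^esub> = \<one>\<^bsub>K\<^esub>"
  using counit_hom by (auto simp: ring_hom_def)

lemma antipode_closed [simp]: "h \<in> carrier H \<Longrightarrow> S h \<in> carrier H"
  by (rule linear_map_closed[OF antipode_linear])

lemma H_smult_mult_left:
  "c \<in> carrier K \<Longrightarrow> h \<in> carrier H \<Longrightarrow> k \<in> carrier H \<Longrightarrow>
   (c \<odot>\<^bsub>H\<^esub> h) \<otimes>\<^bsub>H\<^esub> k = c \<odot>\<^bsub>H\<^esub> (h \<otimes>\<^bsub>H\<^esub> k)"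
  using linear_map_smult[OF bilinear_map_left[OF H_mult_bilinear]] by blast

lemma H_smult_mult_right:
  "c \<in> carrier K \<Longrightarrow> h \<in> carrier H \<Longrightarrow> k \<in> carrier H \<Longrightarrow>
   h \<otimes>\<^bsub>H\<^esub> (c \<odot>\<^bsub>H\<^esub> k) = c \<odot>\<^bsub>H\<^esub> (h \<otimes>\<^bsub>H\<^esub> k)"
  using linear_map_smult[OF bilinear_map_right[OF H_mult_bilinear]] by blast

lemmas H_mult_linear [lin_intros] =
  bilinear_map_comp_left[OF H_mult_bilinear] bilinear_map_comp_right[OF H_mult_bilinear]

lemma antipode_linear_comp [lin_intros]: "linear_map K X H f \<Longrightarrow> linear_map K X H (\<lambda>x. S (f x))"
  by (rule linear_map_compose[OF antipode_linear])

lemma counit_linear: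
  assumes "module K U" "u \<in> carrier U"
  shows "linear_map K H U (\<lambda>h. \<epsilon> h \<odot>\<^bsub>U\<^esub> u)"
proof -
  interpret U: module K U by fact
  have "\<epsilon> (h \<oplus>\<^bsub>H\<^esub> k) = \<epsilon> h \<oplus>\<^bsub>K\<^esub> \<epsilon> k" if "h \<in> carrier H" "k \<in> carrier H" for h k
    using counit_hom that by (auto simp: ring_hom_def)
  moreover have "\<epsilon> (c \<odot>\<^bsub>H\<^esub> h) = c \<otimes>\<^bsub>K\<^esub> \<epsilon> h" if "c \<in> carrier K" "h \<in> carrier H" for c h
    using hopf that by (auto simp: hopf_algebra_def)
  ultimately show ?thesis
    by (intro linear_mapI) (auto simp: U.smult_l_distr U.smult_assoc1 assms(2))
qed

subsection \<open>Sums over coactions\<close>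

text \<open>The rules for Sweedler sums over \<open>X = \<rho> m\<close>, for a comodule \<open>M\<close> with coaction \<open>\<rho>\<close>.\<close>

context
  fixes M :: "('k, 'm, 'x) module_scheme" and \<rho>
  assumes M: "comodule K H M \<rho>"
begin

lemmas coact_sum_closed = sw_closed[OF comodule_module[OF M] H_module _ comodule_coact_closed[OF M]]
lemmas coact_sum_cong = sw_cong[OF comodule_module[OF M] H_module comodule_coact_closed[OF M]]
lemmas coact_sum_linear = sw_linear[OF comodule_module[OF M] H_module _ _ comodule_coact_closed[OF M]]
lemmas linear_map_coact_sum =
  linear_map_sw[OF comodule_module[OF M] H_module _ _ comodule_coact_closed[OF M]]
lemmas coact_sum_coassoc = comodule_coassoc[OF H_comodule M]

lemma linear_map_coact_sum_arg:
  assumes "module K U" "linear_map K X M f" "bilinear_map K M H U \<beta>"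
  shows "linear_map K X U (\<lambda>x. sw U (\<rho> (f x)) \<beta>)"
  by (rule linear_map_compose[OF linear_map_sw_tensor[OF comodule_module[OF M] H_module assms(1,3)]
       linear_map_compose[OF comodule_coact_linear[OF M] assms(2)]])

lemma tensor_lift_coact:
  "module K U \<Longrightarrow> bilinear_map K M H U \<beta> \<Longrightarrow> m \<in> carrier M \<Longrightarrow> tensor_lift U \<beta> (\<rho> m) = sw U (\<rho> m) \<beta>"
  by (rule tensor_lift_eq_sw[OF comodule_module[OF M] H_module _ comodule_coact_closed[OF M]])

lemma coact_sum_pure: "m \<in> carrier M \<Longrightarrow> sw (tensor K M H) (\<rho> m) (pure K M H) = \<rho> m"
  by (rule sw_pure_self[OF comodule_module[OF M] H_module comodule_coact_closed[OF M]])

lemma coact_sum_counit: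
  assumes "module K U" "linear_map K M U F" "m \<in> carrier M"
  shows "sw U (\<rho> m) (\<lambda>x h. \<epsilon> h \<odot>\<^bsub>U\<^esub> F x) = F m"
proof -
  note mM = comodule_module[OF M]
  interpret M: module K M by (rule mM)
  interpret U: module K U by fact
  have b: "bilinear_map K M H M (\<lambda>x h. \<epsilon> h \<odot>\<^bsub>M\<^esub> x)"
    by (intro bilinear_mapI counit_linear mM) (auto intro!: linear_mapI simp: M.smult_r_distr M.smult_assoc1[symmetric] HM.R.m_comm)
  have "sw M (\<rho> m) (\<lambda>x h. \<epsilon> h \<odot>\<^bsub>M\<^esub> x) = m"
    using tensor_lift_coact[OF mM b assms(3)] M assms(3) by (simp add: comodule_def)
  then have "F m = F (sw M (\<rho> m) (\<lambda>x h. \<epsilon> h \<odot>\<^bsub>M\<^esub> x))" by simp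
  also have "\<dots> = sw U (\<rho> m) (\<lambda>x h. F (\<epsilon> h \<odot>\<^bsub>M\<^esub> x))"
    by (rule coact_sum_linear[OF mM assms(1,3,2)]) simp
  also have "\<dots> = sw U (\<rho> m) (\<lambda>x h. \<epsilon> h \<odot>\<^bsub>U\<^esub> F x)"
    by (rule coact_sum_cong[OF assms(3)]) (simp add: linear_map_smult[OF assms(2)])
  finally show ?thesis by simp
qed

end

lemma linear_map_coproduct_sum [lin_intros]:
  "module K U \<Longrightarrow> module K Z \<Longrightarrow> h \<in> carrier H \<Longrightarrow>
   (\<And>k l. k \<in> carrier H \<Longrightarrow> l \<in> carrier H \<Longrightarrow> linear_map K Z U (\<lambda>z. \<beta> z k l)) \<Longrightarrow>
   linear_map K Z U (\<lambda>z. sw U (\<Delta> h) (\<beta> z))"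
  by (rule linear_map_coact_sum[OF H_comodule])

lemmas coproduct_sum_closed [simp] = coact_sum_closed[OF H_comodule]
lemmas coproduct_sum_cong = coact_sum_cong[OF H_comodule]
lemmas coproduct_sum_linear = coact_sum_linear[OF H_comodule]

lemma coproduct_sum_counit_left:
  assumes "module K U" "linear_map K H U F" "h \<in> carrier H"
  shows "sw U (\<Delta> h) (\<lambda>h\<^sub>1 h\<^sub>2. \<epsilon> h\<^sub>1 \<odot>\<^bsub>U\<^esub> F h\<^sub>2) = F h"
proof -
  have "bilinear_map K H H H (\<lambda>h\<^sub>1 h\<^sub>2. \<epsilon> h\<^sub>1 \<odot>\<^bsub>H\<^esub> h\<^sub>2)"
    by (intro bilinear_mapI counit_linear H_module) (auto intro!: linear_mapI simp: HM.smult_r_distr HM.smult_assoc1[symmetric] HM.R.m_comm)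
  then have "sw H (\<Delta> h) (\<lambda>h\<^sub>1 h\<^sub>2. \<epsilon> h\<^sub>1 \<odot>\<^bsub>H\<^esub> h\<^sub>2) = h"
    using tensor_lift_coact[OF H_comodule H_module _ assms(3), of "\<lambda>h\<^sub>1 h\<^sub>2. \<epsilon> h\<^sub>1 \<odot>\<^bsub>H\<^esub> h\<^sub>2"] hopf assms(3)
    by (simp add: hopf_algebra_def)
  then have "F h = F (sw H (\<Delta> h) (\<lambda>h\<^sub>1 h\<^sub>2. \<epsilon> h\<^sub>1 \<odot>\<^bsub>H\<^esub> h\<^sub>2))" by simp
  also have "\<dots> = sw U (\<Delta> h) (\<lambda>h\<^sub>1 h\<^sub>2. F (\<epsilon> h\<^sub>1 \<odot>\<^bsub>H\<^esub> h\<^sub>2))"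
    by (rule coproduct_sum_linear[OF H_module assms(1,3,2)]) simp
  also have "\<dots> = sw U (\<Delta> h) (\<lambda>h\<^sub>1 h\<^sub>2. \<epsilon> h\<^sub>1 \<odot>\<^bsub>U\<^esub> F h\<^sub>2)"
    by (rule coproduct_sum_cong[OF assms(3)]) (simp add: linear_map_smult[OF assms(2)])
  finally show ?thesis by simp
qed

subsection \<open>The antipode\<close>

lemma antipode_left:
  "h \<in> carrier H \<Longrightarrow> sw H (\<Delta> h) (\<lambda>h\<^sub>1 h\<^sub>2. S h\<^sub>1 \<otimes>\<^bsub>H\<^esub> h\<^sub>2) = \<epsilon> h \<odot>\<^bsub>H\<^esub> \<one>\<^bsub>H\<^esub>"
proof -
  assume h: "h \<in> carrier H"
  have "bilinear_map K H H H (\<lambda>h\<^sub>1 h\<^sub>2. S h\<^sub>1 \<otimes>\<^bsub>H\<^esub> h\<^sub>2)"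
    by (intro bilinear_mapI lin_intros antipode_closed)
  then show ?thesis
    using tensor_lift_coact[OF H_comodule H_module _ h, of "\<lambda>h\<^sub>1 h\<^sub>2. S h\<^sub>1 \<otimes>\<^bsub>H\<^esub> h\<^sub>2"] hopf h by (simp add: hopf_algebra_def)
qed

lemma antipode_right:
  "h \<in> carrier H \<Longrightarrow> sw H (\<Delta> h) (\<lambda>h\<^sub>1 h\<^sub>2. h\<^sub>1 \<otimes>\<^bsub>H\<^esub> S h\<^sub>2) = \<epsilon> h \<odot>\<^bsub>H\<^esub> \<one>\<^bsub>H\<^esub>"
proof -
  assume h: "h \<in> carrier H"
  have "bilinear_map K H H H (\<lambda>h\<^sub>1 h\<^sub>2. h\<^sub>1 \<otimes>\<^bsub>H\<^esub> S h\<^sub>2)"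
    by (intro bilinear_mapI lin_intros antipode_closed)
  then show ?thesis
    using tensor_lift_coact[OF H_comodule H_module _ h, of "\<lambda>h\<^sub>1 h\<^sub>2. h\<^sub>1 \<otimes>\<^bsub>H\<^esub> S h\<^sub>2"] hopf h by (simp add: hopf_algebra_def)
qed

lemma antipode_one: "S \<one>\<^bsub>H\<^esub> = \<one>\<^bsub>H\<^esub>"
proof -
  have "\<Delta> \<one>\<^bsub>H\<^esub> = pure K H H \<one>\<^bsub>H\<^esub> \<one>\<^bsub>H\<^esub>"
    using coproduct_hom by (auto simp: ring_hom_def tensor_def)
  moreover have "sw H (pure K H H \<one>\<^bsub>H\<^esub> \<one>\<^bsub>H\<^esub>) (\<lambda>h\<^sub>1 h\<^sub>2. S h\<^sub>1 \<otimes>\<^bsub>H\<^esub> h\<^sub>2) = S \<one>\<^bsub>H\<^esub> \<otimes>\<^bsub>H\<^esub> \<one>\<^bsub>H\<^esub>"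
    by (rule sw_pure[OF H_module H_module H_module])
       (intro bilinear_mapI lin_intros antipode_closed, simp_all)
  ultimately show ?thesis
    using antipode_left[of "\<one>\<^bsub>H\<^esub>"] by simp
qed

text \<open>
  Both \<open>(h, k) \<mapsto> S (h k)\<close> and \<open>(h, k) \<mapsto> S k S h\<close> are convolution inverses of the multiplication
  \<open>H \<otimes> H \<rightarrow> H\<close>: the former from the left and the latter from the right.
\<close>

lemma antipode_mult:
  assumes h: "h \<in> carrier H" and k: "k \<in> carrier H"
  shows "S (h \<otimes>\<^bsub>H\<^esub> k) = S k \<otimes>\<^bsub>H\<^esub> S h"
proof -
  let ?HH = "tensor K H H"
  have mHH [simp]: "module K ?HH" by (simp add: tensor_module)
  have smul: "linear_map K H H (\<lambda>x. c \<odot>\<^bsub>H\<^esub> x)" if "c \<in> carrier K" for c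
    using that by (auto intro!: linear_mapI simp: HM.smult_r_distr HM.smult_assoc1[symmetric] HM.R.m_comm)
  have left: "sw H (\<Delta> h) (\<lambda>h\<^sub>1 h\<^sub>2. sw H (\<Delta> k) (\<lambda>k\<^sub>1 k\<^sub>2. S (h\<^sub>1 \<otimes>\<^bsub>H\<^esub> k\<^sub>1) \<otimes>\<^bsub>H\<^esub> (h\<^sub>2 \<otimes>\<^bsub>H\<^esub> k\<^sub>2))) =
      (\<epsilon> h \<otimes>\<^bsub>K\<^esub> \<epsilon> k) \<odot>\<^bsub>H\<^esub> \<one>\<^bsub>H\<^esub>" if h: "h \<in> carrier H" and k: "k \<in> carrier H" for h k
  proof -
    have b: "bilinear_map K H H H (\<lambda>h\<^sub>1 h\<^sub>2. S h\<^sub>1 \<otimes>\<^bsub>H\<^esub> h\<^sub>2)"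
      by (intro bilinear_mapI lin_intros antipode_closed)
    let ?L = "\<lambda>X. sw H X (\<lambda>h\<^sub>1 h\<^sub>2. S h\<^sub>1 \<otimes>\<^bsub>H\<^esub> h\<^sub>2)"
    have L: "linear_map K ?HH H ?L"
      by (rule linear_map_sw_tensor[OF H_module H_module H_module b])
    have "\<Delta> (h \<otimes>\<^bsub>H\<^esub> k) = \<Delta> h \<otimes>\<^bsub>?HH\<^esub> \<Delta> k"
      using coproduct_hom h k by (auto simp: ring_hom_def)
    also have "\<dots> = sw ?HH (\<Delta> h) (\<lambda>h\<^sub>1 h\<^sub>2. sw ?HH (\<Delta> k) (\<lambda>k\<^sub>1 k\<^sub>2.
        pure K H H (h\<^sub>1 \<otimes>\<^bsub>H\<^esub> k\<^sub>1) (h\<^sub>2 \<otimes>\<^bsub>H\<^esub> k\<^sub>2)))"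
      using h k by (intro tensor_mult_eq_sw H_mult_bilinear) auto
    finally have "?L (\<Delta> (h \<otimes>\<^bsub>H\<^esub> k)) = ?L \<dots>" by simp
    also have "\<dots> = sw H (\<Delta> h) (\<lambda>h\<^sub>1 h\<^sub>2. ?L (sw ?HH (\<Delta> k) (\<lambda>k\<^sub>1 k\<^sub>2.
        pure K H H (h\<^sub>1 \<otimes>\<^bsub>H\<^esub> k\<^sub>1) (h\<^sub>2 \<otimes>\<^bsub>H\<^esub> k\<^sub>2))))"
      using h k by (intro coproduct_sum_linear[OF _ _ _ L]) auto
    also have "\<dots> = sw H (\<Delta> h) (\<lambda>h\<^sub>1 h\<^sub>2. sw H (\<Delta> k) (\<lambda>k\<^sub>1 k\<^sub>2. ?L (
        pure K H H (h\<^sub>1 \<otimes>\<^bsub>H\<^esub> k\<^sub>1) (h\<^sub>2 \<otimes>\<^bsub>H\<^esub> k\<^sub>2))))"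
      using h k by (intro coproduct_sum_cong coproduct_sum_linear[OF _ _ _ L]) auto
    also have "\<dots> = sw H (\<Delta> h) (\<lambda>h\<^sub>1 h\<^sub>2. sw H (\<Delta> k) (\<lambda>k\<^sub>1 k\<^sub>2.
        S (h\<^sub>1 \<otimes>\<^bsub>H\<^esub> k\<^sub>1) \<otimes>\<^bsub>H\<^esub> (h\<^sub>2 \<otimes>\<^bsub>H\<^esub> k\<^sub>2)))"
      using h k by (intro coproduct_sum_cong sw_pure[OF _ _ _ b]) auto
    finally show ?thesis
      using antipode_left[of "h \<otimes>\<^bsub>H\<^esub> k"] h k by (simp add: counit_mult)
  qed
  have right: "sw H (\<Delta> h) (\<lambda>h\<^sub>1 h\<^sub>2. sw H (\<Delta> k) (\<lambda>k\<^sub>1 k\<^sub>2. (h\<^sub>1 \<otimes>\<^bsub>H\<^esub> k\<^sub>1) \<otimes>\<^bsub>H\<^esub> (S k\<^sub>2 \<otimes>\<^bsub>H\<^esub> S h\<^sub>2))) =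
      (\<epsilon> h \<otimes>\<^bsub>K\<^esub> \<epsilon> k) \<odot>\<^bsub>H\<^esub> \<one>\<^bsub>H\<^esub>" if h: "h \<in> carrier H" and k: "k \<in> carrier H" for h k
  proof -
    have "sw H (\<Delta> h) (\<lambda>h\<^sub>1 h\<^sub>2. sw H (\<Delta> k) (\<lambda>k\<^sub>1 k\<^sub>2. (h\<^sub>1 \<otimes>\<^bsub>H\<^esub> k\<^sub>1) \<otimes>\<^bsub>H\<^esub> (S k\<^sub>2 \<otimes>\<^bsub>H\<^esub> S h\<^sub>2))) =
      sw H (\<Delta> h) (\<lambda>h\<^sub>1 h\<^sub>2. sw H (\<Delta> k) (\<lambda>k\<^sub>1 k\<^sub>2. h\<^sub>1 \<otimes>\<^bsub>H\<^esub> ((k\<^sub>1 \<otimes>\<^bsub>H\<^esub> S k\<^sub>2) \<otimes>\<^bsub>H\<^esub> S h\<^sub>2)))"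
      using h k by (intro coproduct_sum_cong) (auto simp: H.m_assoc)
    also have "\<dots> = sw H (\<Delta> h) (\<lambda>h\<^sub>1 h\<^sub>2. h\<^sub>1 \<otimes>\<^bsub>H\<^esub> (sw H (\<Delta> k) (\<lambda>k\<^sub>1 k\<^sub>2. k\<^sub>1 \<otimes>\<^bsub>H\<^esub> S k\<^sub>2) \<otimes>\<^bsub>H\<^esub> S h\<^sub>2))"
      using h k
      by (intro coproduct_sum_cong coproduct_sum_linear[where L="\<lambda>z. _ \<otimes>\<^bsub>H\<^esub> (z \<otimes>\<^bsub>H\<^esub> _)", symmetric]
           lin_intros) auto
    also have "\<dots> = sw H (\<Delta> h) (\<lambda>h\<^sub>1 h\<^sub>2. \<epsilon> k \<odot>\<^bsub>H\<^esub> (h\<^sub>1 \<otimes>\<^bsub>H\<^esub> S h\<^sub>2))"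
      using h k by (intro coproduct_sum_cong) (auto simp: antipode_right H_smult_mult_left H_smult_mult_right)
    also have "\<dots> = \<epsilon> k \<odot>\<^bsub>H\<^esub> sw H (\<Delta> h) (\<lambda>h\<^sub>1 h\<^sub>2. h\<^sub>1 \<otimes>\<^bsub>H\<^esub> S h\<^sub>2)"
      using h k by (intro coproduct_sum_linear[symmetric] smul) auto
    also have "\<dots> = (\<epsilon> h \<otimes>\<^bsub>K\<^esub> \<epsilon> k) \<odot>\<^bsub>H\<^esub> \<one>\<^bsub>H\<^esub>"
      using h k by (simp add: antipode_right HM.smult_assoc1[symmetric] HM.R.m_comm)
    finally show ?thesis .
  qed
  let ?F = "\<lambda>h\<^sub>1 h\<^sub>2 h\<^sub>3 k\<^sub>1 k\<^sub>2 k\<^sub>3. S (h\<^sub>1 \<otimes>\<^bsub>H\<^esub> k\<^sub>1) \<otimes>\<^bsub>H\<^esub> ((h\<^sub>2 \<otimes>\<^bsub>H\<^esub> k\<^sub>2) \<otimes>\<^bsub>H\<^esub> (S k\<^sub>3 \<otimes>\<^bsub>H\<^esub> S h\<^sub>3))"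
  have "S (h \<otimes>\<^bsub>H\<^esub> k) = sw H (\<Delta> h) (\<lambda>h\<^sub>1 h\<^sub>2. \<epsilon> h\<^sub>2 \<odot>\<^bsub>H\<^esub> S (h\<^sub>1 \<otimes>\<^bsub>H\<^esub> k))"
    using h k
    by (intro coact_sum_counit[OF H_comodule, where F="\<lambda>x. S (x \<otimes>\<^bsub>H\<^esub> k)", symmetric] lin_intros) auto
  also have "\<dots> = sw H (\<Delta> h) (\<lambda>h\<^sub>1 h\<^sub>2. sw H (\<Delta> k) (\<lambda>k\<^sub>1 k\<^sub>2. \<epsilon> k\<^sub>2 \<odot>\<^bsub>H\<^esub> (\<epsilon> h\<^sub>2 \<odot>\<^bsub>H\<^esub> S (h\<^sub>1 \<otimes>\<^bsub>H\<^esub> k\<^sub>1))))"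
    using h k
    by (intro coproduct_sum_cong coact_sum_counit[OF H_comodule, where F="\<lambda>x. _ \<odot>\<^bsub>H\<^esub> S (_ \<otimes>\<^bsub>H\<^esub> x)", symmetric] lin_intros
         linear_map_compose[OF smul]) auto
  also have "\<dots> = sw H (\<Delta> h) (\<lambda>h\<^sub>1 h\<^sub>2. sw H (\<Delta> k) (\<lambda>k\<^sub>1 k\<^sub>2. S (h\<^sub>1 \<otimes>\<^bsub>H\<^esub> k\<^sub>1) \<otimes>\<^bsub>H\<^esub>
      sw H (\<Delta> h\<^sub>2) (\<lambda>x y. sw H (\<Delta> k\<^sub>2) (\<lambda>u v. (x \<otimes>\<^bsub>H\<^esub> u) \<otimes>\<^bsub>H\<^esub> (S v \<otimes>\<^bsub>H\<^esub> S y)))))"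
    using h k by (intro coproduct_sum_cong)
      (auto simp: right H_smult_mult_right HM.smult_assoc1[symmetric] HM.R.m_comm)
  also have "\<dots> = sw H (\<Delta> h) (\<lambda>h\<^sub>1 h\<^sub>2. sw H (\<Delta> k) (\<lambda>k\<^sub>1 k\<^sub>2.
      sw H (\<Delta> h\<^sub>2) (\<lambda>x y. S (h\<^sub>1 \<otimes>\<^bsub>H\<^esub> k\<^sub>1) \<otimes>\<^bsub>H\<^esub> sw H (\<Delta> k\<^sub>2) (\<lambda>u v. (x \<otimes>\<^bsub>H\<^esub> u) \<otimes>\<^bsub>H\<^esub> (S v \<otimes>\<^bsub>H\<^esub> S y)))))"
    using h k by (intro coproduct_sum_cong coproduct_sum_linear lin_intros) auto
  also have "\<dots> = sw H (\<Delta> h) (\<lambda>h\<^sub>1 h\<^sub>2. sw H (\<Delta> k) (\<lambda>k\<^sub>1 k\<^sub>2.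
      sw H (\<Delta> h\<^sub>2) (\<lambda>x y. sw H (\<Delta> k\<^sub>2) (\<lambda>u v. ?F h\<^sub>1 x y k\<^sub>1 u v))))"
    using h k by (intro coproduct_sum_cong coproduct_sum_linear lin_intros) auto
  also have "\<dots> = sw H (\<Delta> h) (\<lambda>h\<^sub>1 h\<^sub>2. sw H (\<Delta> h\<^sub>2) (\<lambda>x y.
      sw H (\<Delta> k) (\<lambda>k\<^sub>1 k\<^sub>2. sw H (\<Delta> k\<^sub>2) (\<lambda>u v. ?F h\<^sub>1 x y k\<^sub>1 u v))))"
    using h k by (intro coproduct_sum_cong sw_swap[OF H_module H_module H_module H_module]) auto
  also have "\<dots> = sw H (\<Delta> h) (\<lambda>h\<^sub>1 h\<^sub>2. sw H (\<Delta> h\<^sub>1) (\<lambda>a x.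
      sw H (\<Delta> k) (\<lambda>k\<^sub>1 k\<^sub>2. sw H (\<Delta> k\<^sub>2) (\<lambda>u v. ?F a x h\<^sub>2 k\<^sub>1 u v))))"
    using h k by (intro coact_sum_coassoc[OF H_comodule, symmetric] lin_intros) auto
  also have "\<dots> = sw H (\<Delta> h) (\<lambda>h\<^sub>1 h\<^sub>2. sw H (\<Delta> h\<^sub>1) (\<lambda>a x.
      sw H (\<Delta> k) (\<lambda>k\<^sub>1 k\<^sub>2. sw H (\<Delta> k\<^sub>1) (\<lambda>b u. ?F a x h\<^sub>2 b u k\<^sub>2))))"
    using h k by (intro coproduct_sum_cong coact_sum_coassoc[OF H_comodule, symmetric] lin_intros) auto
  also have "\<dots> = sw H (\<Delta> h) (\<lambda>h\<^sub>1 h\<^sub>2. sw H (\<Delta> k) (\<lambda>k\<^sub>1 k\<^sub>2.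
      sw H (\<Delta> h\<^sub>1) (\<lambda>a x. sw H (\<Delta> k\<^sub>1) (\<lambda>b u. ?F a x h\<^sub>2 b u k\<^sub>2))))"
    using h k by (intro coproduct_sum_cong sw_swap[OF H_module H_module H_module H_module]) auto
  also have "\<dots> = sw H (\<Delta> h) (\<lambda>h\<^sub>1 h\<^sub>2. sw H (\<Delta> k) (\<lambda>k\<^sub>1 k\<^sub>2.
      sw H (\<Delta> h\<^sub>1) (\<lambda>a x. sw H (\<Delta> k\<^sub>1) (\<lambda>b u.
        (S (a \<otimes>\<^bsub>H\<^esub> b) \<otimes>\<^bsub>H\<^esub> (x \<otimes>\<^bsub>H\<^esub> u)) \<otimes>\<^bsub>H\<^esub> (S k\<^sub>2 \<otimes>\<^bsub>H\<^esub> S h\<^sub>2)))))"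
    using h k by (intro coproduct_sum_cong) (auto simp: H.m_assoc)
  also have "\<dots> = sw H (\<Delta> h) (\<lambda>h\<^sub>1 h\<^sub>2. sw H (\<Delta> k) (\<lambda>k\<^sub>1 k\<^sub>2.
      sw H (\<Delta> h\<^sub>1) (\<lambda>a x. sw H (\<Delta> k\<^sub>1) (\<lambda>b u.
        S (a \<otimes>\<^bsub>H\<^esub> b) \<otimes>\<^bsub>H\<^esub> (x \<otimes>\<^bsub>H\<^esub> u)) \<otimes>\<^bsub>H\<^esub> (S k\<^sub>2 \<otimes>\<^bsub>H\<^esub> S h\<^sub>2))))"
    using h k by (intro coproduct_sum_cong coproduct_sum_linear[where L="\<lambda>z. z \<otimes>\<^bsub>H\<^esub> _", symmetric] lin_intros) auto
  also have "\<dots> = sw H (\<Delta> h) (\<lambda>h\<^sub>1 h\<^sub>2. sw H (\<Delta> k) (\<lambda>k\<^sub>1 k\<^sub>2.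
      sw H (\<Delta> h\<^sub>1) (\<lambda>a x. sw H (\<Delta> k\<^sub>1) (\<lambda>b u.
        S (a \<otimes>\<^bsub>H\<^esub> b) \<otimes>\<^bsub>H\<^esub> (x \<otimes>\<^bsub>H\<^esub> u))) \<otimes>\<^bsub>H\<^esub> (S k\<^sub>2 \<otimes>\<^bsub>H\<^esub> S h\<^sub>2)))"
    using h k by (intro coproduct_sum_cong coproduct_sum_linear[where L="\<lambda>z. z \<otimes>\<^bsub>H\<^esub> _", symmetric] lin_intros) auto
  also have "\<dots> = sw H (\<Delta> h) (\<lambda>h\<^sub>1 h\<^sub>2. sw H (\<Delta> k) (\<lambda>k\<^sub>1 k\<^sub>2. \<epsilon> k\<^sub>1 \<odot>\<^bsub>H\<^esub> (\<epsilon> h\<^sub>1 \<odot>\<^bsub>H\<^esub> (S k\<^sub>2 \<otimes>\<^bsub>H\<^esub> S h\<^sub>2))))"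
    using h k by (intro coproduct_sum_cong)
      (auto simp: left H_smult_mult_left HM.smult_assoc1[symmetric] HM.R.m_comm)
  also have "\<dots> = sw H (\<Delta> h) (\<lambda>h\<^sub>1 h\<^sub>2. \<epsilon> h\<^sub>1 \<odot>\<^bsub>H\<^esub> (S k \<otimes>\<^bsub>H\<^esub> S h\<^sub>2))"
    using h k by (intro coproduct_sum_cong
        coproduct_sum_counit_left[where F="\<lambda>x. _ \<odot>\<^bsub>H\<^esub> (S x \<otimes>\<^bsub>H\<^esub> _)"] lin_intros
         linear_map_compose[OF smul]) auto
  also have "\<dots> = S k \<otimes>\<^bsub>H\<^esub> S h"
    using h k by (intro coproduct_sum_counit_left[where F="\<lambda>x. S k \<otimes>\<^bsub>H\<^esub> S x"] lin_intros) auto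
  finally show ?thesis .
qed

lemma antipode_inv_closed [simp]: "h \<in> carrier H \<Longrightarrow> T h \<in> carrier H"
  and antipode_antipode_inv [simp]: "h \<in> carrier H \<Longrightarrow> S (T h) = h"
  and antipode_inv_antipode [simp]: "h \<in> carrier H \<Longrightarrow> T (S h) = h"
  using antipode_bij
  by (auto simp: bijective_antipode_def antipode_inv_def bij_betw_def
      intro: inv_into_into f_inv_into_f inv_into_f_f)

lemma antipode_inv_eqI: "x \<in> carrier H \<Longrightarrow> S x = h \<Longrightarrow> T h = x"
  using antipode_inv_antipode by blast

lemma antipode_inv_linear: "linear_map K H H T"
proof (rule linear_mapI)
  fix h k c assume h: "h \<in> carrier H"
  show "T (h \<oplus>\<^bsub>H\<^esub> k) = T h \<oplus>\<^bsub>H\<^esub> T k" if "k \<in> carrier H"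
    by (rule antipode_inv_eqI) (simp_all add: h that linear_map_add[OF antipode_linear])
  show "T (c \<odot>\<^bsub>H\<^esub> h) = c \<odot>\<^bsub>H\<^esub> T h" if "c \<in> carrier K"
    by (rule antipode_inv_eqI) (simp_all add: h that linear_map_smult[OF antipode_linear])
qed simp

lemma antipode_inv_one: "T \<one>\<^bsub>H\<^esub> = \<one>\<^bsub>H\<^esub>"
  by (rule antipode_inv_eqI) (simp_all add: antipode_one)

lemma antipode_inv_mult:
  "h \<in> carrier H \<Longrightarrow> k \<in> carrier H \<Longrightarrow> T (h \<otimes>\<^bsub>H\<^esub> k) = T k \<otimes>\<^bsub>H\<^esub> T h"
  by (rule antipode_inv_eqI) (simp_all add: antipode_mult)

lemma antipode_inv_linear_comp [lin_intros]: "linear_map K X H f \<Longrightarrow> linear_map K X H (\<lambda>x. T (f x))"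
  by (rule linear_map_compose[OF antipode_inv_linear])

lemma antipode_inv_left:
  assumes h: "h \<in> carrier H"
  shows "sw H (\<Delta> h) (\<lambda>h\<^sub>1 h\<^sub>2. T h\<^sub>2 \<otimes>\<^bsub>H\<^esub> h\<^sub>1) = \<epsilon> h \<odot>\<^bsub>H\<^esub> \<one>\<^bsub>H\<^esub>"
proof -
  have "sw H (\<Delta> h) (\<lambda>h\<^sub>1 h\<^sub>2. T h\<^sub>2 \<otimes>\<^bsub>H\<^esub> h\<^sub>1) = sw H (\<Delta> h) (\<lambda>h\<^sub>1 h\<^sub>2. T (S h\<^sub>1 \<otimes>\<^bsub>H\<^esub> h\<^sub>2))"
    using h by (intro coproduct_sum_cong) (auto simp: antipode_inv_mult)
  also have "\<dots> = T (sw H (\<Delta> h) (\<lambda>h\<^sub>1 h\<^sub>2. S h\<^sub>1 \<otimes>\<^bsub>H\<^esub> h\<^sub>2))"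
    using h by (intro coproduct_sum_linear[symmetric] antipode_inv_linear) auto
  finally show ?thesis
    using h by (simp add: antipode_left linear_map_smult[OF antipode_inv_linear] antipode_inv_one)
qed

lemma antipode_inv_right:
  assumes h: "h \<in> carrier H"
  shows "sw H (\<Delta> h) (\<lambda>h\<^sub>1 h\<^sub>2. h\<^sub>2 \<otimes>\<^bsub>H\<^esub> T h\<^sub>1) = \<epsilon> h \<odot>\<^bsub>H\<^esub> \<one>\<^bsub>H\<^esub>"
proof -
  have "sw H (\<Delta> h) (\<lambda>h\<^sub>1 h\<^sub>2. h\<^sub>2 \<otimes>\<^bsub>H\<^esub> T h\<^sub>1) = sw H (\<Delta> h) (\<lambda>h\<^sub>1 h\<^sub>2. T (h\<^sub>1 \<otimes>\<^bsub>H\<^esub> S h\<^sub>2))"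
    using h by (intro coproduct_sum_cong) (auto simp: antipode_inv_mult)
  also have "\<dots> = T (sw H (\<Delta> h) (\<lambda>h\<^sub>1 h\<^sub>2. h\<^sub>1 \<otimes>\<^bsub>H\<^esub> S h\<^sub>2))"
    using h by (intro coproduct_sum_linear[symmetric] antipode_inv_linear) auto
  finally show ?thesis
    using h by (simp add: antipode_right linear_map_smult[OF antipode_inv_linear] antipode_inv_one)
qed

end


section \<open>Coactions on products\<close>

context bijective_hopf_algebra
begin

context
  fixes A :: "('k, 'a, 'x) module_scheme" and M :: "('k, 'm, 'y) module_scheme"
    and N :: "('k, 'n, 't) module_scheme" and \<beta> :: "'a \<Rightarrow> 'm \<Rightarrow> 'n"
  assumes A: "module K A" and M: "module K M" and N: "module K N"
    and \<beta>: "bilinear_map K A M N \<beta>"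
begin

lemma pure_mult_linear:
  "a \<in> carrier A \<Longrightarrow> h \<in> carrier H \<Longrightarrow>
   bilinear_map K M H (tensor K N H) (\<lambda>m k. pure K N H (\<beta> a m) (h \<otimes>\<^bsub>H\<^esub> k))"
  by (intro bilinear_mapI lin_intros bilinear_map_comp_right[OF \<beta>] N H_module H.m_closed
      bilinear_map_closed[OF \<beta>])

lemma pure_mult_sum_linear:
  "Y \<in> carrier (tensor K M H) \<Longrightarrow>
   bilinear_map K A H (tensor K N H)
     (\<lambda>a h. sw (tensor K N H) Y (\<lambda>m k. pure K N H (\<beta> a m) (h \<otimes>\<^bsub>H\<^esub> k)))"
  by (intro bilinear_mapI linear_map_sw[OF M H_module tensor_module[OF N H_module]] lin_intros
      bilinear_map_comp_left[OF \<beta>] A N H_module H.m_closed bilinear_map_closed[OF \<beta>])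

lemma tensor_act_eq_sw:
  assumes X: "X \<in> carrier (tensor K A H)" and Y: "Y \<in> carrier (tensor K M H)"
  shows "tensor_act K N H \<beta> X Y =
     sw (tensor K N H) X (\<lambda>a h. sw (tensor K N H) Y (\<lambda>m k. pure K N H (\<beta> a m) (h \<otimes>\<^bsub>H\<^esub> k)))"
proof -
  let ?T = "tensor K N H"
  note mT = tensor_module[OF N H_module]
  have eq: "tensor_lift ?T (\<lambda>m k. pure K N H (\<beta> a m) (h \<otimes>\<^bsub>H\<^esub> k)) Y =
      sw ?T Y (\<lambda>m k. pure K N H (\<beta> a m) (h \<otimes>\<^bsub>H\<^esub> k))"
    if "a \<in> carrier A" "h \<in> carrier H" for a h
    by (rule tensor_lift_eq_sw[OF M H_module mT Y pure_mult_linear[OF that]])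
  have "bilinear_map K A H ?T (\<lambda>a h. tensor_lift ?T (\<lambda>m k. pure K N H (\<beta> a m) (h \<otimes>\<^bsub>H\<^esub> k)) Y)"
    using pure_mult_sum_linear[OF Y]
    by (intro bilinear_mapI)
       (auto intro: linear_map_cong[OF bilinear_map_left A] linear_map_cong[OF bilinear_map_right H_module]
         simp: eq)
  then have "tensor_act K N H \<beta> X Y =
      sw ?T X (\<lambda>a h. tensor_lift ?T (\<lambda>m k. pure K N H (\<beta> a m) (h \<otimes>\<^bsub>H\<^esub> k)) Y)"
    unfolding tensor_act_def by (rule tensor_lift_eq_sw[OF A H_module mT X])
  also have "\<dots> = sw ?T X (\<lambda>a h. sw ?T Y (\<lambda>m k. pure K N H (\<beta> a m) (h \<otimes>\<^bsub>H\<^esub> k)))"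
    by (rule sw_cong[OF A H_module X eq])
  finally show ?thesis .
qed

lemma tensor_act_bilinear:
  "bilinear_map K (tensor K A H) (tensor K M H) (tensor K N H) (tensor_act K N H \<beta>)"
proof (rule bilinear_mapI)
  note mT = tensor_module[OF N H_module]
  fix X assume X: "X \<in> carrier (tensor K A H)"
  show "linear_map K (tensor K M H) (tensor K N H) (tensor_act K N H \<beta> X)"
    by (rule linear_map_cong[OF _ tensor_module[OF M H_module] tensor_act_eq_sw[OF X]])
       (intro linear_map_sw[OF A H_module mT tensor_module[OF M H_module] X]
         linear_map_sw_tensor[OF M H_module mT] pure_mult_linear)
next
  note mT = tensor_module[OF N H_module]
  fix Y assume Y: "Y \<in> carrier (tensor K M H)"
  show "linear_map K (tensor K A H) (tensor K N H) (\<lambda>X. tensor_act K N H \<beta> X Y)"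
    by (rule linear_map_cong[OF _ tensor_module[OF A H_module] tensor_act_eq_sw[OF _ Y]])
       (intro linear_map_sw_tensor[OF A H_module mT] pure_mult_sum_linear[OF Y])
qed

lemma tensor_act_pure:
  assumes "a \<in> carrier A" "h \<in> carrier H" "m \<in> carrier M" "k \<in> carrier H"
  shows "tensor_act K N H \<beta> (pure K A H a h) (pure K M H m k) = pure K N H (\<beta> a m) (h \<otimes>\<^bsub>H\<^esub> k)"
proof -
  note mT = tensor_module[OF N H_module]
  show ?thesis
    using assms
    by (simp add: tensor_act_eq_sw sw_pure[OF A H_module mT pure_mult_sum_linear]
        sw_pure[OF M H_module mT pure_mult_linear])
qed

end

end

section \<open>Commutative comodule algebras with a colinear algebra map\<close>

text \<open>
  A commutative comodule algebra \<open>A\<close> with a colinear algebra map \<open>\<phi>: H \<rightarrow> A\<close>.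
\<close>

locale comodule_algebra_with_map = bijective_hopf_algebra K H
  for K :: "('k, 'z) ring_scheme" and H :: "('k, 'h) hopf" +
  fixes A :: "('k, 'a, 'x) module_scheme" and \<alpha> :: "'a \<Rightarrow> ('a, 'h) tensor_elem" and \<phi> :: "'h \<Rightarrow> 'a"
  assumes A_algebra: "algebra K A"
    and A_comodule [simp]: "comodule K H A \<alpha>"
    and A_coact_hom: "\<alpha> \<in> ring_hom A (tensor K A H)"
    and \<phi>_linear: "linear_map K H A \<phi>"
    and \<phi>_hom: "\<phi> \<in> ring_hom H A"
    and \<phi>_colinear: "h \<in> carrier H \<Longrightarrow> \<alpha> (\<phi> h) = tensor_map K A H \<phi> id (\<Delta> h)"
begin

sublocale A: cring A
  using A_algebra by (rule algebra.M_cring)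

sublocale AM: module K A
  using A_algebra by (rule algebra.module)

lemma A_module [simp]: "module K A" ..

lemma A_smult_mult_left:
  "c \<in> carrier K \<Longrightarrow> a \<in> carrier A \<Longrightarrow> b \<in> carrier A \<Longrightarrow>
   (c \<odot>\<^bsub>A\<^esub> a) \<otimes>\<^bsub>A\<^esub> b = c \<odot>\<^bsub>A\<^esub> (a \<otimes>\<^bsub>A\<^esub> b)"
  using A_algebra by (rule algebra.smult_assoc2)

lemma A_smult_mult_right:
  "c \<in> carrier K \<Longrightarrow> a \<in> carrier A \<Longrightarrow> b \<in> carrier A \<Longrightarrow>
   a \<otimes>\<^bsub>A\<^esub> (c \<odot>\<^bsub>A\<^esub> b) = c \<odot>\<^bsub>A\<^esub> (a \<otimes>\<^bsub>A\<^esub> b)"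
  using A_smult_mult_left[of c b a] by (simp add: A.m_comm)

lemma A_mult_bilinear: "bilinear_map K A A A (mult A)"
  by (intro bilinear_mapI linear_mapI)
     (simp_all add: A.l_distr A.r_distr A_smult_mult_left A_smult_mult_right)

lemmas A_mult_linear [lin_intros] =
  bilinear_map_comp_left[OF A_mult_bilinear] bilinear_map_comp_right[OF A_mult_bilinear]

lemma A_coact_closed [simp]: "a \<in> carrier A \<Longrightarrow> \<alpha> a \<in> carrier (tensor K A H)"
  by (rule comodule_coact_closed[OF A_comodule])

lemma A_coact_linear_comp [lin_intros]:
  "linear_map K X A f \<Longrightarrow> linear_map K X (tensor K A H) (\<lambda>x. \<alpha> (f x))"
  by (rule linear_map_compose[OF comodule_coact_linear[OF A_comodule]])

lemma A_coact_mult: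
  assumes "a \<in> carrier A" "b \<in> carrier A"
  shows "\<alpha> (a \<otimes>\<^bsub>A\<^esub> b) = tensor_act K A H (mult A) (\<alpha> a) (\<alpha> b)"
proof -
  have "\<alpha> (a \<otimes>\<^bsub>A\<^esub> b) = \<alpha> a \<otimes>\<^bsub>tensor K A H\<^esub> \<alpha> b"
    using A_coact_hom assms by (auto simp: ring_hom_def)
  then show ?thesis
    using assms tensor_act_eq_sw[OF A_module A_module A_module A_mult_bilinear]
      tensor_mult_eq_sw[OF A_module H_module A_mult_bilinear H_mult_bilinear] by simp
qed

lemma A_coact_one: "\<alpha> \<one>\<^bsub>A\<^esub> = pure K A H \<one>\<^bsub>A\<^esub> \<one>\<^bsub>H\<^esub>"
  using A_coact_hom by (auto simp: ring_hom_def tensor_def)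

lemma \<phi>_closed [simp]: "h \<in> carrier H \<Longrightarrow> \<phi> h \<in> carrier A"
  by (rule linear_map_closed[OF \<phi>_linear])

lemma \<phi>_one [simp]: "\<phi> \<one>\<^bsub>H\<^esub> = \<one>\<^bsub>A\<^esub>"
  using \<phi>_hom by (auto simp: ring_hom_def)

lemma \<phi>_mult: "h \<in> carrier H \<Longrightarrow> k \<in> carrier H \<Longrightarrow> \<phi> (h \<otimes>\<^bsub>H\<^esub> k) = \<phi> h \<otimes>\<^bsub>A\<^esub> \<phi> k"
  using \<phi>_hom by (auto simp: ring_hom_def)

lemma \<phi>_linear_comp [lin_intros]: "linear_map K X H f \<Longrightarrow> linear_map K X A (\<lambda>x. \<phi> (f x))"
  by (rule linear_map_compose[OF \<phi>_linear])

lemma coact_\<phi>: "h \<in> carrier H \<Longrightarrow> \<alpha> (\<phi> h) = sw (tensor K A H) (\<Delta> h) (\<lambda>h\<^sub>1 h\<^sub>2. pure K A H (\<phi> h\<^sub>1) h\<^sub>2)"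
  using \<phi>_colinear[of h] tensor_map_eq_sw[OF H_module H_module A_module H_module \<phi>_linear, of id "\<Delta> h"]
  by (simp add: id_def linear_map_ident)

end

section \<open>Relative Hopf modules\<close>

text \<open>
  An \<open>A\<close>-module \<open>M\<close> with a compatible coaction \<open>\<rho>\<close>. The module structure \<open>act\<close> and the coaction are
  separate parameters so that \<open>A\<close> itself is an instance.
\<close>

locale relative_hopf_module = comodule_algebra_with_map K H A \<alpha> \<phi>
  for K :: "('k, 'z) ring_scheme" and H :: "('k, 'h) hopf"
    and A :: "('k, 'a, 'x) module_scheme" and \<alpha> \<phi> +
  fixes M :: "('k, 'm, 'y) module_scheme" and act :: "'a \<Rightarrow> 'm \<Rightarrow> 'm" (infixr \<open>\<rhd>\<close> 72)
    and \<rho> :: "'m \<Rightarrow> ('m, 'h) tensor_elem"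
  assumes M_comodule [simp]: "comodule K H M \<rho>"
    and act_bilinear: "bilinear_map K A M M act"
    and act_one [simp]: "m \<in> carrier M \<Longrightarrow> \<one>\<^bsub>A\<^esub> \<rhd> m = m"
    and act_mult: "a \<in> carrier A \<Longrightarrow> b \<in> carrier A \<Longrightarrow> m \<in> carrier M \<Longrightarrow> (a \<otimes>\<^bsub>A\<^esub> b) \<rhd> m = a \<rhd> b \<rhd> m"
    and coact_act: "a \<in> carrier A \<Longrightarrow> m \<in> carrier M \<Longrightarrow> \<rho> (a \<rhd> m) = tensor_act K M H act (\<alpha> a) (\<rho> m)"
begin

lemma M_module [simp]: "module K M"
  by (rule comodule_module[OF M_comodule])

sublocale M: module K M by (rule M_module)

abbreviation MH where "MH \<equiv> tensor K M H"

lemma MH_module [simp]: "module K MH" and AH_module [simp]: "module K (tensor K A H)"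
  by (simp_all add: tensor_module)

lemma coact_closed [simp]: "m \<in> carrier M \<Longrightarrow> \<rho> m \<in> carrier MH"
  by (rule comodule_coact_closed[OF M_comodule])

lemmas coact_linear = comodule_coact_linear[OF M_comodule]

lemma act_closed [simp]: "a \<in> carrier A \<Longrightarrow> m \<in> carrier M \<Longrightarrow> a \<rhd> m \<in> carrier M"
  by (rule bilinear_map_closed[OF act_bilinear])

lemmas act_linear [lin_intros] =
  bilinear_map_comp_left[OF act_bilinear] bilinear_map_comp_right[OF act_bilinear]

lemma act_smult_one: "c \<in> carrier K \<Longrightarrow> m \<in> carrier M \<Longrightarrow> (c \<odot>\<^bsub>A\<^esub> \<one>\<^bsub>A\<^esub>) \<rhd> m = c \<odot>\<^bsub>M\<^esub> m"
  using linear_map_smult[OF bilinear_map_left[OF act_bilinear]] by simp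

lemmas M_sum_closed [simp] = coact_sum_closed[OF M_comodule]
lemmas M_sum_cong = coact_sum_cong[OF M_comodule]
lemmas M_sum_linear = coact_sum_linear[OF M_comodule]
lemmas M_sum_coassoc = coact_sum_coassoc[OF M_comodule]
lemmas A_sum_cong = coact_sum_cong[OF A_comodule]
lemmas A_sum_linear = coact_sum_linear[OF A_comodule]
lemmas linear_map_M_sum_arg [lin_intros] = linear_map_coact_sum_arg[OF M_comodule]

text \<open>The action of \<open>A \<otimes> H\<close> on \<open>M \<otimes> H\<close>.\<close>

abbreviation tact where "tact \<equiv> tensor_act K M H act"

lemma tact_bilinear: "bilinear_map K (tensor K A H) MH MH tact"
  by (rule tensor_act_bilinear[OF A_module M_module M_module act_bilinear])

lemmas tact_linear [lin_intros] =
  bilinear_map_comp_left[OF tact_bilinear] bilinear_map_comp_right[OF tact_bilinear]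

lemma tact_closed [simp]: "X \<in> carrier (tensor K A H) \<Longrightarrow> Y \<in> carrier MH \<Longrightarrow> tact X Y \<in> carrier MH"
  by (rule bilinear_map_closed[OF tact_bilinear])

lemmas tact_pure = tensor_act_pure[OF A_module M_module M_module act_bilinear]

lemma tact_mult:
  assumes X: "X \<in> carrier (tensor K A H)" and Y: "Y \<in> carrier (tensor K A H)" and Z: "Z \<in> carrier MH"
  shows "tact (tensor_act K A H (mult A) X Y) Z = tact X (tact Y Z)"
proof -
  note mu = tensor_act_bilinear[OF A_module A_module A_module A_mult_bilinear]
  note mu_closed = bilinear_map_closed[OF mu]
  note mu_pure = tensor_act_pure[OF A_module A_module A_module A_mult_bilinear]
  note lin = lin_intros bilinear_map_comp_left[OF mu] bilinear_map_comp_right[OF mu]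
  let ?AH = "tensor K A H" and ?mu = "tensor_act K A H (mult A)"
  have "tact (?mu (pure K A H a h) (pure K A H b k)) (pure K M H m l) =
        tact (pure K A H a h) (tact (pure K A H b k) (pure K M H m l))"
    if "a \<in> carrier A" "h \<in> carrier H" "b \<in> carrier A" "k \<in> carrier H" "m \<in> carrier M" "l \<in> carrier H"
    for a h b k m l
    using that by (simp add: mu_pure tact_pure act_mult H.m_assoc)
  then have "tact (?mu (pure K A H a h) (pure K A H b k)) Z =
        tact (pure K A H a h) (tact (pure K A H b k) Z)"
    if "a \<in> carrier A" "h \<in> carrier H" "b \<in> carrier A" "k \<in> carrier H" for a h b k
    using that
    by (intro linear_map_tensor_eqI[OF M_module H_module MH_module _ _ _ Z,
          where F="\<lambda>Z. tact (?mu (pure K A H a h) (pure K A H b k)) Z"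
            and G="\<lambda>Z. tact (pure K A H a h) (tact (pure K A H b k) Z)"] lin mu_closed) auto
  then have "tact (?mu (pure K A H a h) Y) Z = tact (pure K A H a h) (tact Y Z)"
    if "a \<in> carrier A" "h \<in> carrier H" for a h
    using that Z
    by (intro linear_map_tensor_eqI[OF A_module H_module MH_module _ _ _ Y,
          where F="\<lambda>Y. tact (?mu (pure K A H a h) Y) Z"
            and G="\<lambda>Y. tact (pure K A H a h) (tact Y Z)"] lin mu_closed) auto
  then show ?thesis
    using Y Z
    by (intro linear_map_tensor_eqI[OF A_module H_module MH_module _ _ _ X,
          where F="\<lambda>X. tact (?mu X Y) Z" and G="\<lambda>X. tact X (tact Y Z)"] lin mu_closed) auto
qed

lemma tact_one:
  assumes Z: "Z \<in> carrier MH"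
  shows "tact (pure K A H \<one>\<^bsub>A\<^esub> \<one>\<^bsub>H\<^esub>) Z = Z"
  by (rule linear_map_tensor_eqI[OF M_module H_module MH_module _ _ _ Z,
          where F="\<lambda>Z. tact (pure K A H \<one>\<^bsub>A\<^esub> \<one>\<^bsub>H\<^esub>) Z" and G="\<lambda>Z. Z"])
     (auto intro!: lin_intros simp: tact_pure)

text \<open>A Sweedler sum over \<open>\<rho> (a \<rhd> m)\<close>.\<close>

lemma sum_coact_act:
  assumes U: "module K U" and \<beta>: "bilinear_map K M H U \<beta>" and a: "a \<in> carrier A" and m: "m \<in> carrier M"
  shows "sw U (\<rho> (a \<rhd> m)) \<beta> =
     sw U (\<alpha> a) (\<lambda>a\<^sub>0 a\<^sub>1. sw U (\<rho> m) (\<lambda>m\<^sub>0 m\<^sub>1. \<beta> (a\<^sub>0 \<rhd> m\<^sub>0) (a\<^sub>1 \<otimes>\<^bsub>H\<^esub> m\<^sub>1)))"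
proof -
  note L = linear_map_sw_tensor[OF M_module H_module U \<beta>]
  have "sw U (\<rho> (a \<rhd> m)) \<beta> = sw U (sw MH (\<alpha> a) (\<lambda>a\<^sub>0 a\<^sub>1. sw MH (\<rho> m) (\<lambda>m\<^sub>0 m\<^sub>1.
      pure K M H (a\<^sub>0 \<rhd> m\<^sub>0) (a\<^sub>1 \<otimes>\<^bsub>H\<^esub> m\<^sub>1)))) \<beta>"
    using a m by (simp add: coact_act tensor_act_eq_sw[OF A_module M_module M_module act_bilinear])
  also have "\<dots> = sw U (\<alpha> a) (\<lambda>a\<^sub>0 a\<^sub>1. sw U (sw MH (\<rho> m) (\<lambda>m\<^sub>0 m\<^sub>1.
      pure K M H (a\<^sub>0 \<rhd> m\<^sub>0) (a\<^sub>1 \<otimes>\<^bsub>H\<^esub> m\<^sub>1))) \<beta>)"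
    using a m U by (intro A_sum_linear[OF _ _ _ L]) auto
  also have "\<dots> = sw U (\<alpha> a) (\<lambda>a\<^sub>0 a\<^sub>1. sw U (\<rho> m) (\<lambda>m\<^sub>0 m\<^sub>1. sw U (
      pure K M H (a\<^sub>0 \<rhd> m\<^sub>0) (a\<^sub>1 \<otimes>\<^bsub>H\<^esub> m\<^sub>1)) \<beta>))"
    using a m U by (intro A_sum_cong M_sum_linear[OF _ _ _ L]) auto
  also have "\<dots> = sw U (\<alpha> a) (\<lambda>a\<^sub>0 a\<^sub>1. sw U (\<rho> m) (\<lambda>m\<^sub>0 m\<^sub>1. \<beta> (a\<^sub>0 \<rhd> m\<^sub>0) (a\<^sub>1 \<otimes>\<^bsub>H\<^esub> m\<^sub>1)))"
    using a m U by (intro A_sum_cong M_sum_cong sw_pure[OF _ _ _ \<beta>]) auto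
  finally show ?thesis .
qed

subsection \<open>The projection onto the coinvariants\<close>

text \<open>The map \<open>p(m) = \<phi>(S\<^sup>-\<^sup>1(m\<^sub>1)) m\<^sub>0\<close>.\<close>

definition proj :: "'m \<Rightarrow> 'm" where
  "proj m = sw M (\<rho> m) (\<lambda>m\<^sub>0 m\<^sub>1. \<phi> (T m\<^sub>1) \<rhd> m\<^sub>0)"

lemma proj_bilinear: "bilinear_map K M H M (\<lambda>m\<^sub>0 m\<^sub>1. \<phi> (T m\<^sub>1) \<rhd> m\<^sub>0)"
  by (intro bilinear_mapI lin_intros) auto

lemma proj_linear_comp [lin_intros]: "linear_map K X M f \<Longrightarrow> linear_map K X M (\<lambda>x. proj (f x))"
  unfolding proj_def by (intro lin_intros proj_bilinear M_module)

lemma proj_closed [simp]: "m \<in> carrier M \<Longrightarrow> proj m \<in> carrier M"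
  unfolding proj_def by simp

lemma proj_eq_tensor_lift:
  "m \<in> carrier M \<Longrightarrow> tensor_lift M (\<lambda>m\<^sub>0 m\<^sub>1. \<phi> (T m\<^sub>1) \<rhd> m\<^sub>0) (\<rho> m) = proj m"
  unfolding proj_def by (rule tensor_lift_coact[OF M_comodule M_module proj_bilinear])

text \<open>\<open>\<phi>(m\<^sub>1) p(m\<^sub>0) = \<phi>(m\<^sub>2 S\<^sup>-\<^sup>1(m\<^sub>1)) m\<^sub>0 = m\<close>\<close>

lemma sum_proj:
  assumes m: "m \<in> carrier M"
  shows "sw M (\<rho> m) (\<lambda>m\<^sub>0 m\<^sub>1. \<phi> m\<^sub>1 \<rhd> proj m\<^sub>0) = m"
proof -
  have "sw M (\<rho> m) (\<lambda>m\<^sub>0 m\<^sub>1. \<phi> m\<^sub>1 \<rhd> proj m\<^sub>0) =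
      sw M (\<rho> m) (\<lambda>m\<^sub>0 m\<^sub>1. sw M (\<rho> m\<^sub>0) (\<lambda>x h. \<phi> m\<^sub>1 \<rhd> \<phi> (T h) \<rhd> x))"
    unfolding proj_def using m
    by (intro M_sum_cong M_sum_linear[where L="\<lambda>z. _ \<rhd> z"] lin_intros) auto
  also have "\<dots> = sw M (\<rho> m) (\<lambda>m\<^sub>0 m\<^sub>1. sw M (\<Delta> m\<^sub>1) (\<lambda>h\<^sub>1 h\<^sub>2. \<phi> h\<^sub>2 \<rhd> \<phi> (T h\<^sub>1) \<rhd> m\<^sub>0))"
    using m by (intro M_sum_coassoc lin_intros) auto
  also have "\<dots> = sw M (\<rho> m) (\<lambda>m\<^sub>0 m\<^sub>1. sw M (\<Delta> m\<^sub>1) (\<lambda>h\<^sub>1 h\<^sub>2. \<phi> (h\<^sub>2 \<otimes>\<^bsub>H\<^esub> T h\<^sub>1) \<rhd> m\<^sub>0))"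
    using m by (intro M_sum_cong coproduct_sum_cong) (auto simp: \<phi>_mult act_mult)
  also have "\<dots> = sw M (\<rho> m) (\<lambda>m\<^sub>0 m\<^sub>1. \<phi> (sw H (\<Delta> m\<^sub>1) (\<lambda>h\<^sub>1 h\<^sub>2. h\<^sub>2 \<otimes>\<^bsub>H\<^esub> T h\<^sub>1)) \<rhd> m\<^sub>0)"
    using m by (intro M_sum_cong coproduct_sum_linear[where L="\<lambda>z. \<phi> z \<rhd> _", symmetric] lin_intros) auto
  also have "\<dots> = sw M (\<rho> m) (\<lambda>m\<^sub>0 m\<^sub>1. \<epsilon> m\<^sub>1 \<odot>\<^bsub>M\<^esub> m\<^sub>0)"
    using m by (intro M_sum_cong)
      (auto simp: antipode_inv_right linear_map_smult[OF \<phi>_linear] act_smult_one)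
  also have "\<dots> = m"
    using m by (intro coact_sum_counit[OF M_comodule, where F="\<lambda>x. x"] lin_intros) auto
  finally show ?thesis .
qed

text \<open>
  For a linear map \<open>q\<close> from a comodule \<open>V\<close> to \<open>M\<close>, put \<open>g(v) = \<phi>(v\<^sub>1) q(v\<^sub>0)\<close>. Since \<open>\<phi>\<close> is colinear,
  \<open>\<alpha>(\<phi>(v\<^sub>1)) (q(v\<^sub>0) \<otimes> 1) = g(v\<^sub>0) \<otimes> v\<^sub>1\<close>.
\<close>

lemma sum_tact_\<phi>:
  assumes V: "comodule K H V \<sigma>" and q: "linear_map K V M q" and v: "v \<in> carrier V"
  shows "sw MH (\<sigma> v) (\<lambda>v\<^sub>0 v\<^sub>1. tact (\<alpha> (\<phi> v\<^sub>1)) (pure K M H (q v\<^sub>0) \<one>\<^bsub>H\<^esub>)) =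
         sw MH (\<sigma> v) (\<lambda>v\<^sub>0 v\<^sub>1. pure K M H (sw M (\<sigma> v\<^sub>0) (\<lambda>x h. \<phi> h \<rhd> q x)) v\<^sub>1)"
proof -
  note qc [simp] = linear_map_closed[OF q]
  have 1: "tact (\<alpha> (\<phi> h)) (pure K M H n \<one>\<^bsub>H\<^esub>) = sw MH (\<Delta> h) (\<lambda>h\<^sub>1 h\<^sub>2. pure K M H (\<phi> h\<^sub>1 \<rhd> n) h\<^sub>2)"
    if "h \<in> carrier H" "n \<in> carrier M" for h n
  proof -
    have "tact (\<alpha> (\<phi> h)) (pure K M H n \<one>\<^bsub>H\<^esub>) =
       sw MH (\<Delta> h) (\<lambda>h\<^sub>1 h\<^sub>2. tact (pure K A H (\<phi> h\<^sub>1) h\<^sub>2) (pure K M H n \<one>\<^bsub>H\<^esub>))"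
      unfolding coact_\<phi>[OF that(1)] using that
      by (intro coproduct_sum_linear[where L="\<lambda>X. tact X _"] lin_intros) auto
    also have "\<dots> = sw MH (\<Delta> h) (\<lambda>h\<^sub>1 h\<^sub>2. pure K M H (\<phi> h\<^sub>1 \<rhd> n) h\<^sub>2)"
      using that by (intro coproduct_sum_cong) (auto simp: tact_pure)
    finally show ?thesis .
  qed
  have "sw MH (\<sigma> v) (\<lambda>v\<^sub>0 v\<^sub>1. tact (\<alpha> (\<phi> v\<^sub>1)) (pure K M H (q v\<^sub>0) \<one>\<^bsub>H\<^esub>)) =
    sw MH (\<sigma> v) (\<lambda>v\<^sub>0 v\<^sub>1. sw MH (\<Delta> v\<^sub>1) (\<lambda>h\<^sub>1 h\<^sub>2. pure K M H (\<phi> h\<^sub>1 \<rhd> q v\<^sub>0) h\<^sub>2))"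
    using v by (intro coact_sum_cong[OF V]) (auto simp: 1)
  also have "\<dots> = sw MH (\<sigma> v) (\<lambda>v\<^sub>0 v\<^sub>1. sw MH (\<sigma> v\<^sub>0) (\<lambda>x h. pure K M H (\<phi> h \<rhd> q x) v\<^sub>1))"
    using v by (intro coact_sum_coassoc[OF V, symmetric] lin_intros q) auto
  also have "\<dots> = sw MH (\<sigma> v) (\<lambda>v\<^sub>0 v\<^sub>1. pure K M H (sw M (\<sigma> v\<^sub>0) (\<lambda>x h. \<phi> h \<rhd> q x)) v\<^sub>1)"
    using v by (intro coact_sum_cong[OF V]
        coact_sum_linear[OF V, where L="\<lambda>z. pure K M H z _", symmetric] lin_intros) auto
  finally show ?thesis .
qed

text \<open>
  The map \<open>p\<close> takes its values in the coinvariants: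
  \<open>p(m) \<otimes> 1 = \<alpha>(\<phi>(S\<^sup>-\<^sup>1(m\<^sub>2) m\<^sub>1)) (p(m\<^sub>0) \<otimes> 1) = \<alpha>(\<phi>(S\<^sup>-\<^sup>1(m\<^sub>1))) \<rho>(m\<^sub>0) = \<rho>(p(m))\<close>.
  The middle step is the preceding lemma for \<open>q = p\<close>, where \<open>g(m) = m\<close>. This argument needs the
  multiplicativity of \<open>\<alpha>\<close>, but not that \<open>S\<close> reverses the comultiplication.
\<close>

lemma coact_proj:
  assumes m: "m \<in> carrier M"
  shows "\<rho> (proj m) = pure K M H (proj m) \<one>\<^bsub>H\<^esub>"
proof -
  have unit: "\<epsilon> h \<odot>\<^bsub>MH\<^esub> Z = sw MH (\<Delta> h) (\<lambda>h\<^sub>1 h\<^sub>2. tact (\<alpha> (\<phi> (T h\<^sub>2))) (tact (\<alpha> (\<phi> h\<^sub>1)) Z))"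
    if h: "h \<in> carrier H" and Z: "Z \<in> carrier MH" for h Z
  proof -
    have L: "linear_map K H MH (\<lambda>x. tact (\<alpha> (\<phi> x)) Z)"
      by (intro lin_intros Z)
    have "\<epsilon> h \<odot>\<^bsub>MH\<^esub> Z = \<epsilon> h \<odot>\<^bsub>MH\<^esub> tact (\<alpha> (\<phi> \<one>\<^bsub>H\<^esub>)) Z"
      using Z by (simp add: A_coact_one tact_one)
    also have "\<dots> = tact (\<alpha> (\<phi> (\<epsilon> h \<odot>\<^bsub>H\<^esub> \<one>\<^bsub>H\<^esub>))) Z"
      using h by (intro linear_map_smult[OF L, symmetric]) auto
    also have "\<dots> = tact (\<alpha> (\<phi> (sw H (\<Delta> h) (\<lambda>h\<^sub>1 h\<^sub>2. T h\<^sub>2 \<otimes>\<^bsub>H\<^esub> h\<^sub>1)))) Z"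
      using h by (simp add: antipode_inv_left)
    also have "\<dots> = sw MH (\<Delta> h) (\<lambda>h\<^sub>1 h\<^sub>2. tact (\<alpha> (\<phi> (T h\<^sub>2 \<otimes>\<^bsub>H\<^esub> h\<^sub>1))) Z)"
      using h by (intro coproduct_sum_linear[OF _ _ _ L]) auto
    also have "\<dots> = sw MH (\<Delta> h) (\<lambda>h\<^sub>1 h\<^sub>2. tact (\<alpha> (\<phi> (T h\<^sub>2))) (tact (\<alpha> (\<phi> h\<^sub>1)) Z))"
      using h Z by (intro coproduct_sum_cong) (auto simp: \<phi>_mult A_coact_mult tact_mult)
    finally show ?thesis .
  qed
  have "pure K M H (proj m) \<one>\<^bsub>H\<^esub> = sw MH (\<rho> m) (\<lambda>m\<^sub>0 m\<^sub>1. \<epsilon> m\<^sub>1 \<odot>\<^bsub>MH\<^esub> pure K M H (proj m\<^sub>0) \<one>\<^bsub>H\<^esub>)"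
    using m
    by (intro coact_sum_counit[OF M_comodule, where F="\<lambda>x. pure K M H (proj x) \<one>\<^bsub>H\<^esub>", symmetric] lin_intros) auto
  also have "\<dots> = sw MH (\<rho> m) (\<lambda>m\<^sub>0 m\<^sub>1. sw MH (\<Delta> m\<^sub>1) (\<lambda>h\<^sub>1 h\<^sub>2.
      tact (\<alpha> (\<phi> (T h\<^sub>2))) (tact (\<alpha> (\<phi> h\<^sub>1)) (pure K M H (proj m\<^sub>0) \<one>\<^bsub>H\<^esub>))))"
    using m by (intro M_sum_cong unit) auto
  also have "\<dots> = sw MH (\<rho> m) (\<lambda>m\<^sub>0 m\<^sub>1. sw MH (\<rho> m\<^sub>0) (\<lambda>x h.
      tact (\<alpha> (\<phi> (T m\<^sub>1))) (tact (\<alpha> (\<phi> h)) (pure K M H (proj x) \<one>\<^bsub>H\<^esub>))))"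
    using m by (intro M_sum_coassoc[symmetric] lin_intros) auto
  also have "\<dots> = sw MH (\<rho> m) (\<lambda>m\<^sub>0 m\<^sub>1. tact (\<alpha> (\<phi> (T m\<^sub>1))) (sw MH (\<rho> m\<^sub>0) (\<lambda>x h.
      tact (\<alpha> (\<phi> h)) (pure K M H (proj x) \<one>\<^bsub>H\<^esub>))))"
    using m by (intro M_sum_cong M_sum_linear[where L="\<lambda>Z. tact _ Z", symmetric] lin_intros) auto
  also have "\<dots> = sw MH (\<rho> m) (\<lambda>m\<^sub>0 m\<^sub>1. tact (\<alpha> (\<phi> (T m\<^sub>1))) (\<rho> m\<^sub>0))"
  proof (rule M_sum_cong[OF m])
    fix x h assume x: "x \<in> carrier M"
    have "sw MH (\<rho> x) (\<lambda>y k. tact (\<alpha> (\<phi> k)) (pure K M H (proj y) \<one>\<^bsub>H\<^esub>)) =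
          sw MH (\<rho> x) (\<lambda>y k. pure K M H (sw M (\<rho> y) (\<lambda>z l. \<phi> l \<rhd> proj z)) k)"
      using x by (intro sum_tact_\<phi> lin_intros) (auto simp: linear_map_ident)
    also have "\<dots> = sw MH (\<rho> x) (pure K M H)"
      using x by (intro M_sum_cong) (auto simp: sum_proj)
    also have "\<dots> = \<rho> x"
      using x by (rule coact_sum_pure[OF M_comodule])
    finally show "tact (\<alpha> (\<phi> (T h))) (sw MH (\<rho> x) (\<lambda>y k. tact (\<alpha> (\<phi> k)) (pure K M H (proj y) \<one>\<^bsub>H\<^esub>))) =
      tact (\<alpha> (\<phi> (T h))) (\<rho> x)" by simp
  qed
  also have "\<dots> = sw MH (\<rho> m) (\<lambda>m\<^sub>0 m\<^sub>1. \<rho> (\<phi> (T m\<^sub>1) \<rhd> m\<^sub>0))"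
    using m by (intro M_sum_cong) (auto simp: coact_act)
  also have "\<dots> = \<rho> (proj m)"
    unfolding proj_def using m by (intro M_sum_linear[symmetric] coact_linear) auto
  finally show ?thesis by simp
qed

lemma sum_coinvariant:
  assumes "module K U" "bilinear_map K M H U \<beta>" "n \<in> carrier M" "\<rho> n = pure K M H n \<one>\<^bsub>H\<^esub>"
  shows "sw U (\<rho> n) \<beta> = \<beta> n \<one>\<^bsub>H\<^esub>"
  using assms by (simp add: sw_pure[OF M_module H_module])

lemma proj_coinvariant:
  assumes "n \<in> carrier M" "\<rho> n = pure K M H n \<one>\<^bsub>H\<^esub>"
  shows "proj n = n"
  unfolding proj_def sum_coinvariant[OF M_module proj_bilinear assms]
  using assms by (simp add: antipode_inv_one)

end

lemma (in comodule_algebra_with_map) regular_hopf_module: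
  "relative_hopf_module K H A \<alpha> \<phi> A (mult A) \<alpha>"
  by unfold_locales (auto simp: A_mult_bilinear A.m_assoc A_coact_mult)

context relative_hopf_module
begin

sublocale A: relative_hopf_module K H A \<alpha> \<phi> A "mult A" \<alpha>
  by (rule regular_hopf_module)

text \<open>Commutativity of \<open>A\<close> compensates for \<open>S\<^sup>-\<^sup>1\<close> reversing products.\<close>

lemma proj_act:
  assumes a: "a \<in> carrier A" and m: "m \<in> carrier M"
  shows "proj (a \<rhd> m) = A.proj a \<rhd> proj m"
proof -
  have "proj (a \<rhd> m) =
    sw M (\<alpha> a) (\<lambda>a\<^sub>0 a\<^sub>1. sw M (\<rho> m) (\<lambda>m\<^sub>0 m\<^sub>1. \<phi> (T (a\<^sub>1 \<otimes>\<^bsub>H\<^esub> m\<^sub>1)) \<rhd> a\<^sub>0 \<rhd> m\<^sub>0))"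
    unfolding proj_def by (rule sum_coact_act[OF M_module proj_bilinear a m])
  also have "\<dots> = sw M (\<alpha> a) (\<lambda>a\<^sub>0 a\<^sub>1. sw M (\<rho> m) (\<lambda>m\<^sub>0 m\<^sub>1. (\<phi> (T a\<^sub>1) \<otimes>\<^bsub>A\<^esub> a\<^sub>0) \<rhd> \<phi> (T m\<^sub>1) \<rhd> m\<^sub>0))"
    using a m by (intro A_sum_cong M_sum_cong)
      (auto simp: antipode_inv_mult \<phi>_mult act_mult[symmetric] A.m_ac)
  also have "\<dots> = sw M (\<alpha> a) (\<lambda>a\<^sub>0 a\<^sub>1. (\<phi> (T a\<^sub>1) \<otimes>\<^bsub>A\<^esub> a\<^sub>0) \<rhd> proj m)"
    unfolding proj_def using a m
    by (intro A_sum_cong M_sum_linear[where L="\<lambda>z. _ \<rhd> z", symmetric] lin_intros) auto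
  also have "\<dots> = A.proj a \<rhd> proj m"
    unfolding A.proj_def using a m
    by (intro A_sum_linear[where L="\<lambda>z. z \<rhd> _", symmetric] lin_intros) auto
  finally show ?thesis .
qed

end


section \<open>Extending maps into coinvariants\<close>

text \<open>
  For relative Hopf modules \<open>M\<close> and \<open>N\<close>, a linear map \<open>q\<close> from \<open>M\<close> to the coinvariants of \<open>N\<close> that is
  semilinear along \<open>a \<mapsto> p(a)\<close> gives rise to a map \<open>g m = \<phi>(m\<^sub>1) q(m\<^sub>0)\<close> of relative Hopf modules.
\<close>

locale coinvariant_extension =
  M: relative_hopf_module K H A \<alpha> \<phi> M actM \<rho> + N: relative_hopf_module K H A \<alpha> \<phi> N actN \<sigma>
  for K :: "('k, 'z) ring_scheme" and H :: "('k, 'h) hopf"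
    and A :: "('k, 'a, 'x) module_scheme" and \<alpha> \<phi>
    and M :: "('k, 'm, 'y) module_scheme" and actM and \<rho>
    and N :: "('k, 'n, 't) module_scheme" and actN and \<sigma> +
  fixes q :: "'m \<Rightarrow> 'n"
  assumes q_linear: "linear_map K M N q"
    and coact_q: "m \<in> carrier M \<Longrightarrow> \<sigma> (q m) = pure K N H (q m) \<one>\<^bsub>H\<^esub>"
    and q_act: "a \<in> carrier A \<Longrightarrow> m \<in> carrier M \<Longrightarrow> q (actM a m) = actN (M.A.proj a) (q m)"
begin

definition ext :: "'m \<Rightarrow> 'n" where
  "ext m = sw N (\<rho> m) (\<lambda>m\<^sub>0 m\<^sub>1. actN (\<phi> m\<^sub>1) (q m\<^sub>0))"

lemma q_closed [simp]: "m \<in> carrier M \<Longrightarrow> q m \<in> carrier N"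
  by (rule linear_map_closed[OF q_linear])

lemma q_linear_comp [lin_intros]: "linear_map K X M f \<Longrightarrow> linear_map K X N (\<lambda>x. q (f x))"
  by (rule linear_map_compose[OF q_linear])

lemma ext_bilinear: "bilinear_map K M H N (\<lambda>m\<^sub>0 m\<^sub>1. actN (\<phi> m\<^sub>1) (q m\<^sub>0))"
  by (intro bilinear_mapI lin_intros) auto

lemma ext_linear: "linear_map K M N ext"
  unfolding ext_def[abs_def] by (intro lin_intros ext_bilinear N.M_module)

lemma ext_closed [simp]: "m \<in> carrier M \<Longrightarrow> ext m \<in> carrier N"
  by (rule linear_map_closed[OF ext_linear])

lemma ext_coinvariant:
  "n \<in> carrier M \<Longrightarrow> \<rho> n = pure K M H n \<one>\<^bsub>H\<^esub> \<Longrightarrow> ext n = q n"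
  unfolding ext_def by (subst M.sum_coinvariant[OF N.M_module ext_bilinear]) auto

lemma ext_colinear:
  assumes m: "m \<in> carrier M"
  shows "\<sigma> (ext m) = tensor_map K N H ext id (\<rho> m)"
proof -
  have "\<sigma> (ext m) = sw N.MH (\<rho> m) (\<lambda>m\<^sub>0 m\<^sub>1. \<sigma> (actN (\<phi> m\<^sub>1) (q m\<^sub>0)))"
    unfolding ext_def using m by (intro M.M_sum_linear N.coact_linear) auto
  also have "\<dots> = sw N.MH (\<rho> m) (\<lambda>m\<^sub>0 m\<^sub>1. N.tact (\<alpha> (\<phi> m\<^sub>1)) (pure K N H (q m\<^sub>0) \<one>\<^bsub>H\<^esub>))"
    using m by (intro M.M_sum_cong) (auto simp: N.coact_act coact_q)
  also have "\<dots> = sw N.MH (\<rho> m) (\<lambda>m\<^sub>0 m\<^sub>1. pure K N H (ext m\<^sub>0) m\<^sub>1)"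
    unfolding ext_def by (rule N.sum_tact_\<phi>[OF M.M_comodule q_linear m])
  also have "\<dots> = tensor_map K N H ext id (\<rho> m)"
    using m tensor_map_eq_sw[OF M.M_module M.H_module N.M_module M.H_module ext_linear, of id "\<rho> m"]
    by (simp add: id_def linear_map_ident)
  finally show ?thesis .
qed

lemma ext_act:
  assumes a: "a \<in> carrier A" and m: "m \<in> carrier M"
  shows "ext (actM a m) = actN a (ext m)"
proof -
  have "ext (actM a m) =
    sw N (\<alpha> a) (\<lambda>a\<^sub>0 a\<^sub>1. sw N (\<rho> m) (\<lambda>m\<^sub>0 m\<^sub>1. actN (\<phi> (a\<^sub>1 \<otimes>\<^bsub>H\<^esub> m\<^sub>1)) (q (actM a\<^sub>0 m\<^sub>0))))"
    unfolding ext_def by (rule M.sum_coact_act[OF N.M_module ext_bilinear a m])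
  also have "\<dots> = sw N (\<alpha> a) (\<lambda>a\<^sub>0 a\<^sub>1. sw N (\<rho> m) (\<lambda>m\<^sub>0 m\<^sub>1.
      actN (\<phi> a\<^sub>1 \<otimes>\<^bsub>A\<^esub> M.A.proj a\<^sub>0) (actN (\<phi> m\<^sub>1) (q m\<^sub>0))))"
    using a m by (intro M.A_sum_cong M.M_sum_cong)
      (auto simp: M.\<phi>_mult q_act N.act_mult[symmetric] M.A.m_ac)
  also have "\<dots> = sw N (\<alpha> a) (\<lambda>a\<^sub>0 a\<^sub>1. actN (\<phi> a\<^sub>1 \<otimes>\<^bsub>A\<^esub> M.A.proj a\<^sub>0) (ext m))"
    unfolding ext_def using a m
    by (intro M.A_sum_cong M.M_sum_linear[where L="\<lambda>z. actN _ z", symmetric] lin_intros) auto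
  also have "\<dots> = actN (sw A (\<alpha> a) (\<lambda>a\<^sub>0 a\<^sub>1. \<phi> a\<^sub>1 \<otimes>\<^bsub>A\<^esub> M.A.proj a\<^sub>0)) (ext m)"
    using a m by (intro M.A_sum_linear[where L="\<lambda>z. actN z _", symmetric] lin_intros) auto
  also have "\<dots> = actN a (ext m)"
    using a by (simp add: M.A.sum_proj)
  finally show ?thesis .
qed

end

section \<open>Transposed Poisson centers\<close>

lemma add_pow_two:
  fixes M (structure)
  assumes "abelian_group M" "x \<in> carrier M"
  shows "[(2::nat)] \<cdot> x = x \<oplus> x"
proof -
  interpret abelian_group M by fact
  show ?thesis using assms(2) by (simp add: numeral_2_eq_2)
qed

text \<open>
  Membership in \<open>M\<^sup>A\<close> only has to be tested for brackets with \<open>1\<close>: if \<open>{1,b} n = 1 \<diamond> (b n)\<close> for all \<open>b\<close>,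
  the identity \<open>2{1,b} n = 1 \<diamond> (b n) - b \<diamond> n\<close> yields \<open>b \<diamond> n = {b,1} n\<close>, and
  then \<open>a \<diamond> (b n) = 2b (a \<diamond> n) - (ba) \<diamond> n = (2b{a,1} - {ba,1}) n = {a,b} n\<close>.
\<close>

lemma module_centerI:
  assumes A: "transposed_poisson_algebra K A" and M: "transposed_poisson_module K A M"
    and n: "n \<in> carrier M"
    and unit: "\<And>b. b \<in> carrier A \<Longrightarrow> act M (bracket A \<one>\<^bsub>A\<^esub> b) n = lie_act M \<one>\<^bsub>A\<^esub> (act M b n)"
  shows "n \<in> module_center A M"
proof -
  have alg: "algebra K A" and br: "bilinear_map K A A A (bracket A)"
    and alt: "\<And>a. a \<in> carrier A \<Longrightarrow> bracket A a a = \<zero>\<^bsub>A\<^esub>"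
    and tp: "\<And>a b c. a \<in> carrier A \<Longrightarrow> b \<in> carrier A \<Longrightarrow> c \<in> carrier A \<Longrightarrow>
        [(2::nat)] \<cdot>\<^bsub>A\<^esub> (a \<otimes>\<^bsub>A\<^esub> bracket A b c) =
        bracket A (a \<otimes>\<^bsub>A\<^esub> b) c \<oplus>\<^bsub>A\<^esub> bracket A b (a \<otimes>\<^bsub>A\<^esub> c)"
    using A by (auto simp: transposed_poisson_algebra_def lie_bracket_def)
  interpret A: cring A using alg by (rule algebra.M_cring)
  have M': "module K M" and ab: "bilinear_map K A M M (act M)" and lb: "bilinear_map K A M M (lie_act M)"
    and one: "\<And>m. m \<in> carrier M \<Longrightarrow> act M \<one>\<^bsub>A\<^esub> m = m"
    and amult: "\<And>a b m. a \<in> carrier A \<Longrightarrow> b \<in> carrier A \<Longrightarrow> m \<in> carrier M \<Longrightarrow>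
       act M (a \<otimes>\<^bsub>A\<^esub> b) m = act M a (act M b m)"
    and ax1: "\<And>a b m. a \<in> carrier A \<Longrightarrow> b \<in> carrier A \<Longrightarrow> m \<in> carrier M \<Longrightarrow>
       [(2::nat)] \<cdot>\<^bsub>M\<^esub> act M (bracket A a b) m = lie_act M a (act M b m) \<ominus>\<^bsub>M\<^esub> lie_act M b (act M a m)"
    and ax2: "\<And>a b m. a \<in> carrier A \<Longrightarrow> b \<in> carrier A \<Longrightarrow> m \<in> carrier M \<Longrightarrow>
       [(2::nat)] \<cdot>\<^bsub>M\<^esub> act M a (lie_act M b m) = lie_act M (a \<otimes>\<^bsub>A\<^esub> b) m \<oplus>\<^bsub>M\<^esub> lie_act M b (act M a m)"
    using M unfolding transposed_poisson_module_def by blast+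
  interpret M: module K M by fact
  have brc [simp]: "bracket A a b \<in> carrier A" if "a \<in> carrier A" "b \<in> carrier A" for a b
    using bilinear_map_closed[OF br that] .
  have ac [simp]: "act M a m \<in> carrier M" if "a \<in> carrier A" "m \<in> carrier M" for a m
    using bilinear_map_closed[OF ab that] .
  have lc [simp]: "lie_act M a m \<in> carrier M" if "a \<in> carrier A" "m \<in> carrier M" for a m
    using bilinear_map_closed[OF lb that] .
  note aadd = linear_map_add[OF bilinear_map_left[OF ab]]
  note two = add_pow_two[OF M.M.abelian_group_axioms] add_pow_two[OF A.abelian_group_axioms]
  have skew: "bracket A b a \<oplus>\<^bsub>A\<^esub> bracket A a b = \<zero>\<^bsub>A\<^esub>" if "a \<in> carrier A" "b \<in> carrier A" for a b
  proof -
    have "bracket A (a \<oplus>\<^bsub>A\<^esub> b) (a \<oplus>\<^bsub>A\<^esub> b) = bracket A b a \<oplus>\<^bsub>A\<^esub> bracket A a b"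
      using that by (simp add: linear_map_add[OF bilinear_map_left[OF br]]
          linear_map_add[OF bilinear_map_right[OF br]] alt[OF that(1)] alt[OF that(2)])
    then show ?thesis using alt[of "a \<oplus>\<^bsub>A\<^esub> b"] that by simp
  qed
  have lie_unit: "lie_act M b n = act M (bracket A b \<one>\<^bsub>A\<^esub>) n" if b: "b \<in> carrier A" for b
  proof -
    let ?x = "act M (bracket A \<one>\<^bsub>A\<^esub> b) n" and ?y = "act M (bracket A b \<one>\<^bsub>A\<^esub>) n"
    have "?y \<oplus>\<^bsub>M\<^esub> ?x = act M \<zero>\<^bsub>A\<^esub> n"
      using b n by (simp add: aadd[symmetric] skew)
    then have yx: "?y \<oplus>\<^bsub>M\<^esub> ?x = \<zero>\<^bsub>M\<^esub>"
      using linear_map_zero[OF algebra.module[OF alg] M' bilinear_map_left[OF ab n]] by simp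
    have "?x \<oplus>\<^bsub>M\<^esub> ?x = ?x \<ominus>\<^bsub>M\<^esub> lie_act M b n"
      using ax1[of "\<one>\<^bsub>A\<^esub>" b n] b n by (simp add: two one unit)
    then have "?x = \<ominus>\<^bsub>M\<^esub> lie_act M b n"
      using b n by (simp add: M.M.minus_eq)
    then have "lie_act M b n = \<ominus>\<^bsub>M\<^esub> ?x"
      using b n by simp
    also have "\<dots> = ?y"
      using yx b n by (simp add: M.M.minus_equality)
    finally show ?thesis .
  qed
  show ?thesis
    unfolding module_center_def
  proof (intro CollectI conjI ballI n)
    fix a b assume a: "a \<in> carrier A" and b: "b \<in> carrier A"
    let ?z = "act M (bracket A (b \<otimes>\<^bsub>A\<^esub> a) \<one>\<^bsub>A\<^esub>) n"
    have "?z \<oplus>\<^bsub>M\<^esub> lie_act M a (act M b n) = [(2::nat)] \<cdot>\<^bsub>M\<^esub> act M b (lie_act M a n)"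
      using ax2[OF b a n] a b n by (simp add: lie_unit)
    also have "\<dots> = act M ([(2::nat)] \<cdot>\<^bsub>A\<^esub> (b \<otimes>\<^bsub>A\<^esub> bracket A a \<one>\<^bsub>A\<^esub>)) n"
      using a b n by (simp add: two lie_unit aadd amult)
    also have "\<dots> = ?z \<oplus>\<^bsub>M\<^esub> act M (bracket A a b) n"
      using a b n by (simp add: tp aadd)
    finally show "act M (bracket A a b) n = lie_act M a (act M b n)"
      using a b n by simp
  qed
qed

text \<open>
  Likewise for \<open>A\<^sup>A\<close>: the criterion and \<open>2p{1,a} = {p,a} + {1,pa}\<close> yield \<open>{p,a} = p{1,a}\<close>, and then
  \<open>{pa,c} = 2a{p,c} - {p,ac} = p(2a{1,c} - {1,ac}) = p{a,c}\<close>.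
\<close>

lemma transposed_poisson_centerI:
  assumes A: "transposed_poisson_algebra K A" and p: "p \<in> carrier A"
    and unit: "\<And>a. a \<in> carrier A \<Longrightarrow> bracket A \<one>\<^bsub>A\<^esub> a \<otimes>\<^bsub>A\<^esub> p = bracket A \<one>\<^bsub>A\<^esub> (a \<otimes>\<^bsub>A\<^esub> p)"
  shows "p \<in> transposed_poisson_center A"
proof -
  have alg: "algebra K A" and br: "bilinear_map K A A A (bracket A)"
    and tp: "\<And>a b c. a \<in> carrier A \<Longrightarrow> b \<in> carrier A \<Longrightarrow> c \<in> carrier A \<Longrightarrow>
        [(2::nat)] \<cdot>\<^bsub>A\<^esub> (a \<otimes>\<^bsub>A\<^esub> bracket A b c) =
        bracket A (a \<otimes>\<^bsub>A\<^esub> b) c \<oplus>\<^bsub>A\<^esub> bracket A b (a \<otimes>\<^bsub>A\<^esub> c)"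
    using A by (auto simp: transposed_poisson_algebra_def lie_bracket_def)
  interpret A: cring A using alg by (rule algebra.M_cring)
  have brc [simp]: "bracket A a b \<in> carrier A" if "a \<in> carrier A" "b \<in> carrier A" for a b
    using bilinear_map_closed[OF br that] .
  note two = add_pow_two[OF A.abelian_group_axioms]
  have bracket_p: "bracket A p a = p \<otimes>\<^bsub>A\<^esub> bracket A \<one>\<^bsub>A\<^esub> a" if a: "a \<in> carrier A" for a
    using tp[OF p A.one_closed a] unit[OF a] a p by (simp add: two A.m_comm)
  show ?thesis
    unfolding transposed_poisson_center_def
  proof (intro CollectI conjI ballI p)
    fix a c assume a: "a \<in> carrier A" and c: "c \<in> carrier A"
    let ?z = "p \<otimes>\<^bsub>A\<^esub> bracket A \<one>\<^bsub>A\<^esub> (a \<otimes>\<^bsub>A\<^esub> c)"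
    have "bracket A (p \<otimes>\<^bsub>A\<^esub> a) c \<oplus>\<^bsub>A\<^esub> ?z = [(2::nat)] \<cdot>\<^bsub>A\<^esub> (a \<otimes>\<^bsub>A\<^esub> bracket A p c)"
      using tp[OF a p c] a c p by (simp add: bracket_p A.m_comm[of p a])
    also have "\<dots> = p \<otimes>\<^bsub>A\<^esub> ([(2::nat)] \<cdot>\<^bsub>A\<^esub> (a \<otimes>\<^bsub>A\<^esub> bracket A \<one>\<^bsub>A\<^esub> c))"
      using a c p by (simp add: two bracket_p A.r_distr A.m_lcomm)
    also have "\<dots> = p \<otimes>\<^bsub>A\<^esub> bracket A a c \<oplus>\<^bsub>A\<^esub> ?z"
      using a c p by (simp add: tp A.r_distr)
    finally show "p \<otimes>\<^bsub>A\<^esub> bracket A a c = bracket A (p \<otimes>\<^bsub>A\<^esub> a) c"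
      using a c p by simp
  qed
qed

section \<open>Relative projectivity\<close>

lemma comodule_algebra_with_map_tpa:
  assumes "hopf_algebra K H" "bijective_antipode H" "comodule_transposed_poisson_algebra K H A"
    and "comodule_algebra_map K H A \<phi>"
  shows "comodule_algebra_with_map K H A (alg_coact A) \<phi>"
  using assms
  by (intro comodule_algebra_with_map.intro bijective_hopf_algebra.intro
      comodule_algebra_with_map_axioms.intro)
     (auto simp: comodule_transposed_poisson_algebra_def transposed_poisson_algebra_def
       comodule_algebra_map_def colinear_map_def)

lemma relative_hopf_module_tpa:
  assumes "comodule_algebra_with_map K H A (alg_coact A) \<phi>" "transposed_poisson_hopf_module K H A M"
  shows "relative_hopf_module K H A (alg_coact A) \<phi> M (act M) (coact M)"
proof -
  interpret comodule_algebra_with_map K H A "alg_coact A" \<phi> by fact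
  show ?thesis
    using assms(2)
    by unfold_locales
       (auto simp: transposed_poisson_hopf_module_def transposed_poisson_module_def)
qed

lemma bilinear_map_cong:
  assumes "bilinear_map K U V W \<gamma>" "module K U" "module K V"
    and "\<And>u v. u \<in> carrier U \<Longrightarrow> v \<in> carrier V \<Longrightarrow> \<beta> u v = \<gamma> u v"
  shows "bilinear_map K U V W \<beta>"
  using assms
  by (auto intro!: bilinear_mapI intro: linear_map_cong[OF bilinear_map_left] linear_map_cong[OF bilinear_map_right])

lemma tensor_lift_pure:
  assumes "module K V" "module K W" "module K U" "bilinear_map K V W U \<beta>"
    and "v \<in> carrier V" "w \<in> carrier W"
  shows "tensor_lift U \<beta> (pure K V W v w) = \<beta> v w"
  using assms by (simp add: tensor_lift_eq_sw sw_pure)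

lemma G_carrier:
  "carrier (G_obj K H A M) =
   {m \<in> module_center A M. m \<in> carrier M \<and> coact M m = pure K M H m \<one>\<^bsub>H\<^esub>}"
  by (auto simp: G_obj_def coinvariants_def)

text \<open>Morphisms restrict to the values of \<open>G\<close>.\<close>

lemma hopf_module_hom_G_closed:
  assumes H: "module K H"
    and M: "transposed_poisson_hopf_module K H A M" and N: "transposed_poisson_hopf_module K H A N"
    and A: "transposed_poisson_algebra K A"
    and f: "hopf_module_hom K H A M N f" and n: "n \<in> carrier (G_obj K H A M)" and one: "\<one>\<^bsub>H\<^esub> \<in> carrier H"
  shows "f n \<in> carrier (G_obj K H A N)"
proof -
  have mM: "module K M" and mN: "module K N"
    and ab: "bilinear_map K A M M (act M)" and br: "bilinear_map K A A A (bracket A)"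
    using M N A by (auto simp: transposed_poisson_hopf_module_def transposed_poisson_module_def
        transposed_poisson_algebra_def lie_bracket_def)
  have lf: "linear_map K M N f" and cf: "\<And>m. m \<in> carrier M \<Longrightarrow> coact N (f m) = tensor_map K N H f id (coact M m)"
    and af: "\<And>a m. a \<in> carrier A \<Longrightarrow> m \<in> carrier M \<Longrightarrow> f (act M a m) = act N a (f m)"
    and lief: "\<And>a m. a \<in> carrier A \<Longrightarrow> m \<in> carrier M \<Longrightarrow> f (lie_act M a m) = lie_act N a (f m)"
    using f by (auto simp: hopf_module_hom_def colinear_map_def)
  have n': "n \<in> carrier M" "n \<in> module_center A M" "coact M n = pure K M H n \<one>\<^bsub>H\<^esub>"
    using n by (auto simp: G_carrier)
  have fn: "f n \<in> carrier N" by (rule linear_map_closed[OF lf n'(1)])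
  have "bilinear_map K M H (tensor K N H) (\<lambda>v w. pure K N H (f v) w)"
    by (intro bilinear_mapI lin_intros lf mN H linear_map_closed[OF lf])
  then have "coact N (f n) = pure K N H (f n) \<one>\<^bsub>H\<^esub>"
    using n' one tensor_module[OF mN H]
    by (simp add: cf tensor_map_def tensor_lift_pure[OF mM H])
  moreover have "act N (bracket A a b) (f n) = lie_act N a (act N b (f n))"
    if "a \<in> carrier A" "b \<in> carrier A" for a b
  proof -
    have "act N (bracket A a b) (f n) = f (act M (bracket A a b) n)"
      using that n' bilinear_map_closed[OF br] by (simp add: af)
    also have "\<dots> = f (lie_act M a (act M b n))"
      using that n' by (simp add: module_center_def)
    also have "\<dots> = lie_act N a (act N b (f n))"
      using that n' bilinear_map_closed[OF ab] by (simp add: af lief)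
    finally show ?thesis .
  qed
  ultimately show ?thesis
    using fn by (auto simp: G_carrier module_center_def)
qed

text \<open>
  Here \<open>s\<close> is the \<open>B\<close>-linear section of \<open>G(p)\<close>, and the lift of \<open>f\<close> along \<open>p: C \<rightarrow> C'\<close> is the extension
  of \<open>q = s \<circ> f \<circ> p\<^sub>P\<close>.
\<close>

lemma hopf_module_G_relative_projective:
  fixes A :: "('k, 'a, 'h) comodule_tpa" and P :: "('k, 'a, 'h, 'm) hopf_mod"
  assumes hopf: "hopf_algebra K H" "bijective_antipode H"
    and tpa: "comodule_transposed_poisson_algebra K H A"
    and \<phi>: "comodule_algebra_map K H A \<phi>"
    and P: "transposed_poisson_hopf_module K H A P"
    and mc: "module_condition H A P \<phi>" and ac: "algebra_condition H A \<phi>"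
  shows "G_relative_projective K H A P"
proof -
  have A: "transposed_poisson_algebra K A" and br: "bilinear_map K A A A (bracket A)"
    using tpa by (auto simp: comodule_transposed_poisson_algebra_def transposed_poisson_algebra_def lie_bracket_def)
  have P': "transposed_poisson_module K A P" and lieP: "bilinear_map K A P P (lie_act P)"
    using P by (auto simp: transposed_poisson_hopf_module_def transposed_poisson_module_def)
  note base = comodule_algebra_with_map_tpa[OF hopf tpa \<phi>]
  interpret P: relative_hopf_module K H A "alg_coact A" \<phi> P "act P" "coact P"
    by (rule relative_hopf_module_tpa[OF base P])
  note br_closed [simp] = bilinear_map_closed[OF br]
  note br_linear = bilinear_map_comp_left[OF br] bilinear_map_comp_right[OF br]
  note lie_linear = bilinear_map_comp_left[OF lieP] bilinear_map_comp_right[OF lieP]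

  have p_module [simp]: "p_module H \<phi> P m = P.proj m" if "m \<in> carrier P" for m
    using that by (simp add: p_module_def P.proj_eq_tensor_lift)
  have p_algebra [simp]: "p_algebra H A \<phi> a = P.A.proj a" if "a \<in> carrier A" for a
    using that by (simp add: p_algebra_def P.A.proj_eq_tensor_lift)

  have proj_center: "P.proj m \<in> module_center A P" if m: "m \<in> carrier P" for m
  proof (rule module_centerI[OF A P' P.proj_closed[OF m]])
    \<comment> \<open>The criterion is the hypothesis on \<open>p\<^sub>P\<close> at \<open>a' = 1\<close>, as \<open>1\<close> has coaction \<open>1 \<otimes> 1\<close> and \<open>\<phi>(1) = 1\<close>.\<close>
    fix a assume a: "a \<in> carrier A"
    let ?\<beta> = "\<lambda>a\<^sub>0 a\<^sub>1. lie_act P (\<phi> a\<^sub>1) (act P a (p_module H \<phi> P (act P a\<^sub>0 m)))"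
    have "bilinear_map K A H P (\<lambda>a\<^sub>0 a\<^sub>1. lie_act P (\<phi> a\<^sub>1) (act P a (P.proj (act P a\<^sub>0 m))))"
      using a m by (intro bilinear_mapI lin_intros lie_linear) auto
    then have "bilinear_map K A H P ?\<beta>"
      by (rule bilinear_map_cong) (use m in auto)
    then have "tensor_lift P ?\<beta> (alg_coact A \<one>\<^bsub>A\<^esub>) = lie_act P \<one>\<^bsub>A\<^esub> (act P a (P.proj m))"
      using m by (simp add: P.A_coact_one tensor_lift_pure[OF P.A_module P.H_module P.M_module])
    moreover have "act P (bracket A \<one>\<^bsub>A\<^esub> (a \<otimes>\<^bsub>A\<^esub> \<one>\<^bsub>A\<^esub>)) (p_module H \<phi> P m) = tensor_lift P ?\<beta> (alg_coact A \<one>\<^bsub>A\<^esub>)"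
      using mc a m unfolding module_condition_def by blast
    ultimately show "act P (bracket A \<one>\<^bsub>A\<^esub> a) (P.proj m) = lie_act P \<one>\<^bsub>A\<^esub> (act P a (P.proj m))"
      using a m by simp
  qed
  have proj_A_center: "P.A.proj b \<in> transposed_poisson_center A" if b: "b \<in> carrier A" for b
  proof (rule transposed_poisson_centerI[OF A P.A.proj_closed[OF b]])
    fix a assume a: "a \<in> carrier A"
    let ?\<beta> = "\<lambda>a\<^sub>0 a\<^sub>1. bracket A (\<phi> a\<^sub>1) (a \<otimes>\<^bsub>A\<^esub> p_algebra H A \<phi> (a\<^sub>0 \<otimes>\<^bsub>A\<^esub> b))"
    have "bilinear_map K A H A (\<lambda>a\<^sub>0 a\<^sub>1. bracket A (\<phi> a\<^sub>1) (a \<otimes>\<^bsub>A\<^esub> P.A.proj (a\<^sub>0 \<otimes>\<^bsub>A\<^esub> b)))"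
      using a b by (intro bilinear_mapI lin_intros br_linear) auto
    then have "bilinear_map K A H A ?\<beta>"
      by (rule bilinear_map_cong) (use b in auto)
    then have "tensor_lift A ?\<beta> (alg_coact A \<one>\<^bsub>A\<^esub>) = bracket A \<one>\<^bsub>A\<^esub> (a \<otimes>\<^bsub>A\<^esub> P.A.proj b)"
      using b by (simp add: P.A_coact_one tensor_lift_pure[OF P.A_module P.H_module P.A_module])
    moreover have "bracket A \<one>\<^bsub>A\<^esub> (a \<otimes>\<^bsub>A\<^esub> \<one>\<^bsub>A\<^esub>) \<otimes>\<^bsub>A\<^esub> p_algebra H A \<phi> b = tensor_lift A ?\<beta> (alg_coact A \<one>\<^bsub>A\<^esub>)"
      using ac a b unfolding algebra_condition_def by blast
    ultimately show "bracket A \<one>\<^bsub>A\<^esub> a \<otimes>\<^bsub>A\<^esub> P.A.proj b = bracket A \<one>\<^bsub>A\<^esub> (a \<otimes>\<^bsub>A\<^esub> P.A.proj b)"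
      using a b by simp
  qed
  have proj_G: "P.proj m \<in> carrier (G_obj K H A P)" if "m \<in> carrier P" for m
    using that by (simp add: G_carrier proj_center P.coact_proj)
  have proj_B: "P.A.proj b \<in> carrier (coinv_algebra K H A)" if "b \<in> carrier A" for b
    using that proj_A_center by (simp add: coinv_algebra_def coinvariants_def P.A.coact_proj)
  have scalar_B: "c \<odot>\<^bsub>A\<^esub> \<one>\<^bsub>A\<^esub> \<in> carrier (coinv_algebra K H A)" if c: "c \<in> carrier K" for c
  proof -
    have "alg_coact A (c \<odot>\<^bsub>A\<^esub> \<one>\<^bsub>A\<^esub>) = pure K A H (c \<odot>\<^bsub>A\<^esub> \<one>\<^bsub>A\<^esub>) \<one>\<^bsub>H\<^esub>"
      using c by (simp add: linear_map_smult[OF P.A.coact_linear] P.A_coact_one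
          linear_map_smult[OF bilinear_map_left[OF pure_bilinear]])
    then show ?thesis
      using c by (auto simp: coinv_algebra_def coinvariants_def transposed_poisson_center_def
          P.A_smult_mult_left linear_map_smult[OF bilinear_map_left[OF br]])
  qed

  show ?thesis
    unfolding G_relative_projective_def
  proof (intro allI impI, elim conjE exE)
    fix C C' :: "('k, 'a, 'h, 'm) hopf_mod" and p s f
    assume C: "transposed_poisson_hopf_module K H A C"
      and C': "transposed_poisson_hopf_module K H A C'"
      and p: "hopf_module_hom K H A C C' p" and f: "hopf_module_hom K H A P C' f"
      and s: "linear_map (coinv_algebra K H A) (G_obj K H A C') (G_obj K H A C) s"
      and ps: "\<forall>x\<in>carrier (G_obj K H A C'). G_mor K H A C p (s x) = x"
    interpret C: relative_hopf_module K H A "alg_coact A" \<phi> C "act C" "coact C"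
      by (rule relative_hopf_module_tpa[OF base C])
    interpret C': relative_hopf_module K H A "alg_coact A" \<phi> C' "act C'" "coact C'"
      by (rule relative_hopf_module_tpa[OF base C'])
    have lieC: "bilinear_map K A C C (lie_act C)"
      using C by (auto simp: transposed_poisson_hopf_module_def transposed_poisson_module_def)
    note lie_linear' = bilinear_map_comp_left[OF lieC] bilinear_map_comp_right[OF lieC]
    have f_lin: "linear_map K P C' f"
      and f_act: "\<And>a m. a \<in> carrier A \<Longrightarrow> m \<in> carrier P \<Longrightarrow> f (act P a m) = act C' a (f m)"
      using f by (auto simp: hopf_module_hom_def colinear_map_def)
    have p_lin: "linear_map K C C' p"
      and p_act: "\<And>a m. a \<in> carrier A \<Longrightarrow> m \<in> carrier C \<Longrightarrow> p (act C a m) = act C' a (p m)"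
      using p by (auto simp: hopf_module_hom_def colinear_map_def)
    have f_G: "f n \<in> carrier (G_obj K H A C')" if "n \<in> carrier (G_obj K H A P)" for n
      using hopf_module_hom_G_closed[OF P.H_module P C' A f that] by simp
    have s_G: "s n \<in> carrier (G_obj K H A C)" if "n \<in> carrier (G_obj K H A C')" for n
      by (rule linear_map_closed[OF s that])
    have s_add: "s (x \<oplus>\<^bsub>C'\<^esub> y) = s x \<oplus>\<^bsub>C\<^esub> s y"
      if "x \<in> carrier (G_obj K H A C')" "y \<in> carrier (G_obj K H A C')" for x y
      using linear_map_add[OF s that] by (simp add: G_obj_def)
    have s_act: "s (act C' b x) = act C b (s x)"
      if "b \<in> carrier (coinv_algebra K H A)" "x \<in> carrier (G_obj K H A C')" for b x
      using linear_map_smult[OF s that] by (simp add: G_obj_def)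
    have p_s: "p (s x) = x" if "x \<in> carrier (G_obj K H A C')" for x
      using bspec[OF ps that] s_G[OF that] by (simp add: G_mor_def)

    define q where "q = (\<lambda>m. s (f (P.proj m)))"
    note fp_G = f_G[OF proj_G]
    note q_G = s_G[OF fp_G]
    have q_C: "s (f (P.proj m)) \<in> carrier C" if "m \<in> carrier P" for m
      using q_G[OF that] by (simp add: G_carrier)
    have fp_lin: "linear_map K P C' (\<lambda>m. f (P.proj m))"
      by (intro linear_map_compose[OF f_lin] lin_intros)
    have q_lin: "linear_map K P C q"
      unfolding q_def
    proof (rule linear_mapI)
      fix c x assume c: "c \<in> carrier K" and x: "x \<in> carrier P"
      \<comment> \<open>\<open>K\<close> acts through \<open>c \<mapsto> c 1\<^sub>A\<close>, and \<open>c 1\<^sub>A\<close> lies in \<open>B\<close>.\<close>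
      have "s (f (P.proj (c \<odot>\<^bsub>P\<^esub> x))) = s (act C' (c \<odot>\<^bsub>A\<^esub> \<one>\<^bsub>A\<^esub>) (f (P.proj x)))"
        using c x linear_map_closed[OF fp_lin] by (simp add: linear_map_smult[OF fp_lin] C'.act_smult_one)
      also have "\<dots> = c \<odot>\<^bsub>C\<^esub> s (f (P.proj x))"
        using c x by (simp add: s_act scalar_B fp_G C.act_smult_one q_C)
      finally show "s (f (P.proj (c \<odot>\<^bsub>P\<^esub> x))) = c \<odot>\<^bsub>C\<^esub> s (f (P.proj x))" .
    qed (simp_all add: q_C linear_map_add[OF fp_lin] s_add fp_G)
    interpret coinvariant_extension K H A "alg_coact A" \<phi> P "act P" "coact P" C "act C" "coact C" q
    proof unfold_locales
      show "linear_map K P C q" by (rule q_lin)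
      show "coact C (q m) = pure K C H (q m) \<one>\<^bsub>H\<^esub>" if "m \<in> carrier P" for m
        using q_G[OF that] by (simp add: G_carrier q_def)
      show "q (act P a m) = act C (P.A.proj a) (q m)" if "a \<in> carrier A" "m \<in> carrier P" for a m
        using that by (simp add: q_def P.proj_act f_act s_act proj_B fp_G)
    qed
    have ext_proj: "ext (P.proj m) = q m" if m: "m \<in> carrier P" for m
    proof -
      have "q (P.proj m) = q m"
        using m by (simp add: q_def P.coact_proj P.proj_coinvariant)
      then show ?thesis
        using m by (simp add: ext_coinvariant P.coact_proj)
    qed
    \<comment> \<open>On \<open>P\<^sup>A\<close> and \<open>C\<^sup>A\<close> the Lie action is \<open>a \<diamond> (b n) = {a,b} n\<close>, so that \<open>A\<close>-linearity suffices.\<close>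
    have ext_lie: "ext (lie_act P a m) = lie_act C a (ext m)" if a: "a \<in> carrier A" and m: "m \<in> carrier P" for a m
    proof -
      have "lie_act P a m = lie_act P a (sw P (coact P m) (\<lambda>m\<^sub>0 m\<^sub>1. act P (\<phi> m\<^sub>1) (P.proj m\<^sub>0)))"
        using m by (simp add: P.sum_proj)
      also have "\<dots> = sw P (coact P m) (\<lambda>m\<^sub>0 m\<^sub>1. lie_act P a (act P (\<phi> m\<^sub>1) (P.proj m\<^sub>0)))"
        using a m by (intro P.M_sum_linear[where L="\<lambda>z. lie_act P a z"] lin_intros lie_linear) auto
      also have "\<dots> = sw P (coact P m) (\<lambda>m\<^sub>0 m\<^sub>1. act P (bracket A a (\<phi> m\<^sub>1)) (P.proj m\<^sub>0))"
        using a m proj_center by (intro P.M_sum_cong) (auto simp: module_center_def)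
      finally have "ext (lie_act P a m) =
          ext (sw P (coact P m) (\<lambda>m\<^sub>0 m\<^sub>1. act P (bracket A a (\<phi> m\<^sub>1)) (P.proj m\<^sub>0)))" by simp
      also have "\<dots> = sw C (coact P m) (\<lambda>m\<^sub>0 m\<^sub>1. ext (act P (bracket A a (\<phi> m\<^sub>1)) (P.proj m\<^sub>0)))"
        using a m by (intro P.M_sum_linear ext_linear) auto
      also have "\<dots> = sw C (coact P m) (\<lambda>m\<^sub>0 m\<^sub>1. act C (bracket A a (\<phi> m\<^sub>1)) (q m\<^sub>0))"
        using a m by (intro P.M_sum_cong) (auto simp: ext_act ext_proj)
      also have "\<dots> = sw C (coact P m) (\<lambda>m\<^sub>0 m\<^sub>1. lie_act C a (act C (\<phi> m\<^sub>1) (q m\<^sub>0)))"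
        using a m q_G by (intro P.M_sum_cong) (auto simp: G_carrier module_center_def q_def)
      also have "\<dots> = lie_act C a (ext m)"
        unfolding ext_def using a m
        by (intro P.M_sum_linear[where L="\<lambda>z. lie_act C a z", symmetric] lin_intros lie_linear') auto
      finally show ?thesis .
    qed
    have "p (ext m) = f m" if m: "m \<in> carrier P" for m
    proof -
      have "p (ext m) = sw C' (coact P m) (\<lambda>m\<^sub>0 m\<^sub>1. p (act C (\<phi> m\<^sub>1) (q m\<^sub>0)))"
        unfolding ext_def using m by (intro P.M_sum_linear p_lin) auto
      also have "\<dots> = sw C' (coact P m) (\<lambda>m\<^sub>0 m\<^sub>1. f (act P (\<phi> m\<^sub>1) (P.proj m\<^sub>0)))"
        using m by (intro P.M_sum_cong) (auto simp: p_act f_act q_C q_def p_s fp_G)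
      also have "\<dots> = f (sw P (coact P m) (\<lambda>m\<^sub>0 m\<^sub>1. act P (\<phi> m\<^sub>1) (P.proj m\<^sub>0)))"
        using m by (intro P.M_sum_linear[symmetric] f_lin) auto
      finally show ?thesis using m by (simp add: P.sum_proj)
    qed
    moreover have "hopf_module_hom K H A P C ext"
      by (simp add: hopf_module_hom_def colinear_map_def ext_linear ext_colinear ext_act ext_lie)
    ultimately show "\<exists>g. hopf_module_hom K H A P C g \<and> (\<forall>x\<in>carrier P. p (g x) = f x)"
      by blast
  qed
qed

theorem corollary3p11:
  fixes K :: "'k ring"
    and H :: "('k, 'h) hopf"
    and A :: "('k, 'a, 'h) comodule_tpa"
  assumes "field_char_zero K"
    and "hopf_algebra K H"
    and "bijective_antipode H"
    and "comodule_transposed_poisson_algebra K H A"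
  shows
    "(\<forall>M :: ('k, 'a, 'h, 'm) hopf_mod.
        transposed_poisson_hopf_module K H A M \<and>
        (\<exists>\<phi>. comodule_algebra_map K H A \<phi> \<and> module_condition H A M \<phi> \<and> algebra_condition H A \<phi>) \<longrightarrow>
        G_relative_projective K H A M) \<and>
     ((\<forall>M :: ('k, 'a, 'h, 'm) hopf_mod.
         transposed_poisson_hopf_module K H A M \<longrightarrow>
         (\<exists>\<phi>. comodule_algebra_map K H A \<phi> \<and> module_condition H A M \<phi> \<and> algebra_condition H A \<phi>)) \<longrightarrow>
      G_dual_Maschke TYPE('m) K H A)"
  unfolding G_dual_Maschke_def
  using hopf_module_G_relative_projective[OF assms(2-4)] by blast

end
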